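(* Let $(u,\psi)\in L^{6}(\mathbb{R}^3)\times L^{3}(\mathbb{R}^3;\mathbb{C}^4)$, with $u$ real-valued, be a solution in the sense of distributions of the system $$-c_3\Delta u=|\psi|^2u,\qquad \mathcal{D}\psi=|u|^2\psi\qquad\text{on }\mathbb{R}^3,\qquad c_3=6 .$$ Then there is $C>0$ such that $$|u(x)|\le\frac{C}{1+|x|},\qquad |\psi(x)|\le\frac{C}{1+|x|^2},\qquad x\in\mathbb{R}^3 .$$ Moreover, if $u\ge 0$, then there exists $\alpha\ge 0$ such that $$\lim_{|x|\to\infty}(1+|x|)u(x)=\alpha ,$$ and if $\alpha=0$ then $u=0$ and $\psi=0$.
   Context: Scalar functions are real-valued. The spinor bundle $\Sigma\mathbb{R}^3$ is identified with the trivial bundle $\mathbb{R}^3\times\mathbb{C}^4$, so spinors are functions $\mathbb{R}^3\to\mathbb{C}^4$, and $|\psi|$ is the pointwise Hermitian norm. Let $\sigma_1,\sigma_2,\sigma_3$ be $2\times2$ Hermitian matrices with $\sigma_j\sigma_k+\sigma_k\sigma_j=2\delta_{j,k}$, and set $\alpha_j=\begin{pmatrix}0&\sigma_j\\ \sigma_j&0\end{pmatrix}$. The Dirac operator is $\mathcal{D}=-i\sum_{j=1}^3\alpha_j\partial_{x_j}$. Functions in $L^6$, $L^3$ are identified with their continuous (in fact smooth) representatives. *)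

theory Defs
  imports "HOL-Analysis.Analysis"
begin

section \<open>Lebesgue spaces\<close>

text \<open>
  Members of \<open>L\<^sup>p\<close> are represented by functions; statements about the class hold up to equality
  almost everywhere. The library norm on \<^typ>\<open>complex ^ 4\<close> is the Hermitian one.
\<close>

definition Lp_function :: "nat \<Rightarrow> (real ^ 3 \<Rightarrow> 'b::euclidean_space) \<Rightarrow> bool" where
  "Lp_function p f \<longleftrightarrow>
     f \<in> borel_measurable lebesgue \<and> integrable lebesgue (\<lambda>x. norm (f x) ^ p)"


section \<open>Test functions\<close>

definition partial :: "3 \<Rightarrow> (real ^ 3 \<Rightarrow> real) \<Rightarrow> real ^ 3 \<Rightarrow> real" where
  "partial j f x = frechet_derivative f (at x) (axis j 1)"

text \<open>
  Differentiability of all iterated partial derivatives makes each of them continuous, so this is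
  the usual class of infinitely often continuously differentiable functions.
\<close>

definition smooth :: "(real ^ 3 \<Rightarrow> real) \<Rightarrow> bool" where
  "smooth f \<longleftrightarrow> (\<forall>js. foldr partial js f differentiable_on UNIV)"

definition test_function :: "(real ^ 3 \<Rightarrow> real) \<Rightarrow> bool" where
  "test_function \<phi> \<longleftrightarrow> smooth \<phi> \<and> compact (closure {x. \<phi> x \<noteq> 0})"


section \<open>Distributions\<close>

text \<open>
  A distribution is represented by its values on test functions; values at other arguments carry
  no meaning, so equality of distributions means agreement on all test functions. Real-valued test
  functions suffice for vector-valued distributions, by linearity.
\<close>

type_synonym 'b distr = "(real ^ 3 \<Rightarrow> real) \<Rightarrow> 'b"

definition regular_distr :: "(real ^ 3 \<Rightarrow> 'b::euclidean_space) \<Rightarrow> 'b distr" where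
  "regular_distr f \<phi> = (\<integral>x. \<phi> x *\<^sub>R f x \<partial>lebesgue)"

definition distr_partial :: "3 \<Rightarrow> 'b::real_vector distr \<Rightarrow> 'b distr" where
  "distr_partial j T \<phi> = - T (partial j \<phi>)"

definition distr_laplacian :: "'b::real_vector distr \<Rightarrow> 'b distr" where
  "distr_laplacian T \<phi> = (\<Sum>j\<in>UNIV. distr_partial j (distr_partial j T) \<phi>)"

definition distr_eq :: "'b distr \<Rightarrow> 'b distr \<Rightarrow> bool" where
  "distr_eq S T \<longleftrightarrow> (\<forall>\<phi>. test_function \<phi> \<longrightarrow> S \<phi> = T \<phi>)"


section \<open>The Dirac operator\<close>

definition hermitian_matrix :: "complex ^ 'n ^ 'n \<Rightarrow> bool" where
  "hermitian_matrix A \<longleftrightarrow> (\<chi> i j. cnj (A $ j $ i)) = A"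

definition pauli_family :: "(3 \<Rightarrow> complex ^ 2 ^ 2) \<Rightarrow> bool" where
  "pauli_family \<sigma> \<longleftrightarrow>
     (\<forall>j. hermitian_matrix (\<sigma> j)) \<and>
     (\<forall>j k. \<sigma> j ** \<sigma> k + \<sigma> k ** \<sigma> j = mat (if j = k then 2 else 0))"

definition dirac_alpha :: "complex ^ 2 ^ 2 \<Rightarrow> complex ^ 4 ^ 4" where
  "dirac_alpha S = vector
     [vector [0, 0, S $ 1 $ 1, S $ 1 $ 2],
      vector [0, 0, S $ 2 $ 1, S $ 2 $ 2],
      vector [S $ 1 $ 1, S $ 1 $ 2, 0, 0],
      vector [S $ 2 $ 1, S $ 2 $ 2, 0, 0]]"

definition distr_dirac ::
    "(3 \<Rightarrow> complex ^ 2 ^ 2) \<Rightarrow> (complex ^ 4) distr \<Rightarrow> (complex ^ 4) distr" where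
  "distr_dirac \<sigma> T \<phi> = (- \<i>) *s (\<Sum>j\<in>UNIV. dirac_alpha (\<sigma> j) *v distr_partial j T \<phi>)"

end

(*
  Both equations are equivalent to integral equations with the Newtonian kernel: testing them with
  cut-off versions of the explicit functions (|x - a|^2 + e)^(-1/2) and their gradients, and letting
  e tend to 0, gives u = c |x|^(-1) * (|psi|^2 u) and psi = c (alpha x / |x|^3) * (u^2 psi).
  Hence v = |u| and f = |psi| satisfy v <= int k f^2 v and f <= int k^2 v^2 f with a multiple k of
  1 / |x - y|, and v in L^6, f in L^3 force v and f to be bounded: the Hardy-Littlewood-Sobolev
  inequality makes the first inequality a contraction up to a bounded part of f^2, which puts v into
  L^24, and the rest is subcritical. This argument only uses that k is of weak type L^3. It applies
  equally to the measure |y|^(-6) dy with the kernel |x| |y| / |x - y| and the unknowns |y| v,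
  |y|^2 f (the Kelvin transform), and this second instance is the decay at infinity.
  The limit alpha is a multiple of the integral of |psi|^2 u, so alpha = 0 makes the right-hand sides
  of the integral equations vanish when u >= 0.
*)

theory Submission
  imports Defs
begin

text \<open>Give k and v weight 1 and f weight 2. Then k f^2 v and k^2 v^2 f both have weight 6, and
  so have v^6 and f^3, the only powers known to be integrable: the system is critical. Young's
  inequality settles the part of the integrals where k is small, but k^6 is not integrable at the
  singularity, so integrability has to improve before sup bounds are possible; the near field asks
  for v^20 and f^10, which 24 and 12 cover. The kernel |x| |y| / |x - y| is not a convolution
  kernel, so the Hardy-Littlewood-Sobolev inequality is derived from superlevel sets and symmetry
  alone. For the Dirac equation, the identity that the square of the operator is minus the Laplacian
  enters through the Hessian of the regularised kernel, contracted with the matrices. The identities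
  for e > 0 hold at every point, but their limit is taken after integration over a box, where
  Fubini's theorem brings every kernel under a fixed weight; Lebesgue differentiation then removes
  the box. What results holds almost everywhere only, and the right-hand sides supply the continuous
  representatives.\<close>

text \<open>Young's inequality without its sharp constants: a weighted geometric mean is at most the
  larger of the two numbers. Interpolation of integrands is done in this form.\<close>

lemma powr_mult_powr_le_add:
  fixes a b s t :: real
  assumes "0 \<le> a" "0 \<le> b" "0 \<le> s" "0 \<le> t" "s + t = 1"
  shows "a powr s * b powr t \<le> a + b"
proof (cases "a = 0 \<or> b = 0")
  case False
  define m where "m = max a b"
  have "m > 0" using False assms by (auto simp: m_def)
  have "a powr s * b powr t \<le> m powr s * m powr t"
    using assms by (intro mult_mono powr_mono2) (auto simp: m_def)
  also have "\<dots> = m powr (s + t)" by (simp add: powr_add)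
  also have "\<dots> = m" using \<open>m > 0\<close> assms by simp
  also have "m \<le> a + b" using assms by (auto simp: m_def)
  finally show ?thesis .
qed (use assms in auto)

text \<open>Multiplication in ennreal is continuous except at the pairs of 0 and infinity, and
  \<open>l\<close>, \<open>l ^ n\<close> never form such a pair.\<close>

lemma tendsto_power_ennreal:
  fixes f :: "'a \<Rightarrow> ennreal"
  assumes "(f \<longlongrightarrow> l) F"
  shows "((\<lambda>x. f x ^ n) \<longlongrightarrow> l ^ n) F"
proof (induction n)
  case (Suc n)
  have "\<not> ((l = 0 \<and> l ^ n = \<infinity>) \<or> (l = \<infinity> \<and> l ^ n = 0))"
    by (cases n) (auto simp: ennreal_top_eq_mult_iff power_eq_0_iff)
  then show ?case
    unfolding power_Suc by (intro tendsto_mult_ennreal assms Suc)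
qed simp

lemma summand_le_suminf_ennreal: "f n \<le> (\<Sum>n. f n)" for f :: "nat \<Rightarrow> ennreal"
  using sum_le_suminf[of f "{n}"] by (simp add: summableI)

subsection \<open>Functions in weak \<open>L\<^sup>3\<close>\<close>

text \<open>The sum of a geometric series: the layer with m between g / 2^(n+1) and g / 2^n
  contributes at most 8 A g^(\<rho> - 3) (2^(3 - \<rho>))^n. The 8 is the cost of using the weak
  bound at the lower end of the layer.\<close>

definition weak_low_const :: "real \<Rightarrow> real \<Rightarrow> real" where
  "weak_low_const A \<rho> = 8 * A / (1 - 2 powr (3 - \<rho>))"

text \<open>The layers now run upwards from g; taking the value of m at the upper end of a layer
  costs 2^\<rho>, and the ratio 2^(\<rho> - 3) is below 1 for \<rho> < 3.\<close>

definition weak_high_const :: "real \<Rightarrow> real \<Rightarrow> real" where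
  "weak_high_const A \<rho> = 2 powr \<rho> * A / (1 - 2 powr (\<rho> - 3))"

lemma weak_low_const_nonneg: "A \<ge> 0 \<Longrightarrow> \<rho> > 3 \<Longrightarrow> weak_low_const A \<rho> \<ge> 0"
  unfolding weak_low_const_def using powr_less_mono[of "3 - \<rho>" 0 2] by auto

lemma weak_high_const_nonneg: "A \<ge> 0 \<Longrightarrow> \<rho> < 3 \<Longrightarrow> weak_high_const A \<rho> \<ge> 0"
  unfolding weak_high_const_def using powr_less_mono[of "\<rho> - 3" 0 2] by auto

text \<open>Superlevel sets stand in for disjoint layers: where h is positive, a single n already
  gives h \<le> c n with l n < m, so h lies below the series of all c n times indicators, and the
  weak bound is summed term by term.\<close>

lemma weak_layer_sum:
  fixes m :: "'a \<Rightarrow> real" and c l :: "nat \<Rightarrow> real"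
  assumes [measurable]: "m \<in> borel_measurable M"
    and weak: "\<And>t. t > 0 \<Longrightarrow> emeasure M {x \<in> space M. t < m x} \<le> ennreal (A / t ^ 3)"
    and "\<And>n. c n \<ge> 0" "\<And>n. l n > 0" "A \<ge> 0"
    and "(\<lambda>n. c n * (A / l n ^ 3)) sums S"
    and pt: "\<And>x. x \<in> space M \<Longrightarrow> h x > 0 \<Longrightarrow> \<exists>n. h x \<le> c n \<and> l n < m x"
  shows "(\<integral>\<^sup>+x. ennreal (h x) \<partial>M) \<le> ennreal S"
proof -
  have "(\<integral>\<^sup>+x. ennreal (h x) \<partial>M)
      \<le> (\<integral>\<^sup>+x. (\<Sum>n. ennreal (c n) * indicator {x \<in> space M. l n < m x} x) \<partial>M)"
  proof (intro nn_integral_mono)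
    fix x assume x: "x \<in> space M"
    show "ennreal (h x) \<le> (\<Sum>n. ennreal (c n) * indicator {x \<in> space M. l n < m x} x)"
    proof (cases "h x > 0")
      case True
      then obtain n where n: "h x \<le> c n" "l n < m x" using pt[OF x] by blast
      have "ennreal (h x) \<le> ennreal (c n) * indicator {x \<in> space M. l n < m x} x"
        using n x by (auto intro!: ennreal_leI)
      also have "\<dots> \<le> (\<Sum>n. ennreal (c n) * indicator {x \<in> space M. l n < m x} x)"
        by (rule summand_le_suminf_ennreal)
      finally show ?thesis .
    qed (simp add: ennreal_neg)
  qed
  also have "\<dots> = (\<Sum>n. \<integral>\<^sup>+x. ennreal (c n) * indicator {x \<in> space M. l n < m x} x \<partial>M)"
    by (intro nn_integral_suminf) measurable
  also have "\<dots> = (\<Sum>n. ennreal (c n) * emeasure M {x \<in> space M. l n < m x})"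
    by (simp add: nn_integral_cmult_indicator)
  also have "\<dots> \<le> (\<Sum>n. ennreal (c n * (A / l n ^ 3)))"
  proof (intro suminf_le summableI)
    fix n
    have "ennreal (c n) * emeasure M {x \<in> space M. l n < m x} \<le> ennreal (c n) * ennreal (A / l n ^ 3)"
      using assms by (intro mult_left_mono weak) auto
    also have "\<dots> = ennreal (c n * (A / l n ^ 3))"
      using assms by (intro ennreal_mult[symmetric] divide_nonneg_nonneg zero_le_power) (auto simp: less_imp_le)
    finally show "ennreal (c n) * emeasure M {x \<in> space M. l n < m x} \<le> ennreal (c n * (A / l n ^ 3))" .
  qed
  also have "\<dots> = ennreal S"
    using assms by (intro suminf_ennreal_eq) (auto intro!: mult_nonneg_nonneg divide_nonneg_pos simp: less_imp_le)
  finally show ?thesis .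
qed

text \<open>Powers above 3 are integrable where m is small, powers below 3 where m is large. These
  two halves are all the information that is drawn from the weak type.\<close>

lemma nn_integral_weak_low:
  fixes m :: "'a \<Rightarrow> real"
  assumes [measurable]: "m \<in> borel_measurable M"
    and nn: "\<And>x. m x \<ge> 0"
    and weak: "\<And>t. t > 0 \<Longrightarrow> emeasure M {x \<in> space M. t < m x} \<le> ennreal (A / t ^ 3)"
    and "A \<ge> 0" "\<rho> > 3" "g > 0"
  shows "(\<integral>\<^sup>+x. ennreal (if m x \<le> g then m x powr \<rho> else 0) \<partial>M)
    \<le> ennreal (weak_low_const A \<rho> * g powr (\<rho> - 3))"
proof (rule weak_layer_sum[OF assms(1) weak, where c = "\<lambda>n. (g / 2 ^ n) powr \<rho>" and l = "\<lambda>n. g / 2 ^ Suc n"])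
  define r where "r = (2::real) powr (3 - \<rho>)"
  have r: "0 < r" "r < 1"
    using assms powr_less_mono[of "3 - \<rho>" 0 2] by (auto simp: r_def)
  have eq: "(g / 2 ^ n) powr \<rho> * (A / (g / 2 ^ Suc n) ^ 3) = 8 * A * g powr (\<rho> - 3) * r ^ n" for n
  proof -
    have "r ^ n = (2 powr (3 - \<rho>)) powr n" by (simp add: r_def powr_realpow)
    also have "\<dots> = (2 powr n) powr (3 - \<rho>)" by (simp add: powr_powr mult.commute)
    also have "\<dots> = (2 ^ n) powr (3 - \<rho>)" by (simp add: powr_realpow)
    also have "\<dots> = (2 ^ n) ^ 3 / (2 ^ n) powr \<rho>"
      by (simp add: powr_diff)
    finally have 1: "r ^ n = (2 ^ n) ^ 3 / (2 ^ n) powr \<rho>" .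
    have 2: "g powr (\<rho> - 3) = g powr \<rho> / g ^ 3" using assms by (simp add: powr_diff)
    show ?thesis unfolding 1 2 using assms
      by (simp add: powr_divide field_simps power_mult_distrib)
  qed
  have "(\<lambda>n. 8 * A * g powr (\<rho> - 3) * r ^ n) sums (8 * A * g powr (\<rho> - 3) * (1 / (1 - r)))"
    using r by (intro sums_mult geometric_sums) auto
  then show "(\<lambda>n. (g / 2 ^ n) powr \<rho> * (A / (g / 2 ^ Suc n) ^ 3)) sums (weak_low_const A \<rho> * g powr (\<rho> - 3))"
    unfolding eq by (simp add: weak_low_const_def r_def)
next
  fix x assume *: "0 < (if m x \<le> g then m x powr \<rho> else 0)"
  then have mx: "m x \<le> g" "m x > 0" using nn[of x] by (auto split: if_splits)
  have "\<exists>n. g / 2 ^ Suc n < m x"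
  proof -
    obtain n where "g / m x < 2 ^ n" using real_arch_pow[of 2 "g / m x"] by auto
    then have "g < m x * 2 ^ n" using mx by (simp add: field_simps)
    also have "\<dots> \<le> m x * 2 ^ Suc n" using mx by simp
    finally show ?thesis by (intro exI[of _ n]) (simp add: field_simps)
  qed
  \<comment> \<open>Minimality of n is the upper bound on m x; for n = 0 that bound is m x \<le> g
    itself.\<close>
  define n where "n = (LEAST n. g / 2 ^ Suc n < m x)"
  have n1: "g / 2 ^ Suc n < m x" unfolding n_def by (rule LeastI_ex) fact
  have n2: "m x \<le> g / 2 ^ n"
  proof (cases n)
    case (Suc k)
    then have "\<not> g / 2 ^ Suc k < m x" using not_less_Least[of k "\<lambda>n. g / 2 ^ Suc n < m x"] unfolding n_def by auto
    then show ?thesis using Suc by simp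
  qed (use mx in auto)
  have "m x powr \<rho> \<le> (g / 2 ^ n) powr \<rho>"
    using mx n2 assms by (intro powr_mono2) auto
  then show "\<exists>n. (if m x \<le> g then m x powr \<rho> else 0) \<le> (g / 2 ^ n) powr \<rho> \<and> g / 2 ^ Suc n < m x"
    using n1 mx by auto
qed (use assms in auto)

lemma nn_integral_weak_high:
  fixes m :: "'a \<Rightarrow> real"
  assumes [measurable]: "m \<in> borel_measurable M"
    and weak: "\<And>t. t > 0 \<Longrightarrow> emeasure M {x \<in> space M. t < m x} \<le> ennreal (A / t ^ 3)"
    and "A \<ge> 0" "0 \<le> \<rho>" "\<rho> < 3" "g > 0"
  shows "(\<integral>\<^sup>+x. ennreal (if g < m x then m x powr \<rho> else 0) \<partial>M)
    \<le> ennreal (weak_high_const A \<rho> * g powr (\<rho> - 3))"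
proof (rule weak_layer_sum[OF assms(1) weak, where c = "\<lambda>n. (g * 2 ^ Suc n) powr \<rho>" and l = "\<lambda>n. g * 2 ^ n"])
  define r where "r = (2::real) powr (\<rho> - 3)"
  have r: "0 < r" "r < 1"
    using assms powr_less_mono[of "\<rho> - 3" 0 2] by (auto simp: r_def)
  have eq: "(g * 2 ^ Suc n) powr \<rho> * (A / (g * 2 ^ n) ^ 3) = 2 powr \<rho> * A * g powr (\<rho> - 3) * r ^ n" for n
  proof -
    have "r ^ n = (2 powr (\<rho> - 3)) powr n" by (simp add: r_def powr_realpow)
    also have "\<dots> = (2 powr n) powr (\<rho> - 3)" by (simp add: powr_powr mult.commute)
    also have "\<dots> = (2 ^ n) powr (\<rho> - 3)" by (simp add: powr_realpow)
    also have "\<dots> = (2 ^ n) powr \<rho> / (2 ^ n) ^ 3"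
      by (simp add: powr_diff)
    finally have 1: "r ^ n = (2 ^ n) powr \<rho> / (2 ^ n) ^ 3" .
    have 2: "g powr (\<rho> - 3) = g powr \<rho> / g ^ 3" using assms by (simp add: powr_diff)
    show ?thesis unfolding 1 2 using assms
      by (simp add: powr_mult field_simps power_mult_distrib)
  qed
  have "(\<lambda>n. 2 powr \<rho> * A * g powr (\<rho> - 3) * r ^ n) sums (2 powr \<rho> * A * g powr (\<rho> - 3) * (1 / (1 - r)))"
    using r by (intro sums_mult geometric_sums) auto
  then show "(\<lambda>n. (g * 2 ^ Suc n) powr \<rho> * (A / (g * 2 ^ n) ^ 3)) sums (weak_high_const A \<rho> * g powr (\<rho> - 3))"
    unfolding eq by (simp add: weak_high_const_def r_def)
next
  fix x assume *: "0 < (if g < m x then m x powr \<rho> else 0)"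
  then have mx: "m x > g" by (auto split: if_splits)
  have "\<exists>n. m x \<le> g * 2 ^ Suc n"
  proof -
    obtain n where "m x / g < 2 ^ n" using real_arch_pow[of 2 "m x / g"] by auto
    then have "m x < g * 2 ^ n" using assms by (simp add: field_simps)
    also have "\<dots> \<le> g * 2 ^ Suc n" using assms by simp
    finally show ?thesis by (intro exI[of _ n]) auto
  qed
  define n where "n = (LEAST n. m x \<le> g * 2 ^ Suc n)"
  have n1: "m x \<le> g * 2 ^ Suc n" unfolding n_def by (rule LeastI_ex) fact
  have n2: "g * 2 ^ n < m x"
  proof (cases n)
    case (Suc k)
    then have "\<not> m x \<le> g * 2 ^ Suc k" using not_less_Least[of k "\<lambda>n. m x \<le> g * 2 ^ Suc n"] unfolding n_def by auto
    then show ?thesis using Suc by simp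
  qed (use mx in auto)
  have "m x powr \<rho> \<le> (g * 2 ^ Suc n) powr \<rho>"
    using mx n1 assms by (intro powr_mono2) auto
  then show "\<exists>n. (if g < m x then m x powr \<rho> else 0) \<le> (g * 2 ^ Suc n) powr \<rho> \<and> g * 2 ^ n < m x"
    using n2 mx by auto
qed (use assms in auto)

subsection \<open>The Hardy--Littlewood--Sobolev inequality for weak-type kernels\<close>

text \<open>
  Whichever of \<open>p\<close>, \<open>q\<close>, \<open>\<kappa>\<close> is smallest can be raised to a larger power at the expense of the
  others; this decouples the trilinear form.
\<close>

lemma three_case_bound:
  fixes p q \<kappa> :: real
  assumes "0 \<le> p" "0 \<le> q" "0 \<le> \<kappa>" and "\<alpha> < 3" "\<beta> < 3" "\<alpha> + \<beta> + \<rho> = 6" "\<alpha> > 0" "\<beta> > 0" "\<rho> > 0"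
  shows "p powr \<alpha> * q powr \<beta> * \<kappa> powr \<rho> \<le> p ^ 3 * q ^ 3
    + q powr \<beta> * (\<kappa> powr \<rho> * min q \<kappa> powr \<alpha>) + p powr \<alpha> * (\<kappa> powr \<rho> * min p \<kappa> powr \<beta>)"
proof -
  have nn: "0 \<le> p ^ 3 * q ^ 3" "0 \<le> q powr \<beta> * (\<kappa> powr \<rho> * min q \<kappa> powr \<alpha>)"
    "0 \<le> p powr \<alpha> * (\<kappa> powr \<rho> * min p \<kappa> powr \<beta>)" using assms by auto
  consider "p = 0 \<or> q = 0 \<or> \<kappa> = 0" | "\<kappa> > 0" "\<kappa> \<le> p" "\<kappa> \<le> q" | "p \<le> q" "p \<le> \<kappa>" | "q \<le> p" "q \<le> \<kappa>"
    using assms by fastforce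
  then show ?thesis
  proof cases
    case 1
    then have "p powr \<alpha> * q powr \<beta> * \<kappa> powr \<rho> = 0" using assms by auto
    then show ?thesis using nn by linarith
  next
    \<comment> \<open>Here \<kappa> is smallest and p, q are raised to the power 3. The excess
      exponents \<alpha> - 3 and \<beta> - 3 are negative, so p and q may be replaced by \<kappa> in
      them, and the exponents of \<kappa> then add up to 0.\<close>
    case 2
    have "p powr (\<alpha> - 3) \<le> \<kappa> powr (\<alpha> - 3)" "q powr (\<beta> - 3) \<le> \<kappa> powr (\<beta> - 3)"
      using 2 assms by (auto intro!: powr_mono2')
    then have "p powr (\<alpha> - 3) * q powr (\<beta> - 3) * \<kappa> powr \<rho>
        \<le> \<kappa> powr (\<alpha> - 3) * \<kappa> powr (\<beta> - 3) * \<kappa> powr \<rho>"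
      by (intro mult_mono) auto
    also have "\<dots> = \<kappa> powr ((\<alpha> - 3) + (\<beta> - 3) + \<rho>)" by (simp only: powr_add)
    also have "\<dots> = 1"
    proof -
      have "(\<alpha> - 3) + (\<beta> - 3) + \<rho> = 0" using assms by simp
      then show ?thesis using 2 by simp
    qed
    finally have "p ^ 3 * q ^ 3 * (p powr (\<alpha> - 3) * q powr (\<beta> - 3) * \<kappa> powr \<rho>) \<le> p ^ 3 * q ^ 3 * 1"
      using assms by (intro mult_left_mono) auto
    also have "p ^ 3 * q ^ 3 * (p powr (\<alpha> - 3) * q powr (\<beta> - 3) * \<kappa> powr \<rho>)
        = p powr \<alpha> * q powr \<beta> * \<kappa> powr \<rho>"
      using 2 by (simp add: powr_diff)
    finally show ?thesis using nn by linarith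
  next
    case 3
    have "p powr \<alpha> \<le> min q \<kappa> powr \<alpha>" using 3 assms by (intro powr_mono2) auto
    then have "p powr \<alpha> * (q powr \<beta> * \<kappa> powr \<rho>) \<le> min q \<kappa> powr \<alpha> * (q powr \<beta> * \<kappa> powr \<rho>)"
      by (intro mult_right_mono) auto
    then have "p powr \<alpha> * q powr \<beta> * \<kappa> powr \<rho> \<le> q powr \<beta> * (\<kappa> powr \<rho> * min q \<kappa> powr \<alpha>)"
      by (simp only: mult_ac)
    then show ?thesis using nn by linarith
  next
    case 4
    have "q powr \<beta> \<le> min p \<kappa> powr \<beta>" using 4 assms by (intro powr_mono2) auto
    then have "q powr \<beta> * (p powr \<alpha> * \<kappa> powr \<rho>) \<le> min p \<kappa> powr \<beta> * (p powr \<alpha> * \<kappa> powr \<rho>)"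
      by (intro mult_right_mono) auto
    then have "p powr \<alpha> * q powr \<beta> * \<kappa> powr \<rho> \<le> p powr \<alpha> * (\<kappa> powr \<rho> * min p \<kappa> powr \<beta>)"
      by (simp only: mult_ac)
    then show ?thesis using nn by linarith
  qed
qed

text \<open>Space and measure are abstract, so neither translations nor convolutions are available.
  Symmetry takes their place: it turns the weak bound in one variable into the same bound in the
  other, uniformly in the base point.\<close>

locale weak_kernel = sigma_finite_measure M for M :: "'a measure" +
  fixes k :: "'a \<Rightarrow> 'a \<Rightarrow> real" and A :: real
  assumes k_measurable [measurable]: "(\<lambda>(x, y). k x y) \<in> borel_measurable (M \<Otimes>\<^sub>M M)"
    and k_nonneg: "0 \<le> k x y"
    and k_sym: "k x y = k y x"
    and k_weak: "x \<in> space M \<Longrightarrow> t > 0 \<Longrightarrow> emeasure M {y \<in> space M. t < k x y} \<le> ennreal (A / t ^ 3)"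
    and A_nonneg: "A \<ge> 0"
begin

lemma k_measurable_comp [measurable (raw)]:
  assumes "f \<in> N \<rightarrow>\<^sub>M M" "g \<in> N \<rightarrow>\<^sub>M M"
  shows "(\<lambda>z. k (f z) (g z)) \<in> borel_measurable N"
  using measurable_compose[OF measurable_Pair[OF assms] k_measurable] by simp

lemma k_section: "x \<in> space M \<Longrightarrow> k x \<in> borel_measurable M"
  by (rule measurable_Pair_compose_split[OF k_measurable]) auto

lemma k_low:
  assumes "x \<in> space M" "\<rho> > 3" "g > 0"
  shows "(\<integral>\<^sup>+y. ennreal (if k x y \<le> g then k x y powr \<rho> else 0) \<partial>M)
    \<le> ennreal (weak_low_const A \<rho> * g powr (\<rho> - 3))"
  using assms by (intro nn_integral_weak_low k_section k_weak k_nonneg A_nonneg) auto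

lemma k_high:
  assumes "x \<in> space M" "0 \<le> \<rho>" "\<rho> < 3" "g > 0"
  shows "(\<integral>\<^sup>+y. ennreal (if g < k x y then k x y powr \<rho> else 0) \<partial>M)
    \<le> ennreal (weak_high_const A \<rho> * g powr (\<rho> - 3))"
  using assms by (intro nn_integral_weak_high k_section k_weak A_nonneg) auto

definition cut_const :: "real \<Rightarrow> real \<Rightarrow> real" where
  "cut_const \<alpha> \<rho> = weak_low_const A (\<alpha> + \<rho>) + weak_high_const A \<rho>"

lemma cut_const_nonneg: "\<alpha> + \<rho> > 3 \<Longrightarrow> \<rho> < 3 \<Longrightarrow> cut_const \<alpha> \<rho> \<ge> 0"
  unfolding cut_const_def
  by (intro add_nonneg_nonneg weak_low_const_nonneg weak_high_const_nonneg A_nonneg) auto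

text \<open>The kernel is cut at height g. Below g the power is \<alpha> + \<rho>, which exceeds 3
  because \<beta> < 3 and the sum is 6; above g it is \<rho> < 3. Both halves scale like g^3, again
  because the exponents add up to 6.\<close>

lemma nn_integral_cut_kernel:
  assumes x: "x \<in> space M" and "g \<ge> 0" "\<alpha> > 0" "\<beta> > 0" "\<rho> > 0" "\<rho> < 3" "\<beta> < 3" "\<alpha> + \<beta> + \<rho> = 6"
  shows "(\<integral>\<^sup>+y. ennreal (g powr \<beta> * (k x y powr \<rho> * min g (k x y) powr \<alpha>)) \<partial>M)
    \<le> ennreal (cut_const \<alpha> \<rho> * g ^ 3)"
proof (cases "g = 0")
  case True
  then show ?thesis using assms by simp
next
  case False
  then have g: "g > 0" using assms by simp
  have kx [measurable]: "k x \<in> borel_measurable M" using x by (rule k_section)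
  have "(\<integral>\<^sup>+y. ennreal (g powr \<beta> * (k x y powr \<rho> * min g (k x y) powr \<alpha>)) \<partial>M)
     = (\<integral>\<^sup>+y. ennreal (g powr \<beta>) * (ennreal (if k x y \<le> g then k x y powr (\<alpha> + \<rho>) else 0)
         + ennreal (g powr \<alpha>) * ennreal (if g < k x y then k x y powr \<rho> else 0)) \<partial>M)"
  proof (intro nn_integral_cong)
    fix y
    show "ennreal (g powr \<beta> * (k x y powr \<rho> * min g (k x y) powr \<alpha>)) = ennreal (g powr \<beta>) *
       (ennreal (if k x y \<le> g then k x y powr (\<alpha> + \<rho>) else 0)
         + ennreal (g powr \<alpha>) * ennreal (if g < k x y then k x y powr \<rho> else 0))"
    proof (cases "k x y \<le> g")
      case True
      then show ?thesis by (simp add: ennreal_mult[symmetric] powr_add mult_ac)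
    next
      case False
      then show ?thesis by (simp add: ennreal_mult[symmetric] mult_ac)
    qed
  qed
  also have "\<dots> = ennreal (g powr \<beta>) * ((\<integral>\<^sup>+y. ennreal (if k x y \<le> g then k x y powr (\<alpha> + \<rho>) else 0) \<partial>M)
         + ennreal (g powr \<alpha>) * (\<integral>\<^sup>+y. ennreal (if g < k x y then k x y powr \<rho> else 0) \<partial>M))"
    by (simp add: nn_integral_cmult nn_integral_add)
  also have "\<dots> \<le> ennreal (g powr \<beta>) * (ennreal (weak_low_const A (\<alpha> + \<rho>) * g powr (\<alpha> + \<rho> - 3))
         + ennreal (g powr \<alpha>) * ennreal (weak_high_const A \<rho> * g powr (\<rho> - 3)))"
    using assms g by (intro mult_left_mono add_mono k_low k_high) auto
  also have "\<dots> = ennreal (g powr \<beta> * (weak_low_const A (\<alpha> + \<rho>) * g powr (\<alpha> + \<rho> - 3)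
         + g powr \<alpha> * (weak_high_const A \<rho> * g powr (\<rho> - 3))))"
  proof -
    have "weak_low_const A (\<alpha> + \<rho>) \<ge> 0" "weak_high_const A \<rho> \<ge> 0"
      using assms A_nonneg weak_low_const_nonneg[of A "\<alpha> + \<rho>"] weak_high_const_nonneg[of A \<rho>] by auto
    then show ?thesis by (simp add: ennreal_mult ennreal_plus)
  qed
  also have "g powr \<beta> * (weak_low_const A (\<alpha> + \<rho>) * g powr (\<alpha> + \<rho> - 3)
         + g powr \<alpha> * (weak_high_const A \<rho> * g powr (\<rho> - 3))) = cut_const \<alpha> \<rho> * g ^ 3"
  proof -
    have "g powr \<beta> * g powr (\<alpha> + \<rho> - 3) = g powr (\<beta> + (\<alpha> + \<rho> - 3))" by (simp only: powr_add)
    also have "\<beta> + (\<alpha> + \<rho> - 3) = 3" using assms by simp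
    finally have 1: "g powr \<beta> * g powr (\<alpha> + \<rho> - 3) = g ^ 3" using g by simp
    have "g powr \<beta> * g powr \<alpha> * g powr (\<rho> - 3) = g powr (\<beta> + \<alpha> + (\<rho> - 3))" by (simp only: powr_add)
    also have "\<beta> + \<alpha> + (\<rho> - 3) = 3" using assms by simp
    finally have 2: "g powr \<beta> * g powr \<alpha> * g powr (\<rho> - 3) = g ^ 3" using g by simp
    have "g powr \<beta> * (weak_low_const A (\<alpha> + \<rho>) * g powr (\<alpha> + \<rho> - 3)
         + g powr \<alpha> * (weak_high_const A \<rho> * g powr (\<rho> - 3)))
       = weak_low_const A (\<alpha> + \<rho>) * (g powr \<beta> * g powr (\<alpha> + \<rho> - 3))
         + weak_high_const A \<rho> * (g powr \<beta> * g powr \<alpha> * g powr (\<rho> - 3))" by (simp add: algebra_simps)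
    then show ?thesis unfolding 1 2 by (simp add: cut_const_def algebra_simps)
  qed
  finally show ?thesis .
qed

text \<open>The powers lie in L^(3/\<alpha>), L^(3/\<beta>) and weak L^(3/\<rho>), and \<alpha>/3 +
  \<beta>/3 + \<rho>/3 = 2 is the Hardy-Littlewood-Sobolev relation. Of the three terms of
  \<open>three_case_bound\<close>, the first factorises; each of the others is integrated first in
  the variable that occurs only in the kernel, which for the second term takes Fubini and symmetry.
  Normalising by 2 instead of 1 leaves room for a q whose cube is bounded by a sum of two normalised
  functions.\<close>

lemma hardy_littlewood_sobolev:
  assumes [measurable]: "p \<in> borel_measurable M" "q \<in> borel_measurable M"
    and nn: "\<And>x. 0 \<le> p x" "\<And>x. 0 \<le> q x"
    and p2: "(\<integral>\<^sup>+x. ennreal (p x ^ 3) \<partial>M) \<le> 2" and q2: "(\<integral>\<^sup>+x. ennreal (q x ^ 3) \<partial>M) \<le> 2"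
    and ex: "\<alpha> > 0" "\<beta> > 0" "\<rho> > 0" "\<alpha> < 3" "\<beta> < 3" "\<rho> < 3" "\<alpha> + \<beta> + \<rho> = 6"
  shows "(\<integral>\<^sup>+x. \<integral>\<^sup>+y. ennreal (p x powr \<alpha> * q y powr \<beta> * k x y powr \<rho>) \<partial>M \<partial>M)
    \<le> ennreal (4 + 2 * cut_const \<alpha> \<rho> + 2 * cut_const \<beta> \<rho>)"
proof -
  interpret P: pair_sigma_finite M M ..
  let ?T1 = "\<lambda>x y. ennreal (p x ^ 3 * q y ^ 3)"
  let ?T2 = "\<lambda>x y. ennreal (q y powr \<beta> * (k x y powr \<rho> * min (q y) (k x y) powr \<alpha>))"
  let ?T3 = "\<lambda>x y. ennreal (p x powr \<alpha> * (k x y powr \<rho> * min (p x) (k x y) powr \<beta>))"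
  have c: "cut_const \<alpha> \<rho> \<ge> 0" "cut_const \<beta> \<rho> \<ge> 0"
    using ex by (auto intro!: cut_const_nonneg)
  have "(\<integral>\<^sup>+x. \<integral>\<^sup>+y. ennreal (p x powr \<alpha> * q y powr \<beta> * k x y powr \<rho>) \<partial>M \<partial>M)
     \<le> (\<integral>\<^sup>+x. \<integral>\<^sup>+y. ?T1 x y + ?T2 x y + ?T3 x y \<partial>M \<partial>M)"
  proof (intro nn_integral_mono)
    fix x y
    have "ennreal (p x powr \<alpha> * q y powr \<beta> * k x y powr \<rho>) \<le>
      ennreal (p x ^ 3 * q y ^ 3 + q y powr \<beta> * (k x y powr \<rho> * min (q y) (k x y) powr \<alpha>)
        + p x powr \<alpha> * (k x y powr \<rho> * min (p x) (k x y) powr \<beta>))"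
      using ex by (intro ennreal_leI three_case_bound nn k_nonneg) auto
    also have "\<dots> = ?T1 x y + ?T2 x y + ?T3 x y"
      using nn by (simp add: ennreal_plus)
    finally show "ennreal (p x powr \<alpha> * q y powr \<beta> * k x y powr \<rho>) \<le> ?T1 x y + ?T2 x y + ?T3 x y" .
  qed
  also have "\<dots> = (\<integral>\<^sup>+x. \<integral>\<^sup>+y. ?T1 x y \<partial>M \<partial>M) + (\<integral>\<^sup>+x. \<integral>\<^sup>+y. ?T2 x y \<partial>M \<partial>M) + (\<integral>\<^sup>+x. \<integral>\<^sup>+y. ?T3 x y \<partial>M \<partial>M)"
  proof -
    have "(\<integral>\<^sup>+x. \<integral>\<^sup>+y. ?T1 x y + ?T2 x y + ?T3 x y \<partial>M \<partial>M)
        = (\<integral>\<^sup>+x. (\<integral>\<^sup>+y. ?T1 x y \<partial>M) + (\<integral>\<^sup>+y. ?T2 x y \<partial>M) + (\<integral>\<^sup>+y. ?T3 x y \<partial>M) \<partial>M)"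
      by (intro nn_integral_cong) (simp add: nn_integral_add)
    then show ?thesis by (simp add: nn_integral_add)
  qed
  also have "(\<integral>\<^sup>+x. \<integral>\<^sup>+y. ?T1 x y \<partial>M \<partial>M) = (\<integral>\<^sup>+x. ennreal (p x ^ 3) \<partial>M) * (\<integral>\<^sup>+y. ennreal (q y ^ 3) \<partial>M)"
    using nn by (simp add: ennreal_mult nn_integral_cmult nn_integral_multc)
  also have "\<dots> \<le> 2 * 2" by (intro mult_mono p2 q2) auto
  also have "(\<integral>\<^sup>+x. \<integral>\<^sup>+y. ?T2 x y \<partial>M \<partial>M) = (\<integral>\<^sup>+y. \<integral>\<^sup>+x. ?T2 x y \<partial>M \<partial>M)"
    by (rule P.Fubini') measurable
  also have "\<dots> = (\<integral>\<^sup>+y. \<integral>\<^sup>+x. ennreal (q y powr \<beta> * (k y x powr \<rho> * min (q y) (k y x) powr \<alpha>)) \<partial>M \<partial>M)"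
    by (simp add: k_sym)
  also have "\<dots> \<le> (\<integral>\<^sup>+y. ennreal (cut_const \<alpha> \<rho> * q y ^ 3) \<partial>M)"
    using ex nn by (intro nn_integral_mono nn_integral_cut_kernel) auto
  also have "\<dots> = ennreal (cut_const \<alpha> \<rho>) * (\<integral>\<^sup>+y. ennreal (q y ^ 3) \<partial>M)"
    using c nn by (simp add: ennreal_mult nn_integral_cmult)
  also have "\<dots> \<le> ennreal (cut_const \<alpha> \<rho>) * 2" by (intro mult_left_mono q2) auto
  also have "(\<integral>\<^sup>+x. \<integral>\<^sup>+y. ?T3 x y \<partial>M \<partial>M) \<le> (\<integral>\<^sup>+x. ennreal (cut_const \<beta> \<rho> * p x ^ 3) \<partial>M)"
    using ex nn by (intro nn_integral_mono nn_integral_cut_kernel) auto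
  also have "\<dots> = ennreal (cut_const \<beta> \<rho>) * (\<integral>\<^sup>+y. ennreal (p y ^ 3) \<partial>M)"
    using c nn by (simp add: ennreal_mult nn_integral_cmult)
  also have "\<dots> \<le> ennreal (cut_const \<beta> \<rho>) * 2" by (intro mult_left_mono p2) auto
  also have "2 * 2 + ennreal (cut_const \<alpha> \<rho>) * 2 + ennreal (cut_const \<beta> \<rho>) * 2
      = ennreal (4 + 2 * cut_const \<alpha> \<rho> + 2 * cut_const \<beta> \<rho>)"
  proof -
    have two: "(2 :: ennreal) = ennreal 2" by simp
    show ?thesis unfolding two using c
      by (simp add: ennreal_mult[symmetric] ennreal_plus[symmetric] algebra_simps del: ennreal_plus ennreal_numeral)
  qed
  finally show ?thesis by (simp add: add_mono)
qed

end

text \<open>Fatou's lemma for a convergent sequence of integrands.\<close>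

lemma nn_integral_limit_le:
  assumes "\<And>n. f n \<in> borel_measurable M" "\<And>x. x \<in> space M \<Longrightarrow> (\<lambda>n. f n x) \<longlonglongrightarrow> g x"
    and "\<And>n. (\<integral>\<^sup>+x. f n x \<partial>M) \<le> B"
  shows "(\<integral>\<^sup>+x. g x \<partial>M) \<le> (B :: ennreal)"
proof -
  have "(\<integral>\<^sup>+x. g x \<partial>M) = (\<integral>\<^sup>+x. liminf (\<lambda>n. f n x) \<partial>M)"
    using assms by (intro nn_integral_cong) (metis lim_imp_Liminf trivial_limit_sequentially)
  also have "\<dots> \<le> liminf (\<lambda>n. \<integral>\<^sup>+x. f n x \<partial>M)"
    by (rule nn_integral_liminf) (rule assms)
  also have "\<dots> \<le> B"
    using assms(3) by (intro Liminf_le) auto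
  finally show ?thesis .
qed

context weak_kernel
begin

definition hls_const :: "real \<Rightarrow> real \<Rightarrow> real \<Rightarrow> real" where
  "hls_const \<alpha> \<beta> \<rho> = 4 + 2 * cut_const \<alpha> \<rho> + 2 * cut_const \<beta> \<rho>"

text \<open>Duality: the bilinear estimate is tested against a truncated power of the potential itself.\<close>

lemma potential_power_bound:
  fixes N :: nat
  defines "\<alpha> \<equiv> 3 - 3 / real N"
  assumes \<rho>: "0 < \<rho>" "\<rho> < 3" "3 / real N < \<rho>" and N: "N \<ge> 2" and \<beta>: "\<beta> = 3 - \<rho> + 3 / real N"
    and G [measurable]: "G \<in> borel_measurable M" and nn: "\<And>x. 0 \<le> G x"
    and G2: "(\<integral>\<^sup>+x. ennreal (G x powr (3 / \<beta>)) \<partial>M) \<le> 2"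
  shows "(\<integral>\<^sup>+x. (\<integral>\<^sup>+y. ennreal (k x y powr \<rho> * G y) \<partial>M) ^ N \<partial>M) \<le> ennreal (hls_const \<alpha> \<beta> \<rho> ^ N)"
proof -
  define C where "C = hls_const \<alpha> \<beta> \<rho>"
  have N0: "real N > 0" "N > 0" using N by auto
  have "3 / real N \<le> 3 / 2" using N by (intro divide_left_mono) auto
  moreover have "0 < 3 / real N" using N0 by simp
  ultimately have ex: "\<alpha> > 0" "\<beta> > 0" "\<alpha> < 3" "\<beta> < 3" "\<alpha> + \<beta> + \<rho> = 6"
    using \<rho> unfolding \<alpha>_def \<beta> by linarith+
  have C: "C \<ge> 0"
    using cut_const_nonneg[of \<alpha> \<rho>] cut_const_nonneg[of \<beta> \<rho>] ex \<rho> by (auto simp: C_def hls_const_def)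
  define I where "I x = (\<integral>\<^sup>+y. ennreal (k x y powr \<rho> * G y) \<partial>M)" for x
  have I [measurable]: "I \<in> borel_measurable M" unfolding I_def by measurable
  obtain S :: "nat \<Rightarrow> 'a set" where S: "range S \<subseteq> sets M" "(\<Union>i. S i) = space M"
    "\<And>i. emeasure M (S i) \<noteq> \<infinity>" "incseq S"
    using sigma_finite_incseq by blast
  have S_meas [measurable]: "S n \<in> sets M" for n using S by auto
  \<comment> \<open>Cutting I off at height n and restricting it to a set of finite measure makes
    the N-th moment X of g finite, so that the division by powers of X below is legitimate.\<close>
  define g where "g n x = enn2real (min (I x) (of_nat n)) * indicator (S n) x" for n x
  have g_nn: "g n x \<ge> 0" for n x by (simp add: g_def)
  have g_meas [measurable]: "g n \<in> borel_measurable M" for n unfolding g_def by measurable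
  have g_eq: "ennreal (g n x) = min (I x) (of_nat n) * indicator (S n) x" for n x
    by (auto simp: g_def indicator_def intro!: ennreal_enn2real) 
      (metis ennreal_of_nat_eq_real_of_nat ennreal_less_top min_less_iff_disj)
  have g_le: "ennreal (g n x) \<le> I x" "ennreal (g n x) \<le> of_nat n * indicator (S n) x" for n x
    unfolding g_eq by (auto simp: indicator_def)
  have key: "(\<integral>\<^sup>+x. ennreal (g n x) ^ N \<partial>M) \<le> ennreal (C ^ N)" for n
  proof -
    have "(\<integral>\<^sup>+x. ennreal (g n x) ^ N \<partial>M) \<le> (\<integral>\<^sup>+x. of_nat n ^ N * indicator (S n) x \<partial>M)"
    proof (intro nn_integral_mono)
      fix x
      have "ennreal (g n x) ^ N \<le> (of_nat n * indicator (S n) x) ^ N"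
        by (intro power_mono g_le) auto
      also have "\<dots> = of_nat n ^ N * indicator (S n) x"
        using N0 by (auto simp: indicator_def)
      finally show "ennreal (g n x) ^ N \<le> of_nat n ^ N * indicator (S n) x" .
    qed
    also have "\<dots> = of_nat n ^ N * emeasure M (S n)" by (simp add: nn_integral_cmult_indicator)
    also have "\<dots> < \<infinity>" using S(3)[of n] by (simp add: ennreal_mult_less_top less_top power_less_top_ennreal of_nat_less_top)
    finally obtain X where X: "(\<integral>\<^sup>+x. ennreal (g n x) ^ N \<partial>M) = ennreal X" "X \<ge> 0"
      by (metis ennreal_enn2real enn2real_nonneg infinity_ennreal_def)
    have "X \<le> C ^ N"
    proof (cases "X = 0")
      case False
      then have X0: "X > 0" using X by simp
      \<comment> \<open>The cube of p has integral 1, and p^\<alpha> is a multiple of g^(N - 1)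
        because N \<alpha> / 3 = N - 1. Pairing p^\<alpha> with I therefore dominates a multiple of
        the N-th moment of g.\<close>
      define p where "p x = g n x powr (N / 3) / X powr (1 / 3)" for x
      define q where "q y = G y powr (1 / \<beta>)" for y
      have p3: "p x ^ 3 = g n x ^ N / X" for x
      proof -
        have "(g n x powr (N / 3)) ^ 3 = g n x ^ N"
        proof (cases "g n x = 0")
          case False
          then have "g n x > 0" using g_nn[of n x] by simp
          then show ?thesis by (simp add: powr_power powr_realpow)
        qed (use N0 in auto)
        moreover have "(X powr (1 / 3)) ^ 3 = X" using X0 by (simp add: powr_power)
        ultimately show ?thesis by (simp add: p_def power_divide)
      qed
      have q3: "q x ^ 3 = G x powr (3 / \<beta>)" for x
        using nn[of x] ex by (cases "G x = 0") (auto simp: q_def powr_power)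
      have q\<beta>: "q x powr \<beta> = G x" for x
        using nn[of x] ex by (simp add: q_def powr_powr)
      have e: "real N / 3 * \<alpha> = real (N - 1)"
        using N0 by (simp add: \<alpha>_def field_simps of_nat_diff)
      have p\<alpha>: "p x powr \<alpha> = g n x ^ (N - 1) / X powr (\<alpha> / 3)" for x
      proof (cases "g n x = 0")
        case True
        then show ?thesis using N by (simp add: p_def power_0_left)
      next
        case False
        then have "g n x > 0" using g_nn[of n x] by simp
        then show ?thesis using X0 e by (simp add: p_def powr_divide powr_powr powr_realpow)
      qed
      have "(\<integral>\<^sup>+x. ennreal (p x ^ 3) \<partial>M) = (\<integral>\<^sup>+x. ennreal (1 / X) * ennreal (g n x) ^ N \<partial>M)"
        unfolding p3 using g_nn X0 by (intro nn_integral_cong) (simp add: ennreal_power ennreal_mult[symmetric])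
      also have "\<dots> = ennreal (1 / X) * ennreal X"
        using X by (simp add: nn_integral_cmult)
      also have "\<dots> = 1" using X0 by (simp add: ennreal_mult[symmetric])
      finally have p2: "(\<integral>\<^sup>+x. ennreal (p x ^ 3) \<partial>M) \<le> 2" by simp
      have HLS: "(\<integral>\<^sup>+x. \<integral>\<^sup>+y. ennreal (p x powr \<alpha> * q y powr \<beta> * k x y powr \<rho>) \<partial>M \<partial>M) \<le> ennreal C"
        unfolding C_def hls_const_def
        by (rule hardy_littlewood_sobolev) (use ex \<rho> p2 G2 q3 X0 g_nn in \<open>auto simp: p_def q_def\<close>)
      have "ennreal X = (\<integral>\<^sup>+x. ennreal (g n x) ^ (N - 1) * ennreal (g n x) \<partial>M)"
        unfolding X(1)[symmetric] using N0 by (intro nn_integral_cong power_minus_mult[symmetric])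
      also have "\<dots> \<le> (\<integral>\<^sup>+x. ennreal (g n x) ^ (N - 1) * I x \<partial>M)"
        by (intro nn_integral_mono mult_left_mono g_le) auto
      also have "\<dots> = (\<integral>\<^sup>+x. \<integral>\<^sup>+y. ennreal (X powr (\<alpha> / 3)) *
          ennreal (p x powr \<alpha> * q y powr \<beta> * k x y powr \<rho>) \<partial>M \<partial>M)"
      proof (intro nn_integral_cong)
        fix x assume x [measurable]: "x \<in> space M"
        have "ennreal (g n x) ^ (N - 1) * I x
            = (\<integral>\<^sup>+y. ennreal (g n x) ^ (N - 1) * ennreal (k x y powr \<rho> * G y) \<partial>M)"
          unfolding I_def by (simp add: nn_integral_cmult)
        also have "\<dots> = (\<integral>\<^sup>+y. ennreal (X powr (\<alpha> / 3)) * ennreal (p x powr \<alpha> * q y powr \<beta> * k x y powr \<rho>) \<partial>M)"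
          using X0 g_nn nn
          by (intro nn_integral_cong) (simp add: ennreal_power ennreal_mult[symmetric] q\<beta> p\<alpha> mult_ac)
        finally show "ennreal (g n x) ^ (N - 1) * I x = (\<integral>\<^sup>+y. ennreal (X powr (\<alpha> / 3)) *
          ennreal (p x powr \<alpha> * q y powr \<beta> * k x y powr \<rho>) \<partial>M)" .
      qed
      also have "\<dots> = ennreal (X powr (\<alpha> / 3)) *
          (\<integral>\<^sup>+x. \<integral>\<^sup>+y. ennreal (p x powr \<alpha> * q y powr \<beta> * k x y powr \<rho>) \<partial>M \<partial>M)"
      proof -
        have [measurable]: "p \<in> borel_measurable M" "q \<in> borel_measurable M"
          unfolding p_def q_def by measurable
        have "(\<integral>\<^sup>+x. \<integral>\<^sup>+y. ennreal (X powr (\<alpha> / 3)) *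
            ennreal (p x powr \<alpha> * q y powr \<beta> * k x y powr \<rho>) \<partial>M \<partial>M)
          = (\<integral>\<^sup>+x. ennreal (X powr (\<alpha> / 3)) *
            (\<integral>\<^sup>+y. ennreal (p x powr \<alpha> * q y powr \<beta> * k x y powr \<rho>) \<partial>M) \<partial>M)"
        proof (rule nn_integral_cong)
          fix x assume x [measurable]: "x \<in> space M"
          show "(\<integral>\<^sup>+y. ennreal (X powr (\<alpha> / 3)) * ennreal (p x powr \<alpha> * q y powr \<beta> * k x y powr \<rho>) \<partial>M)
            = ennreal (X powr (\<alpha> / 3)) * (\<integral>\<^sup>+y. ennreal (p x powr \<alpha> * q y powr \<beta> * k x y powr \<rho>) \<partial>M)"
            by (rule nn_integral_cmult) measurable
        qed
        also have "\<dots> = ennreal (X powr (\<alpha> / 3)) *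
            (\<integral>\<^sup>+x. \<integral>\<^sup>+y. ennreal (p x powr \<alpha> * q y powr \<beta> * k x y powr \<rho>) \<partial>M \<partial>M)"
          by (rule nn_integral_cmult) measurable
        finally show ?thesis .
      qed
      also have "\<dots> \<le> ennreal (X powr (\<alpha> / 3)) * ennreal C" by (intro mult_left_mono HLS) auto
      finally have "X \<le> X powr (\<alpha> / 3) * C"
        using C by (simp add: ennreal_mult[symmetric])
      \<comment> \<open>Since 1 - \<alpha> / 3 = 1 / N, cancelling the common power of X leaves
        X^(1/N) \<le> C.\<close>
      moreover have "X = X powr (\<alpha> / 3) * X powr (1 / N)"
        using X0 N0 by (simp add: \<alpha>_def powr_add[symmetric] diff_divide_distrib)
      ultimately have "X powr (\<alpha> / 3) * X powr (1 / N) \<le> X powr (\<alpha> / 3) * C" by simp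
      then have "X powr (1 / N) \<le> C" using X0 by simp
      then have "(X powr (1 / N)) ^ N \<le> C ^ N" by (intro power_mono) auto
      then show ?thesis using X0 N0 by (simp add: powr_power)
    qed (use C in simp)
    then show ?thesis unfolding X(1) using C by (intro ennreal_leI)
  qed
  have "(\<integral>\<^sup>+x. I x ^ N \<partial>M) \<le> ennreal (C ^ N)"
  proof (rule nn_integral_limit_le[OF _ _ key])
    fix x assume "x \<in> space M"
    then obtain i where i: "x \<in> S i" using S(2) by blast
    have "(\<lambda>n. min (I x) (of_nat n)) \<longlonglongrightarrow> I x"
    proof (cases "I x = \<infinity>")
      case True
      have "(\<lambda>n. of_nat n :: ennreal) \<longlonglongrightarrow> \<infinity>"
        by (simp add: of_nat_tendsto_top_ennreal)
      then show ?thesis using True by (simp add: min_def top_unique cong: if_cong)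
    next
      case False
      then obtain m where m: "I x < of_nat m"
        using ennreal_Ex_less_of_nat[of "I x"] by (auto simp: less_top)
      have "min (I x) (of_nat n) = I x" if "m \<le> n" for n
      proof (rule min.absorb1)
        have "(of_nat m :: ennreal) \<le> of_nat n" using that by simp
        then show "I x \<le> of_nat n" using m by (meson less_imp_le order_trans)
      qed
      then have "\<forall>\<^sub>F n in sequentially. min (I x) (of_nat n) = I x"
        unfolding eventually_sequentially by blast
      then show ?thesis by (rule tendsto_eventually)
    qed
    moreover have "\<forall>\<^sub>F n in sequentially. min (I x) (of_nat n) = ennreal (g n x)"
      unfolding eventually_sequentially
    proof (intro exI[of _ i] allI impI)
      fix n assume "i \<le> n"
      then have "x \<in> S n" using i S(4) by (auto simp: incseq_def)
      then show "min (I x) (of_nat n) = ennreal (g n x)" by (simp add: g_eq)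
    qed
    ultimately have "(\<lambda>n. ennreal (g n x)) \<longlonglongrightarrow> I x"
      by (rule Lim_transform_eventually)
    then show "(\<lambda>n. ennreal (g n x) ^ N) \<longlonglongrightarrow> I x ^ N" by (rule tendsto_power_ennreal)
  qed measurable
  then show ?thesis unfolding I_def C_def .
qed

text \<open>Up to the factor C, the N-th power of the norm on L^N of the map z \<mapsto> \<integral>
  k V z is at most \<delta>^N, where \<delta> bounds V in L^(3/2). One C serves for all V and
  \<delta>, because the threshold \<delta> is chosen only after C is known.\<close>

definition operator_bound :: "nat \<Rightarrow> real \<Rightarrow> bool" where
  "operator_bound N C \<longleftrightarrow> (\<forall>V z \<delta>. V \<in> borel_measurable M \<longrightarrow> z \<in> borel_measurable M \<longrightarrow> (\<forall>x. 0 \<le> V x) \<longrightarrow> \<delta> > 0 \<longrightarrow>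
     (\<integral>\<^sup>+x. ennreal (V x powr (3 / 2)) \<partial>M) \<le> ennreal (\<delta> powr (3 / 2)) \<longrightarrow>
     (\<integral>\<^sup>+x. (\<integral>\<^sup>+y. ennreal (k x y * V y) * z y \<partial>M) ^ N \<partial>M) \<le> ennreal (C * \<delta> ^ N) * (\<integral>\<^sup>+x. z x ^ N \<partial>M))"

lemma operator_boundD:
  assumes "operator_bound N C" "V \<in> borel_measurable M" "z \<in> borel_measurable M" "\<And>x. 0 \<le> V x" "\<delta> > 0"
    and "(\<integral>\<^sup>+x. ennreal (V x powr (3 / 2)) \<partial>M) \<le> ennreal (\<delta> powr (3 / 2))"
  shows "(\<integral>\<^sup>+x. (\<integral>\<^sup>+y. ennreal (k x y * V y) * z y \<partial>M) ^ N \<partial>M) \<le> ennreal (C * \<delta> ^ N) * (\<integral>\<^sup>+x. z x ^ N \<partial>M)"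
  using assms unfolding operator_bound_def by blast

text \<open>Hoelder's inequality puts V z into L^(3/\<beta>) with \<beta>/3 = 2/3 + 1/N, and the
  potential with \<rho> = 1 maps that space back to L^N. The requirement 3/N < \<rho> is N >
  3.\<close>

lemma ex_operator_bound:
  fixes N :: nat
  assumes N: "N > 3"
  shows "\<exists>C>0. operator_bound N C"
proof -
  define \<beta> where "\<beta> = 3 - 1 + 3 / real N"
  have N0: "real N > 0" "3 / real N < 1" using N by auto
  have \<beta>: "\<beta> > 0" using N0 by (simp add: \<beta>_def add_pos_pos)
  define B where "B = hls_const (3 - 3 / real N) \<beta> 1"
  define C where "C = 1 + \<bar>B ^ N\<bar>"
  have C: "C > 0" "B ^ N \<le> C" by (auto simp: C_def)
  show ?thesis
    unfolding operator_bound_def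
  proof (intro exI[of _ C] conjI allI impI C)
    fix V :: "'a \<Rightarrow> real" and z :: "'a \<Rightarrow> ennreal" and \<delta> :: real
    assume V [measurable]: "V \<in> borel_measurable M" and z [measurable]: "z \<in> borel_measurable M"
      and V0: "\<forall>x. 0 \<le> V x" and \<delta>: "\<delta> > 0"
      and V\<delta>: "(\<integral>\<^sup>+x. ennreal (V x powr (3 / 2)) \<partial>M) \<le> ennreal (\<delta> powr (3 / 2))"
    define Z where "Z = (\<integral>\<^sup>+x. z x ^ N \<partial>M)"
    let ?T = "\<lambda>x. \<integral>\<^sup>+y. ennreal (k x y * V y) * z y \<partial>M"
    consider "Z = \<infinity>" | "Z = 0" | Z' where "Z = ennreal Z'" "Z' > 0"
      by (metis ennreal_cases ennreal_eq_0_iff infinity_ennreal_def linorder_not_le)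
    then have "(\<integral>\<^sup>+x. ?T x ^ N \<partial>M) \<le> ennreal (C * \<delta> ^ N) * Z"
    proof cases
      case 1
      then show ?thesis using C \<delta> by (simp add: ennreal_mult_top)
    next
      case 2
      then have "AE y in M. z y = 0"
        unfolding Z_def using N0 by (subst (asm) nn_integral_0_iff_AE) auto
      then have "?T x = 0" if "x \<in> space M" for x
        using that by (subst nn_integral_0_iff_AE) auto
      then have "(\<integral>\<^sup>+x. ?T x ^ N \<partial>M) = (\<integral>\<^sup>+x. 0 \<partial>M)"
        using N0 by (intro nn_integral_cong) (simp add: power_0_left)
      then show ?thesis by simp
    next
      case (3 Z')
      define y where "y x = enn2real (z x)" for x
      have y [measurable]: "y \<in> borel_measurable M" unfolding y_def by measurable
      have "AE x in M. z x ^ N \<noteq> \<infinity>"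
        using 3 by (intro nn_integral_PInf_AE) (auto simp: Z_def)
      then have zy: "AE x in M. z x = ennreal (y x)"
        using N0 by (auto simp: y_def less_top power_eq_top_ennreal elim!: eventually_mono)
      \<comment> \<open>The product of the bound for V and the L^N norm of z, so that G = V y / d is
        normalised as \<open>potential_power_bound\<close> demands.\<close>
      define d where "d = \<delta> * Z' powr (1 / N)"
      have d: "d > 0" using \<delta> 3 by (simp add: d_def)
      define G where "G x = V x * y x / d" for x
      have G0: "G x \<ge> 0" for x using V0 d by (simp add: G_def y_def)
      have G_int: "(\<integral>\<^sup>+x. (\<integral>\<^sup>+y. ennreal (k x y powr 1 * G y) \<partial>M) ^ N \<partial>M) \<le> ennreal (B ^ N)"
        unfolding B_def
      proof (rule potential_power_bound[OF _ _ _ _ \<beta>_def])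
        have "ennreal (G x powr (3 / \<beta>)) \<le> ennreal (1 / \<delta> powr (3 / 2)) * ennreal (V x powr (3 / 2))
            + ennreal (1 / Z') * ennreal (y x) ^ N" for x
        proof -
          define a b where "a = V x / \<delta>" and "b = y x / Z' powr (1 / N)"
          have ab: "a \<ge> 0" "b \<ge> 0" using V0 \<delta> 3 by (auto simp: a_def b_def y_def)
          have bN: "b ^ N = y x ^ N / Z'"
            using 3 N0 by (simp add: b_def power_divide powr_power)
          have e12: "3 / 2 * (2 / \<beta>) = 3 / \<beta>" "real N * (3 / (\<beta> * N)) = 3 / \<beta>"
            using \<beta> N0 by (auto simp: field_simps)
          \<comment> \<open>The two weights of Young's inequality add up to 1; this is the choice of
            \<beta>.\<close>
          have "2 / \<beta> + 3 / (\<beta> * N) = (2 + 3 / N) / \<beta>"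
            by (simp add: add_divide_distrib)
          also have "2 + 3 / N = \<beta>" by (simp add: \<beta>_def)
          finally have e: "3 / 2 * (2 / \<beta>) = 3 / \<beta>" "real N * (3 / (\<beta> * N)) = 3 / \<beta>" "2 / \<beta> + 3 / (\<beta> * N) = 1"
            using e12 \<beta> by auto
          have "G x powr (3 / \<beta>) = a powr (3 / \<beta>) * b powr (3 / \<beta>)"
            using ab by (simp add: G_def a_def b_def d_def powr_mult[symmetric])
          also have "\<dots> = (a powr (3 / 2)) powr (2 / \<beta>) * (b powr N) powr (3 / (\<beta> * N))"
            by (simp only: powr_powr e)
          also have "\<dots> \<le> a powr (3 / 2) + b powr N"
            using \<beta> e by (intro powr_mult_powr_le_add) auto
          also have "b powr N = b ^ N"
            using ab N0 by (cases "b = 0") (auto simp: powr_realpow)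
          also have "a powr (3 / 2) = V x powr (3 / 2) / \<delta> powr (3 / 2)"
            using V0 \<delta> by (simp add: a_def powr_divide)
          finally have "ennreal (G x powr (3 / \<beta>)) \<le> ennreal (1 / \<delta> powr (3 / 2) * V x powr (3 / 2) + 1 / Z' * y x ^ N)"
            unfolding bN by (intro ennreal_leI) simp
          then show ?thesis
            using \<delta> 3 by (simp add: ennreal_plus ennreal_mult[symmetric] ennreal_power y_def)
        qed
        then have "(\<integral>\<^sup>+x. ennreal (G x powr (3 / \<beta>)) \<partial>M) \<le> (\<integral>\<^sup>+x. ennreal (1 / \<delta> powr (3 / 2)) * ennreal (V x powr (3 / 2))
            + ennreal (1 / Z') * ennreal (y x) ^ N \<partial>M)"
          by (intro nn_integral_mono)
        also have "\<dots> = ennreal (1 / \<delta> powr (3 / 2)) * (\<integral>\<^sup>+x. ennreal (V x powr (3 / 2)) \<partial>M)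
            + ennreal (1 / Z') * (\<integral>\<^sup>+x. ennreal (y x) ^ N \<partial>M)"
          by (simp add: nn_integral_add nn_integral_cmult)
        also have "(\<integral>\<^sup>+x. ennreal (y x) ^ N \<partial>M) = ennreal Z'"
          unfolding 3(1)[symmetric] Z_def using zy by (intro nn_integral_cong_AE) auto
        also have "ennreal (1 / \<delta> powr (3 / 2)) * (\<integral>\<^sup>+x. ennreal (V x powr (3 / 2)) \<partial>M)
            + ennreal (1 / Z') * ennreal Z' \<le> ennreal (1 / \<delta> powr (3 / 2)) * ennreal (\<delta> powr (3 / 2)) + ennreal (1 / Z') * ennreal Z'"
          by (intro add_right_mono mult_left_mono V\<delta>) auto
        also have "\<dots> = 2" using \<delta> 3 by (simp add: ennreal_mult[symmetric])
        finally show "(\<integral>\<^sup>+x. ennreal (G x powr (3 / \<beta>)) \<partial>M) \<le> 2" .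
      qed (use N N0 G0 in \<open>auto simp: G_def\<close>)
      have "?T x = ennreal d * (\<integral>\<^sup>+y. ennreal (k x y powr 1 * G y) \<partial>M)" if x: "x \<in> space M" for x
      proof -
        have [measurable]: "G \<in> borel_measurable M" unfolding G_def by measurable
        have "?T x = (\<integral>\<^sup>+y. ennreal d * ennreal (k x y powr 1 * G y) \<partial>M)"
        proof (rule nn_integral_cong_AE)
          have "y u \<ge> 0" for u by (simp add: y_def)
          then show "AE y in M. ennreal (k x y * V y) * z y = ennreal d * ennreal (k x y powr 1 * G y)"
            using zy d V0 k_nonneg by (auto simp: G_def ennreal_mult[symmetric] elim!: eventually_mono)
        qed
        then show ?thesis using x by (simp add: nn_integral_cmult)
      qed
      then have "(\<integral>\<^sup>+x. ?T x ^ N \<partial>M) = (\<integral>\<^sup>+x. ennreal d ^ N * (\<integral>\<^sup>+y. ennreal (k x y powr 1 * G y) \<partial>M) ^ N \<partial>M)"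
        by (intro nn_integral_cong) (simp add: power_mult_distrib)
      also have "\<dots> = ennreal d ^ N * (\<integral>\<^sup>+x. (\<integral>\<^sup>+y. ennreal (k x y powr 1 * G y) \<partial>M) ^ N \<partial>M)"
      proof -
        have [measurable]: "G \<in> borel_measurable M" unfolding G_def by measurable
        show ?thesis by (rule nn_integral_cmult) measurable
      qed
      also have "\<dots> \<le> ennreal d ^ N * ennreal (B ^ N)"
        by (intro mult_left_mono G_int) auto
      also have "\<dots> \<le> ennreal d ^ N * ennreal C"
        by (intro mult_left_mono ennreal_leI C) auto
      also have "\<dots> = ennreal (C * \<delta> ^ N) * Z"
      proof -
        have "d ^ N = \<delta> ^ N * Z'" using 3 N0 by (simp add: d_def power_mult_distrib powr_power)
        then show ?thesis using d C \<delta> 3 by (simp add: ennreal_power ennreal_mult[symmetric] mult_ac)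
      qed
      finally show ?thesis .
    qed
    then show "(\<integral>\<^sup>+x. ?T x ^ N \<partial>M) \<le> ennreal (C * \<delta> ^ N) * (\<integral>\<^sup>+x. z x ^ N \<partial>M)"
      unfolding Z_def .
  qed
qed

end

section \<open>Coupled integral inequalities: from the critical exponents to bounded
  functions\<close>

lemma ennreal_power_add_le: "(a + b :: ennreal) ^ n \<le> 2 ^ n * (a ^ n + b ^ n)"
proof -
  have "(a + b) ^ n \<le> (2 * max a b) ^ n"
    by (intro power_mono) (auto simp: mult_2 intro!: add_mono)
  also have "\<dots> = 2 ^ n * max a b ^ n" by (simp add: power_mult_distrib)
  also have "max a b ^ n \<le> a ^ n + b ^ n" by (auto simp: max_def)
  finally show ?thesis by (simp add: mult_left_mono)
qed

text \<open>With weight 1 for k and v and weight 2 for f both products are homogeneous of weight 6.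
  They are at most s^6 for s the largest of k, v and sqrt f, and s^6 is one of the three terms on
  the right.\<close>

lemma mult3_le_powers:
  fixes k v f :: real
  assumes "0 \<le> k" "0 \<le> v" "0 \<le> f"
  shows "k * (f\<^sup>2 * v) \<le> k ^ 6 + f ^ 3 + v ^ 6" "k\<^sup>2 * (v\<^sup>2 * f) \<le> k ^ 6 + f ^ 3 + v ^ 6"
proof -
  define s where "s = max k (max v (sqrt f))"
  have s: "0 \<le> s" "k \<le> s" "v \<le> s" "sqrt f \<le> s" using assms by (auto simp: s_def)
  then have f: "f \<le> s\<^sup>2" using assms power_mono[of "sqrt f" s 2] by simp
  have f3: "sqrt f ^ 6 = f ^ 3"
  proof -
    have "sqrt f ^ 6 = ((sqrt f)\<^sup>2) ^ 3" by (simp flip: power_mult)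
    then show ?thesis using assms by simp
  qed
  have "s ^ 6 \<in> {k ^ 6, v ^ 6, f ^ 3}"
    using f3 unfolding s_def by (simp add: max_def)
  then have s6: "s ^ 6 \<le> k ^ 6 + f ^ 3 + v ^ 6" using assms by auto
  have "k * (f\<^sup>2 * v) \<le> s * ((s\<^sup>2)\<^sup>2 * s)"
    using assms s f by (intro mult_mono power_mono) auto
  also have "\<dots> = s ^ 6" by (simp add: eval_nat_numeral)
  finally show "k * (f\<^sup>2 * v) \<le> k ^ 6 + f ^ 3 + v ^ 6" using s6 by simp
  have "k\<^sup>2 * (v\<^sup>2 * f) \<le> s\<^sup>2 * (s\<^sup>2 * s\<^sup>2)"
    using assms s f by (intro mult_mono power_mono) auto
  also have "\<dots> = s ^ 6" by (simp add: eval_nat_numeral)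
  finally show "k\<^sup>2 * (v\<^sup>2 * f) \<le> k ^ 6 + f ^ 3 + v ^ 6" using s6 by simp
qed

lemma power_between_le_add:
  fixes x :: real
  assumes "0 \<le> x" "m \<le> n" "n \<le> l"
  shows "x ^ n \<le> x ^ m + x ^ l"
proof (cases "x \<le> 1")
  case True
  then have "x ^ n \<le> x ^ m" using assms by (intro power_decreasing) auto
  then show ?thesis using assms by (simp add: add_increasing2)
next
  case False
  then have "x ^ n \<le> x ^ l" using assms by (intro power_increasing) auto
  then show ?thesis using assms by (simp add: add_increasing)
qed

text \<open>Where k > 1 only powers of k below 3 are integrable, so the excess is shifted to v and
  f. The power 5/2 comes from comparing G with sqrt k; it leaves G^5 \<le> v^20 + f^10, and the
  powers 20 and 10 are interpolated between 6 and 24 and between 3 and 12.\<close>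

lemma mult3_le_powers_near:
  fixes k v f :: real
  assumes "1 < k" "0 \<le> v" "0 \<le> f"
  shows "k * (f\<^sup>2 * v) \<le> k\<^sup>2 + (f ^ 3 + f ^ 12 + v ^ 6)"
    and "k\<^sup>2 * (v\<^sup>2 * f) \<le> k powr (5 / 2) + (v ^ 6 + v ^ 24 + (f ^ 3 + f ^ 12))"
proof -
  define G where "G = f\<^sup>2 * v"
  have "k * G \<le> k\<^sup>2 + G\<^sup>2"
  proof -
    have "0 \<le> k * G" using assms by (simp add: G_def)
    then show ?thesis using sum_squares_bound[of k G] by linarith
  qed
  moreover have "G\<^sup>2 \<le> f ^ 6 + v ^ 6"
  proof -
    define m where "m = max f v"
    have "G\<^sup>2 \<le> (m\<^sup>2 * m)\<^sup>2" using assms unfolding G_def m_def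
      by (intro power_mono mult_mono) auto
    also have "\<dots> = m ^ 6" by (simp add: eval_nat_numeral)
    also have "\<dots> \<le> f ^ 6 + v ^ 6" using assms by (auto simp: m_def max_def)
    finally show ?thesis .
  qed
  moreover have "f ^ 6 \<le> f ^ 3 + f ^ 12" using assms by (intro power_between_le_add) auto
  ultimately show "k * (f\<^sup>2 * v) \<le> k\<^sup>2 + (f ^ 3 + f ^ 12 + v ^ 6)" by (simp add: G_def)
next
  define G where "G = v\<^sup>2 * f"
  have G: "G \<ge> 0" using assms by (simp add: G_def)
  have "k\<^sup>2 * G \<le> k powr (5 / 2) + G ^ 5"
  proof (cases "G \<le> sqrt k")
    case True
    have "k\<^sup>2 * G \<le> k\<^sup>2 * sqrt k" using True by (intro mult_left_mono) auto
    also have "\<dots> = k powr 2 * k powr (1 / 2)" using assms by (simp add: powr_half_sqrt)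
    also have "\<dots> = k powr (5 / 2)" by (simp add: powr_add[symmetric])
    finally show ?thesis using G by (simp add: add_increasing2)
  next
    case False
    then have "sqrt k < G" by simp
    then have "k \<le> G\<^sup>2" using assms power_mono[of "sqrt k" G 2] by simp
    then have "k\<^sup>2 * G \<le> (G\<^sup>2)\<^sup>2 * G" using G assms by (intro mult_right_mono power_mono) auto
    also have "\<dots> = G ^ 5" by (simp add: eval_nat_numeral)
    finally show ?thesis using G by (simp add: add_increasing)
  qed
  moreover have "G ^ 5 \<le> v ^ 20 + f ^ 10"
  proof -
    have "G ^ 5 = v ^ 10 * f ^ 5" by (simp add: G_def power_mult_distrib flip: power_mult)
    also have "\<dots> \<le> (v ^ 10)\<^sup>2 + (f ^ 5)\<^sup>2"
    proof -
      have "0 \<le> v ^ 10 * f ^ 5" using assms by simp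
      then show ?thesis using sum_squares_bound[of "v ^ 10" "f ^ 5"] by linarith
    qed
    finally show ?thesis by (simp flip: power_mult)
  qed
  moreover have "v ^ 20 \<le> v ^ 6 + v ^ 24" "f ^ 10 \<le> f ^ 3 + f ^ 12"
    using assms by (auto intro!: power_between_le_add)
  ultimately show "k\<^sup>2 * (v\<^sup>2 * f) \<le> k powr (5 / 2) + (v ^ 6 + v ^ 24 + (f ^ 3 + f ^ 12))"
    by (simp add: G_def)
qed

context weak_kernel
begin

text \<open>Regularity lifting: one linear operator T contracts both L^6 and L^24. The iteration z
  \<mapsto> F + T z started at 0 increases and stays bounded in L^24, and its limit W satisfies F +
  T W \<le> W. The excess z of v over W satisfies z \<le> T z and lies in L^6, so the other
  contraction forces z = 0.\<close>

lemma higher_integrability_linear: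
  fixes F v :: "'a \<Rightarrow> ennreal" and V :: "'a \<Rightarrow> real"
  assumes [measurable]: "F \<in> borel_measurable M" "v \<in> borel_measurable M" "V \<in> borel_measurable M"
    and contr6: "\<And>z. z \<in> borel_measurable M \<Longrightarrow>
       (\<integral>\<^sup>+x. (\<integral>\<^sup>+y. ennreal (k x y * V y) * z y \<partial>M) ^ 6 \<partial>M) \<le> ennreal (1 / 2) * (\<integral>\<^sup>+x. z x ^ 6 \<partial>M)"
    and contr24: "\<And>z. z \<in> borel_measurable M \<Longrightarrow>
       (\<integral>\<^sup>+x. (\<integral>\<^sup>+y. ennreal (k x y * V y) * z y \<partial>M) ^ 24 \<partial>M) \<le> ennreal (1 / 2 ^ 25) * (\<integral>\<^sup>+x. z x ^ 24 \<partial>M)"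
    and F24: "(\<integral>\<^sup>+x. F x ^ 24 \<partial>M) < \<infinity>" and v6: "(\<integral>\<^sup>+x. v x ^ 6 \<partial>M) < \<infinity>"
    and v_le: "AE x in M. v x \<le> F x + (\<integral>\<^sup>+y. ennreal (k x y * V y) * v y \<partial>M)"
  shows "(\<integral>\<^sup>+x. v x ^ 24 \<partial>M) < \<infinity>"
proof -
  define T where "T z x = (\<integral>\<^sup>+y. ennreal (k x y * V y) * z y \<partial>M)" for z x
  have T [measurable]: "T z \<in> borel_measurable M" if [measurable]: "z \<in> borel_measurable M" for z
    unfolding T_def by measurable
  have T_mono: "T a x \<le> T b x" if "\<And>y. a y \<le> b y" for a b x
    unfolding T_def by (intro nn_integral_mono mult_left_mono that) auto
  define w where "w = rec_nat (\<lambda>x. 0) (\<lambda>n z x. F x + T z x)"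
  have w0: "w 0 = (\<lambda>x. 0)" and wS: "w (Suc n) = (\<lambda>x. F x + T (w n) x)" for n
    by (simp_all add: w_def)
  have w [measurable]: "w n \<in> borel_measurable M" for n
    by (induction n) (simp_all add: w0 wS)
  have w_step: "w n x \<le> w (Suc n) x" for n x
  proof (induction n arbitrary: x)
    case (Suc n)
    show ?case unfolding wS[of "Suc n"] by (subst wS) (intro add_left_mono T_mono Suc)
  qed (simp add: w0)
  have inc: "incseq (\<lambda>n. w n x)" for x using w_step by (simp add: incseq_Suc_iff)
  define \<Phi> where "\<Phi> = (\<integral>\<^sup>+x. F x ^ 24 \<partial>M)"
  \<comment> \<open>The constants close up: the power of a sum costs 2^24, the factor 2^(-25) turns
    the bound 2^25 \<Phi> back into \<Phi>, and 2^24 (\<Phi> + \<Phi>) = 2^25 \<Phi>.\<close>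
  have w24: "(\<integral>\<^sup>+x. w n x ^ 24 \<partial>M) \<le> 2 ^ 25 * \<Phi>" for n
  proof (induction n)
    case (Suc n)
    have "(\<integral>\<^sup>+x. w (Suc n) x ^ 24 \<partial>M) \<le> (\<integral>\<^sup>+x. 2 ^ 24 * (F x ^ 24 + T (w n) x ^ 24) \<partial>M)"
      unfolding wS by (intro nn_integral_mono ennreal_power_add_le)
    also have "\<dots> = 2 ^ 24 * (\<Phi> + (\<integral>\<^sup>+x. T (w n) x ^ 24 \<partial>M))"
      unfolding \<Phi>_def by (subst nn_integral_cmult, measurable, subst nn_integral_add, measurable)
    also have "\<dots> \<le> 2 ^ 24 * (\<Phi> + ennreal (1 / 2 ^ 25) * (2 ^ 25 * \<Phi>))"
    proof (intro mult_left_mono add_left_mono)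
      have "(\<integral>\<^sup>+x. T (w n) x ^ 24 \<partial>M) \<le> ennreal (1 / 2 ^ 25) * (\<integral>\<^sup>+x. w n x ^ 24 \<partial>M)"
        unfolding T_def by (rule contr24) measurable
      also have "\<dots> \<le> ennreal (1 / 2 ^ 25) * (2 ^ 25 * \<Phi>)"
        by (rule mult_left_mono[OF Suc]) simp
      finally show "(\<integral>\<^sup>+x. T (w n) x ^ 24 \<partial>M) \<le> ennreal (1 / 2 ^ 25) * (2 ^ 25 * \<Phi>)" .
    qed simp
    also have "ennreal (1 / 2 ^ 25) * (2 ^ 25 * \<Phi>) = \<Phi>"
    proof -
      have "ennreal (1 / 2 ^ 25) * 2 ^ 25 = ennreal (1 / 2 ^ 25) * ennreal (2 ^ 25)" by simp
      also have "\<dots> = 1" by (subst ennreal_mult[symmetric]) auto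
      finally show ?thesis by (simp only: mult.assoc[symmetric]) simp
    qed
    also have "2 ^ 24 * (\<Phi> + \<Phi>) = 2 ^ 25 * \<Phi>" by (simp add: mult_2[symmetric] mult.assoc[symmetric])
    finally show ?case .
  qed (simp add: w0)
  define W where "W x = (SUP n. w n x)" for x
  have W [measurable]: "W \<in> borel_measurable M" unfolding W_def by measurable
  have lim: "(\<lambda>n. w n x) \<longlonglongrightarrow> W x" for x
    unfolding W_def by (rule LIMSEQ_SUP[OF inc])
  have W24: "(\<integral>\<^sup>+x. W x ^ 24 \<partial>M) \<le> 2 ^ 25 * \<Phi>"
    by (rule nn_integral_limit_le[OF _ _ w24]) (auto intro!: tendsto_power_ennreal lim)
  have W_fix: "F x + T W x \<le> W x" if x [measurable]: "x \<in> space M" for x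
  proof -
    have "T W x = (SUP n. T (w n) x)"
      unfolding T_def W_def SUP_mult_left_ennreal
      by (intro nn_integral_monotone_convergence_SUP)
        (auto simp: incseq_def le_fun_def intro!: mult_left_mono incseqD[OF inc])
    moreover have "incseq (\<lambda>n. T (w n) x)"
      unfolding incseq_Suc_iff by (auto intro!: T_mono w_step)
    ultimately have "(\<lambda>n. T (w n) x) \<longlonglongrightarrow> T W x" using LIMSEQ_SUP by metis
    then have "(\<lambda>n. F x + T (w n) x) \<longlonglongrightarrow> F x + T W x" by (intro tendsto_intros)
    moreover have "F x + T (w n) x \<le> W x" for n
      unfolding W_def by (intro SUP_upper2[of "Suc n"]) (auto simp: wS)
    ultimately show ?thesis by (intro LIMSEQ_le_const2) auto
  qed
  \<comment> \<open>Subtraction in ennreal is cut off at 0, so z is the positive part of v - W. The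
    value infinity of v, where subtraction misbehaves, is excluded almost everywhere.\<close>
  define z where "z x = v x - W x" for x
  have z [measurable]: "z \<in> borel_measurable M" unfolding z_def by measurable
  have "AE x in M. v x ^ 6 \<noteq> \<infinity>" using v6 by (intro nn_integral_PInf_AE) auto
  then have v_fin: "AE x in M. v x \<noteq> top"
    by (rule eventually_mono) (auto simp: power_eq_top_ennreal)
  have zT: "AE x in M. z x \<le> T z x"
    using v_le AE_space v_fin
  proof eventually_elim
    case (elim x)
    note [measurable] = elim(2)
    have "T v x \<le> T (\<lambda>y. W y + z y) x"
    proof (intro T_mono)
      fix y
      show "v y \<le> W y + z y"
      proof (cases "W y \<le> v y")
        case True
        then show ?thesis by (simp add: z_def add_diff_inverse_ennreal)
      next
        case False
        then show ?thesis by (simp add: add_increasing2)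
      qed
    qed
    also have "\<dots> = T W x + T z x"
      unfolding T_def by (simp add: distrib_left nn_integral_add)
    finally have "v x \<le> F x + (T W x + T z x)"
      using elim(1) unfolding T_def by (meson add_left_mono order_trans)
    also have "\<dots> \<le> W x + T z x"
      using W_fix[OF elim(2)] by (simp add: add.assoc[symmetric] add_right_mono)
    finally show ?case using elim(3) unfolding z_def by (simp add: ennreal_minus_le_iff)
  qed
  define Z where "Z = (\<integral>\<^sup>+x. z x ^ 6 \<partial>M)"
  have "Z \<le> (\<integral>\<^sup>+x. T z x ^ 6 \<partial>M)"
    unfolding Z_def using zT by (intro nn_integral_mono_AE) (auto intro!: power_mono elim!: eventually_mono)
  also have "\<dots> \<le> ennreal (1 / 2) * Z" unfolding T_def Z_def by (rule contr6) measurable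
  finally have Z2: "Z \<le> ennreal (1 / 2) * Z" .
  have "Z \<le> (\<integral>\<^sup>+x. v x ^ 6 \<partial>M)"
    unfolding Z_def by (intro nn_integral_mono power_mono) (auto simp: z_def diff_le_self_ennreal)
  \<comment> \<open>Finiteness is what turns Z \<le> Z / 2 into Z = 0; this is where v in L^6
    enters.\<close>
  then have "Z < \<infinity>" using v6 by simp
  then obtain r where r: "Z = ennreal r" "r \<ge> 0" by (cases Z) auto
  then have "ennreal r \<le> ennreal (1 / 2 * r)"
    using Z2 unfolding r(1) by (subst ennreal_mult) auto
  then have "r \<le> 1 / 2 * r" using r by (subst (asm) ennreal_le_iff) auto
  then have "Z = 0" using r by simp
  then have "AE x in M. z x = 0" unfolding Z_def by (subst (asm) nn_integral_0_iff_AE) auto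
  then have "AE x in M. v x \<le> W x"
    by (rule eventually_mono) (simp add: z_def diff_eq_0_iff_ennreal)
  then have "(\<integral>\<^sup>+x. v x ^ 24 \<partial>M) \<le> (\<integral>\<^sup>+x. W x ^ 24 \<partial>M)"
    by (intro nn_integral_mono_AE) (auto intro!: power_mono elim!: eventually_mono)
  also have "\<dots> < \<infinity>"
    using F24 W24 unfolding \<Phi>_def by (auto simp: ennreal_mult_less_top power_less_top_ennreal intro: le_less_trans)
  finally show ?thesis .
qed

end

lemma ex_contraction_radius:
  fixes a b :: real
  assumes "a > 0" "b > 0"
  shows "\<exists>\<delta>>0. a * \<delta> ^ 6 \<le> 1 / 2 \<and> b * \<delta> ^ 24 \<le> 1 / 2 ^ 25"
proof -
  \<comment> \<open>For \<delta> \<le> 1 both powers are at most \<delta> itself, so linear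
    conditions suffice.\<close>
  define \<delta> where "\<delta> = min 1 (min (1 / (2 * a)) (1 / (2 ^ 25 * b)))"
  have \<delta>: "0 < \<delta>" "\<delta> \<le> 1" "\<delta> \<le> 1 / (2 * a)" "\<delta> \<le> 1 / (2 ^ 25 * b)"
    using assms by (auto simp: \<delta>_def)
  have "\<delta> ^ 6 \<le> \<delta>" "\<delta> ^ 24 \<le> \<delta>"
    using power_decreasing[of 1 6 \<delta>] power_decreasing[of 1 24 \<delta>] \<delta> by auto
  then have "\<delta> ^ 6 \<le> 1 / (2 * a)" "\<delta> ^ 24 \<le> 1 / (2 ^ 25 * b)"
    using \<delta> by linarith+
  then have "a * \<delta> ^ 6 \<le> a * (1 / (2 * a))" "b * \<delta> ^ 24 \<le> b * (1 / (2 ^ 25 * b))"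
    using assms by (intro mult_left_mono; simp)+
  then show ?thesis using \<delta> assms by (intro exI[of _ \<delta>]) simp
qed

text \<open>Dominated convergence: a point with f > 0 satisfies 1/n \<le> f \<le> n for all large n.
  The two-sided cut is chosen so that on the set removed f is bounded, and that set has finite
  measure, since f \<ge> 1/n there.\<close>

lemma tail_cubes_small:
  fixes f :: "'a \<Rightarrow> real"
  assumes [measurable]: "f \<in> borel_measurable M" and f0: "\<And>x. 0 \<le> f x"
    and f3: "(\<integral>\<^sup>+x. ennreal (f x ^ 3) \<partial>M) < \<infinity>" and "\<epsilon> > (0 :: real)"
  shows "\<exists>n::nat. n > 0 \<and> (\<integral>\<^sup>+x. ennreal (if 1 / n \<le> f x \<and> f x \<le> n then 0 else f x ^ 3) \<partial>M) \<le> ennreal \<epsilon>"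
proof -
  have "(\<lambda>n. \<integral>\<^sup>+x. ennreal (if 1 / real n \<le> f x \<and> f x \<le> n then 0 else f x ^ 3) \<partial>M)
      \<longlonglongrightarrow> (\<integral>\<^sup>+x. 0 \<partial>M)"
  proof (rule nn_integral_dominated_convergence[where w = "\<lambda>x. ennreal (f x ^ 3)"])
    show "AE x in M. (\<lambda>n. ennreal (if 1 / real n \<le> f x \<and> f x \<le> real n then 0 else f x ^ 3)) \<longlonglongrightarrow> 0"
    proof (rule AE_I2)
      fix x
      show "(\<lambda>n. ennreal (if 1 / real n \<le> f x \<and> f x \<le> real n then 0 else f x ^ 3)) \<longlonglongrightarrow> 0"
      proof (cases "f x = 0")
        case False
        then have fx: "f x > 0" using f0[of x] by simp
        obtain m :: nat where m: "f x \<le> m" "1 / f x \<le> m"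
          using real_arch_simple[of "max (f x) (1 / f x)"] by auto
        have "m > 0" using m fx by (cases m) auto
        have "1 / real n \<le> f x \<and> f x \<le> n" if "m \<le> n" for n :: nat
        proof
          have "real n > 0" using that \<open>m > 0\<close> by simp
          moreover have "1 \<le> f x * n" using m that fx
            by (smt (verit) divide_le_eq mult.commute mult_left_mono of_nat_mono)
          ultimately show "1 / real n \<le> f x" by (simp add: field_simps)
          show "f x \<le> n" using m that by (meson of_nat_mono order_trans)
        qed
        then show ?thesis
          by (intro tendsto_eventually) (auto simp: eventually_sequentially)
      qed (simp cong: if_cong)
    qed
    show "AE x in M. ennreal (if 1 / real n \<le> f x \<and> f x \<le> real n then 0 else f x ^ 3) \<le> ennreal (f x ^ 3)" for n
      using f0 by (intro AE_I2 ennreal_leI) auto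
  qed (use f3 in auto)
  then have "(\<lambda>n. \<integral>\<^sup>+x. ennreal (if 1 / real n \<le> f x \<and> f x \<le> n then 0 else f x ^ 3) \<partial>M) \<longlonglongrightarrow> 0"
    by simp
  then have "\<forall>\<^sub>F n in sequentially.
      (\<integral>\<^sup>+x. ennreal (if 1 / real n \<le> f x \<and> f x \<le> n then 0 else f x ^ 3) \<partial>M) < ennreal \<epsilon>"
    using assms by (intro order_tendstoD) auto
  then have "\<forall>\<^sub>F n in sequentially. n > 0 \<and>
      (\<integral>\<^sup>+x. ennreal (if 1 / real n \<le> f x \<and> f x \<le> n then 0 else f x ^ 3) \<partial>M) < ennreal \<epsilon>"
    using eventually_gt_at_top[of 0] by eventually_elim auto
  from eventually_happens'[OF sequentially_bot this] show ?thesis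
    by (auto intro: less_imp_le)
qed

context weak_kernel
begin

lemma k_square_high:
  assumes "x \<in> space M"
  shows "(\<integral>\<^sup>+y. ennreal (if 1 < k x y then (k x y)\<^sup>2 else 0) \<partial>M) \<le> ennreal (weak_high_const A 2)"
proof -
  have "(\<integral>\<^sup>+y. ennreal (if 1 < k x y then (k x y)\<^sup>2 else 0) \<partial>M)
      = (\<integral>\<^sup>+y. ennreal (if 1 < k x y then k x y powr 2 else 0) \<partial>M)"
    by (intro nn_integral_cong) auto
  then show ?thesis using k_high[OF assms, of 2 1] by simp
qed

text \<open>The part of f^2 that is not small is bounded and carried by a set E of finite measure.
  Its potential F therefore has a sup bound, and it lies in L^6 by the operator bound; the two
  together put the inhomogeneity of the linear inequality into L^24.\<close>

lemma first_unknown_L24: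
  fixes v f :: "'a \<Rightarrow> real"
  assumes [measurable]: "v \<in> borel_measurable M" "f \<in> borel_measurable M"
    and v0: "\<And>x. 0 \<le> v x" and f0: "\<And>x. 0 \<le> f x"
    and v6: "(\<integral>\<^sup>+x. ennreal (v x ^ 6) \<partial>M) < \<infinity>" and f3: "(\<integral>\<^sup>+x. ennreal (f x ^ 3) \<partial>M) < \<infinity>"
    and v_le: "AE x in M. ennreal (v x) \<le> (\<integral>\<^sup>+y. ennreal (k x y * ((f y)\<^sup>2 * v y)) \<partial>M)"
  shows "(\<integral>\<^sup>+x. ennreal (v x ^ 24) \<partial>M) < \<infinity>"
proof -
  obtain C6 where C6: "C6 > 0" "operator_bound 6 C6" using ex_operator_bound[of 6] by auto
  obtain C24 where C24: "C24 > 0" "operator_bound 24 C24" using ex_operator_bound[of 24] by auto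
  obtain \<delta> where \<delta>: "\<delta> > 0" "C6 * \<delta> ^ 6 \<le> 1 / 2" "C24 * \<delta> ^ 24 \<le> 1 / 2 ^ 25"
    using ex_contraction_radius[OF C6(1) C24(1)] by blast
  obtain n :: nat where n: "n > 0"
    "(\<integral>\<^sup>+x. ennreal (if 1 / n \<le> f x \<and> f x \<le> n then 0 else f x ^ 3) \<partial>M) \<le> ennreal (\<delta> powr (3 / 2))"
    using tail_cubes_small[OF _ f0 f3, of "\<delta> powr (3 / 2)"] \<delta> by auto
  define E where "E = {x \<in> space M. 1 / n \<le> f x \<and> f x \<le> n}"
  have [measurable]: "E \<in> sets M" unfolding E_def by measurable
  define V1 where "V1 x = (if 1 / n \<le> f x \<and> f x \<le> n then 0 else (f x)\<^sup>2)" for x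
  define V2 where "V2 x = (if 1 / n \<le> f x \<and> f x \<le> n then (f x)\<^sup>2 else 0)" for x
  have V_meas [measurable]: "V1 \<in> borel_measurable M" "V2 \<in> borel_measurable M"
    unfolding V1_def V2_def by measurable
  have V0: "V1 x \<ge> 0" "V2 x \<ge> 0" for x by (auto simp: V1_def V2_def)
  have f32: "(f x)\<^sup>2 powr (3 / 2) = f x ^ 3" for x
  proof (cases "f x = 0")
    case False
    then have "f x > 0" using f0[of x] by simp
    then have "(f x)\<^sup>2 powr (3 / 2) = (f x powr 2) powr (3 / 2)" by simp
    also have "\<dots> = f x powr 3" by (simp add: powr_powr)
    finally show ?thesis using \<open>f x > 0\<close> by simp
  qed simp
  have "(\<integral>\<^sup>+x. ennreal (V1 x powr (3 / 2)) \<partial>M)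
      = (\<integral>\<^sup>+x. ennreal (if 1 / n \<le> f x \<and> f x \<le> n then 0 else f x ^ 3) \<partial>M)"
    by (intro nn_integral_cong) (auto simp: V1_def f32)
  then have V1\<delta>: "(\<integral>\<^sup>+x. ennreal (V1 x powr (3 / 2)) \<partial>M) \<le> ennreal (\<delta> powr (3 / 2))" using n by simp
  define F where "F x = (\<integral>\<^sup>+y. ennreal (k x y * V2 y) * ennreal (v y) \<partial>M)" for x
  have F [measurable]: "F \<in> borel_measurable M" unfolding F_def by measurable
  define Y where "Y = enn2real (\<integral>\<^sup>+x. ennreal (f x ^ 3) \<partial>M)"
  have Y: "(\<integral>\<^sup>+x. ennreal (f x ^ 3) \<partial>M) = ennreal Y" "Y \<ge> 0"
    using f3 by (auto simp: Y_def)
  have F6: "(\<integral>\<^sup>+x. F x ^ 6 \<partial>M) < \<infinity>"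
  proof -
    have "(\<integral>\<^sup>+x. ennreal (V2 x powr (3 / 2)) \<partial>M) \<le> (\<integral>\<^sup>+x. ennreal (f x ^ 3) \<partial>M)"
      using f0 by (intro nn_integral_mono ennreal_leI) (auto simp: V2_def f32)
    \<comment> \<open>A crude radius: here the operator bound only has to give a finite
      value.\<close>
    also have "\<dots> \<le> ennreal ((1 + Y) powr (3 / 2))"
    proof -
      have "Y \<le> (1 + Y) powr 1" using Y by simp
      also have "\<dots> \<le> (1 + Y) powr (3 / 2)" using Y by (intro powr_mono) auto
      finally show ?thesis unfolding Y by (intro ennreal_leI)
    qed
    finally have "(\<integral>\<^sup>+x. F x ^ 6 \<partial>M) \<le> ennreal (C6 * (1 + Y) ^ 6) * (\<integral>\<^sup>+x. ennreal (v x) ^ 6 \<partial>M)"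
      unfolding F_def using Y V0 by (intro operator_boundD[OF C6(2)]) auto
    also have "\<dots> < \<infinity>" using v6 v0 by (simp add: ennreal_power ennreal_mult_less_top)
    finally show ?thesis .
  qed
  have E_fin: "emeasure M E < \<infinity>"
  proof -
    have "emeasure M E = (\<integral>\<^sup>+x. indicator E x \<partial>M)" by simp
    also have "\<dots> \<le> (\<integral>\<^sup>+x. ennreal (n ^ 3) * ennreal (f x ^ 3) \<partial>M)"
    proof (intro nn_integral_mono)
      fix x assume "x \<in> space M"
      have "1 \<le> (real n * f x) ^ 3" if "x \<in> E"
        using that n by (intro one_le_power) (auto simp: E_def field_simps)
      then show "indicator E x \<le> ennreal (n ^ 3) * ennreal (f x ^ 3)"
        using f0 by (auto simp: indicator_def ennreal_mult[symmetric] power_mult_distrib)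
    qed
    also have "\<dots> < \<infinity>" using f3 by (simp add: nn_integral_cmult ennreal_mult_less_top)
    finally show ?thesis .
  qed
  define K where "K = ennreal (n\<^sup>2) * (ennreal (weak_high_const A 2) + (emeasure M E + (\<integral>\<^sup>+x. ennreal (v x ^ 6) \<partial>M)))"
  have K: "K < \<infinity>" using E_fin v6 by (simp add: K_def ennreal_mult_less_top)
  have F_bound: "F x \<le> K" if x [measurable]: "x \<in> space M" for x
  proof -
    have "F x \<le> (\<integral>\<^sup>+y. ennreal (n\<^sup>2) * (ennreal (if 1 < k x y then (k x y)\<^sup>2 else 0) + (indicator E y + ennreal (v y ^ 6))) \<partial>M)"
      unfolding F_def
    proof (intro nn_integral_mono)
      fix y assume y: "y \<in> space M"
      show "ennreal (k x y * V2 y) * ennreal (v y) \<le> ennreal (n\<^sup>2) *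
          (ennreal (if 1 < k x y then (k x y)\<^sup>2 else 0) + (indicator E y + ennreal (v y ^ 6)))"
      proof (cases "y \<in> E")
        case True
        then have V: "V2 y \<le> n\<^sup>2" using f0 by (auto simp: V2_def E_def intro!: power_mono)
        have v1: "v y \<le> 1 + v y ^ 6" using power_between_le_add[of "v y" 0 1 6] v0 by simp
        have v2: "v y ^ 2 \<le> 1 + v y ^ 6" using power_between_le_add[of "v y" 0 2 6] v0 by simp
        \<comment> \<open>Where k > 1 the product is split into squares, k^2 being integrable there;
          elsewhere k is at most 1 and v \<le> 1 + v^6. The constant 1 is integrated over E
          only.\<close>
        have kv: "k x y * v y \<le> (if 1 < k x y then (k x y)\<^sup>2 else 0) + (1 + v y ^ 6)"
        proof (cases "1 < k x y")
          case True
          have "0 \<le> k x y * v y" using k_nonneg v0 by simp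
          then have "k x y * v y \<le> (k x y)\<^sup>2 + (v y)\<^sup>2"
            using sum_squares_bound[of "k x y" "v y"] by linarith
          then show ?thesis using True v2 by simp
        next
          case False
          then have "k x y * v y \<le> 1 * v y" using v0 by (intro mult_right_mono) auto
          then show ?thesis using False v1 by simp
        qed
        have "k x y * V2 y * v y = V2 y * (k x y * v y)" by simp
        also have "\<dots> \<le> n\<^sup>2 * ((if 1 < k x y then (k x y)\<^sup>2 else 0) + (1 + v y ^ 6))"
          using V V0 v0 k_nonneg by (intro mult_mono kv) auto
        finally have "ennreal (k x y * V2 y * v y) \<le> ennreal (n\<^sup>2 * ((if 1 < k x y then (k x y)\<^sup>2 else 0) + (1 + v y ^ 6)))"
          by (rule ennreal_leI)
        then show ?thesis using True v0 k_nonneg V0 by (simp add: ennreal_mult ennreal_plus)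
      next
        case False
        then have "V2 y = 0" using y by (auto simp: V2_def E_def)
        then show ?thesis by simp
      qed
    qed
    also have "\<dots> = ennreal (n\<^sup>2) * ((\<integral>\<^sup>+y. ennreal (if 1 < k x y then (k x y)\<^sup>2 else 0) \<partial>M)
        + (emeasure M E + (\<integral>\<^sup>+x. ennreal (v x ^ 6) \<partial>M)))"
      by (simp add: nn_integral_cmult nn_integral_add)
    also have "\<dots> \<le> K"
      unfolding K_def using k_square_high[OF x] by (intro mult_left_mono add_right_mono) auto
    finally show ?thesis .
  qed
  have F24: "(\<integral>\<^sup>+x. F x ^ 24 \<partial>M) < \<infinity>"
  proof -
    have "(\<integral>\<^sup>+x. F x ^ 24 \<partial>M) \<le> (\<integral>\<^sup>+x. K ^ 18 * F x ^ 6 \<partial>M)"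
    proof (intro nn_integral_mono)
      fix x assume "x \<in> space M"
      \<comment> \<open>Interpolation between L^6 and the sup bound K.\<close>
      have "F x ^ 24 = F x ^ 18 * F x ^ 6" by (simp add: power_add[symmetric])
      also have "\<dots> \<le> K ^ 18 * F x ^ 6"
        by (intro mult_right_mono power_mono F_bound) (auto simp: \<open>x \<in> space M\<close>)
      finally show "F x ^ 24 \<le> K ^ 18 * F x ^ 6" .
    qed
    also have "\<dots> = K ^ 18 * (\<integral>\<^sup>+x. F x ^ 6 \<partial>M)" by (simp add: nn_integral_cmult)
    also have "\<dots> < \<infinity>" using K F6 by (simp add: ennreal_mult_less_top power_less_top_ennreal)
    finally show ?thesis .
  qed
  have "(\<integral>\<^sup>+x. ennreal (v x) ^ 24 \<partial>M) < \<infinity>"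
  proof (rule higher_integrability_linear[OF F _ V_meas(1)])
    show "(\<integral>\<^sup>+x. (\<integral>\<^sup>+y. ennreal (k x y * V1 y) * z y \<partial>M) ^ 6 \<partial>M) \<le> ennreal (1 / 2) * (\<integral>\<^sup>+x. z x ^ 6 \<partial>M)"
      if "z \<in> borel_measurable M" for z
      by (rule order_trans[OF operator_boundD[OF C6(2) V_meas(1) that V0(1) \<delta>(1) V1\<delta>]])
        (intro mult_right_mono ennreal_leI \<delta>, simp)
    show "(\<integral>\<^sup>+x. (\<integral>\<^sup>+y. ennreal (k x y * V1 y) * z y \<partial>M) ^ 24 \<partial>M) \<le> ennreal (1 / 2 ^ 25) * (\<integral>\<^sup>+x. z x ^ 24 \<partial>M)"
      if "z \<in> borel_measurable M" for z
      by (rule order_trans[OF operator_boundD[OF C24(2) V_meas(1) that V0(1) \<delta>(1) V1\<delta>]])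
        (intro mult_right_mono ennreal_leI \<delta>, simp)
    show "(\<integral>\<^sup>+x. ennreal (v x) ^ 6 \<partial>M) < \<infinity>" using v6 v0 by (simp add: ennreal_power)
    show "AE x in M. ennreal (v x) \<le> F x + (\<integral>\<^sup>+y. ennreal (k x y * V1 y) * ennreal (v y) \<partial>M)"
      using v_le AE_space
    proof eventually_elim
      case (elim x)
      note [measurable] = elim(2)
      have "(\<integral>\<^sup>+y. ennreal (k x y * ((f y)\<^sup>2 * v y)) \<partial>M)
          = (\<integral>\<^sup>+y. ennreal (k x y * V2 y) * ennreal (v y) + ennreal (k x y * V1 y) * ennreal (v y) \<partial>M)"
        using v0 k_nonneg V0 by (intro nn_integral_cong) (auto simp: V1_def V2_def ennreal_mult[symmetric] mult_ac)
      also have "\<dots> = F x + (\<integral>\<^sup>+y. ennreal (k x y * V1 y) * ennreal (v y) \<partial>M)"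
        unfolding F_def by (rule nn_integral_add) measurable
      finally show ?case using elim(1) by simp
    qed
  qed (use F24 in auto)
  then show ?thesis using v0 by (simp add: ennreal_power)
qed

text \<open>For N = 12 and \<rho> = 2 the exponent relation gives \<beta> = 5/4, so v^2 f has to lie
  in L^(12/5). Its power 12/5 is (v^24)^(1/5) (f^3)^(4/5), and the weights 1/5 and 4/5 add up to
  1.\<close>

lemma second_unknown_L12:
  fixes v f :: "'a \<Rightarrow> real"
  assumes [measurable]: "v \<in> borel_measurable M" "f \<in> borel_measurable M"
    and v0: "\<And>x. 0 \<le> v x" and f0: "\<And>x. 0 \<le> f x"
    and v24: "(\<integral>\<^sup>+x. ennreal (v x ^ 24) \<partial>M) < \<infinity>" and f3: "(\<integral>\<^sup>+x. ennreal (f x ^ 3) \<partial>M) < \<infinity>"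
    and f_le: "AE x in M. ennreal (f x) \<le> (\<integral>\<^sup>+y. ennreal ((k x y)\<^sup>2 * ((v y)\<^sup>2 * f y)) \<partial>M)"
  shows "(\<integral>\<^sup>+x. ennreal (f x ^ 12) \<partial>M) < \<infinity>"
proof -
  have "(\<integral>\<^sup>+x. ennreal (v x ^ 24) + ennreal (f x ^ 3) \<partial>M) < \<infinity>"
    using v24 f3 by (simp add: nn_integral_add)
  moreover define Y where "Y = enn2real (\<integral>\<^sup>+x. ennreal (v x ^ 24) + ennreal (f x ^ 3) \<partial>M)"
  ultimately have Y: "(\<integral>\<^sup>+x. ennreal (v x ^ 24) + ennreal (f x ^ 3) \<partial>M) = ennreal Y" "Y \<ge> 0"
    by (simp_all only: ennreal_enn2real infinity_ennreal_def enn2real_nonneg)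
  \<comment> \<open>Since D \<ge> 1 also D \<le> D^(12/5), so dividing v^2 f by D is enough to
    normalise the integral of G^(12/5).\<close>
  define D where "D = 1 + Y"
  have D: "D > 0" "Y \<le> D" "1 \<le> D" using Y by (auto simp: D_def)
  define G where "G x = (v x)\<^sup>2 * f x / D" for x
  have G0: "G x \<ge> 0" for x using v0 f0 D by (simp add: G_def)
  have G [measurable]: "G \<in> borel_measurable M" unfolding G_def by measurable
  define B where "B = hls_const (3 - 3 / real 12) (5 / 4) 2 ^ 12"
  have G_int: "(\<integral>\<^sup>+x. (\<integral>\<^sup>+y. ennreal (k x y powr 2 * G y) \<partial>M) ^ 12 \<partial>M) \<le> ennreal B"
    unfolding B_def
  proof (rule potential_power_bound)
    have "ennreal (G x powr (3 / (5 / 4))) \<le> ennreal (1 / D) * (ennreal (v x ^ 24) + ennreal (f x ^ 3))" for x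
    proof -
      have "((v x)\<^sup>2 * f x) powr (12 / 5) = (v x ^ 24) powr (1 / 5) * (f x ^ 3) powr (4 / 5)"
      proof (cases "v x = 0 \<or> f x = 0")
        case False
        then have "v x > 0" "f x > 0" using v0[of x] f0[of x] by auto
        then show ?thesis by (simp add: powr_mult powr_powr flip: powr_numeral)
      qed auto
      also have "\<dots> \<le> v x ^ 24 + f x ^ 3" using v0 f0 by (intro powr_mult_powr_le_add) auto
      finally have 1: "((v x)\<^sup>2 * f x) powr (12 / 5) \<le> v x ^ 24 + f x ^ 3" .
      have "D powr 1 \<le> D powr (12 / 5)" using D by (intro powr_mono) auto
      then have 2: "D \<le> D powr (12 / 5)" using D by simp
      have "G x powr (3 / (5 / 4)) = ((v x)\<^sup>2 * f x) powr (12 / 5) / D powr (12 / 5)"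
        using v0 f0 D by (simp add: G_def powr_divide)
      also have "\<dots> \<le> (v x ^ 24 + f x ^ 3) / D"
        using 1 2 D v0 f0 by (intro frac_le) auto
      finally have "ennreal (G x powr (3 / (5 / 4))) \<le> ennreal (1 / D * (v x ^ 24 + f x ^ 3))"
        by (intro ennreal_leI) simp
      then show ?thesis using v0 f0 D by (subst (asm) ennreal_mult) (auto simp: ennreal_plus)
    qed
    then have "(\<integral>\<^sup>+x. ennreal (G x powr (3 / (5 / 4))) \<partial>M)
        \<le> (\<integral>\<^sup>+x. ennreal (1 / D) * (ennreal (v x ^ 24) + ennreal (f x ^ 3)) \<partial>M)"
      by (intro nn_integral_mono)
    also have "\<dots> = ennreal (1 / D) * ennreal Y" unfolding Y(1)[symmetric] by (rule nn_integral_cmult) measurable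
    also have "\<dots> = ennreal (Y / D)" using D Y by (simp add: ennreal_mult[symmetric])
    also have "\<dots> \<le> ennreal 2" using D Y by (intro ennreal_leI) (auto simp: field_simps)
    finally show "(\<integral>\<^sup>+x. ennreal (G x powr (3 / (5 / 4))) \<partial>M) \<le> 2" by simp
  qed (use G0 in auto)
  have "(\<integral>\<^sup>+x. ennreal (f x) ^ 12 \<partial>M) \<le> (\<integral>\<^sup>+x. ennreal (D ^ 12) * (\<integral>\<^sup>+y. ennreal (k x y powr 2 * G y) \<partial>M) ^ 12 \<partial>M)"
  proof (rule nn_integral_mono_AE)
    show "AE x in M. ennreal (f x) ^ 12 \<le> ennreal (D ^ 12) * (\<integral>\<^sup>+y. ennreal (k x y powr 2 * G y) \<partial>M) ^ 12"
      using f_le AE_space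
    proof eventually_elim
      case (elim x)
      note [measurable] = elim(2)
      have "(\<integral>\<^sup>+y. ennreal ((k x y)\<^sup>2 * ((v y)\<^sup>2 * f y)) \<partial>M) = (\<integral>\<^sup>+y. ennreal D * ennreal (k x y powr 2 * G y) \<partial>M)"
        using D G0 k_nonneg v0 f0 by (intro nn_integral_cong) (simp add: G_def ennreal_mult[symmetric])
      also have "\<dots> = ennreal D * (\<integral>\<^sup>+y. ennreal (k x y powr 2 * G y) \<partial>M)"
        by (rule nn_integral_cmult) measurable
      finally have "ennreal (f x) ^ 12 \<le> (ennreal D * (\<integral>\<^sup>+y. ennreal (k x y powr 2 * G y) \<partial>M)) ^ 12"
        using elim(1) by (intro power_mono) auto
      then show ?case using D by (simp add: power_mult_distrib ennreal_power)
    qed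
  qed
  also have "\<dots> = ennreal (D ^ 12) * (\<integral>\<^sup>+x. (\<integral>\<^sup>+y. ennreal (k x y powr 2 * G y) \<partial>M) ^ 12 \<partial>M)"
    by (rule nn_integral_cmult) measurable
  also have "\<dots> < \<infinity>" using G_int by (simp add: ennreal_mult_less_top le_less_trans)
  finally show ?thesis using f0 by (simp add: ennreal_power)
qed

text \<open>The kernel enters to the power 6 where it is at most 1 and to the powers 2 and 5/2 where
  it exceeds 1. Each power is on the integrable side of 3 in its region, uniformly in x, and the
  remaining terms are integrals of v^6, v^24, f^3 and f^12 that do not depend on x.\<close>

theorem coupled_potentials_bounded:
  fixes v f :: "'a \<Rightarrow> real"
  assumes [measurable]: "v \<in> borel_measurable M" "f \<in> borel_measurable M"
    and v0: "\<And>x. 0 \<le> v x" and f0: "\<And>x. 0 \<le> f x"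
    and v6: "(\<integral>\<^sup>+x. ennreal (v x ^ 6) \<partial>M) < \<infinity>" and f3: "(\<integral>\<^sup>+x. ennreal (f x ^ 3) \<partial>M) < \<infinity>"
    and v_le: "AE x in M. ennreal (v x) \<le> (\<integral>\<^sup>+y. ennreal (k x y * ((f y)\<^sup>2 * v y)) \<partial>M)"
    and f_le: "AE x in M. ennreal (f x) \<le> (\<integral>\<^sup>+y. ennreal ((k x y)\<^sup>2 * ((v y)\<^sup>2 * f y)) \<partial>M)"
  shows "\<exists>B. AE x in M. v x \<le> B \<and> f x \<le> B"
proof -
  have v24: "(\<integral>\<^sup>+x. ennreal (v x ^ 24) \<partial>M) < \<infinity>"
    by (rule first_unknown_L24[OF _ _ v0 f0 v6 f3 v_le]) auto
  have f12: "(\<integral>\<^sup>+x. ennreal (f x ^ 12) \<partial>M) < \<infinity>"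
    by (rule second_unknown_L12[OF _ _ v0 f0 v24 f3 f_le]) auto
  let ?l = "\<lambda>x y. ennreal (if k x y \<le> 1 then k x y powr 6 else 0)"
  let ?h = "\<lambda>x y. ennreal (if 1 < k x y then (k x y)\<^sup>2 else 0)"
  let ?h' = "\<lambda>x y. ennreal (if 1 < k x y then k x y powr (5 / 2) else 0)"
  let ?S = "\<lambda>y. ennreal (v y ^ 6) + ennreal (v y ^ 24) + ennreal (f y ^ 3) + ennreal (f y ^ 12)"
  define J where "J = ennreal (weak_low_const A 6) + ennreal (weak_high_const A 2)
    + ennreal (weak_high_const A (5 / 2)) + (\<integral>\<^sup>+y. ?S y \<partial>M)"
  have "(\<integral>\<^sup>+y. ?S y \<partial>M) < \<infinity>" using v6 v24 f3 f12 by (simp add: nn_integral_add)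
  then have J: "J < \<infinity>" by (simp add: J_def)
  have bound: "(\<integral>\<^sup>+y. ?l x y + ?h x y + ?h' x y + ?S y \<partial>M) \<le> J" if x [measurable]: "x \<in> space M" for x
  proof -
    have "(\<integral>\<^sup>+y. ?l x y + ?h x y + ?h' x y + ?S y \<partial>M)
      = (\<integral>\<^sup>+y. ?l x y \<partial>M) + (\<integral>\<^sup>+y. ?h x y \<partial>M) + (\<integral>\<^sup>+y. ?h' x y \<partial>M) + (\<integral>\<^sup>+y. ?S y \<partial>M)"
      by (simp add: nn_integral_add)
    also have "\<dots> \<le> J"
      unfolding J_def using k_low[OF x, of 6 1] k_square_high[OF x] k_high[OF x, of "5 / 2" 1]
      by (intro add_mono) auto
    finally show ?thesis .
  qed
  have pt: "ennreal (k x y * ((f y)\<^sup>2 * v y)) \<le> ?l x y + ?h x y + ?h' x y + ?S y"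
    "ennreal ((k x y)\<^sup>2 * ((v y)\<^sup>2 * f y)) \<le> ?l x y + ?h x y + ?h' x y + ?S y" for x y
  proof -
    let ?r = "(if k x y \<le> 1 then k x y powr 6 else 0) + (if 1 < k x y then (k x y)\<^sup>2 else 0)
      + (if 1 < k x y then k x y powr (5 / 2) else 0) + (v y ^ 6 + v y ^ 24 + f y ^ 3 + f y ^ 12)"
    have nn: "0 \<le> v y ^ 6" "0 \<le> v y ^ 24" "0 \<le> f y ^ 3" "0 \<le> f y ^ 12" "0 \<le> k x y powr (5 / 2)" "0 \<le> (k x y)\<^sup>2"
      using v0 f0 by auto
    have r: "ennreal ?r = ?l x y + ?h x y + ?h' x y + ?S y"
      using v0 f0 by (simp add: ennreal_plus)
    have "k x y * ((f y)\<^sup>2 * v y) \<le> ?r \<and> (k x y)\<^sup>2 * ((v y)\<^sup>2 * f y) \<le> ?r"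
    proof (cases "1 < k x y")
      case True
      then have "?r = (k x y)\<^sup>2 + k x y powr (5 / 2) + (v y ^ 6 + v y ^ 24 + f y ^ 3 + f y ^ 12)"
        by simp
      then show ?thesis using mult3_le_powers_near[OF True v0[of y] f0[of y]] nn by linarith
    next
      case False
      then have "?r = k x y ^ 6 + (v y ^ 6 + v y ^ 24 + f y ^ 3 + f y ^ 12)"
        using k_nonneg[of x y] by simp
      then show ?thesis using mult3_le_powers[OF k_nonneg[of x y] v0[of y] f0[of y]] nn by linarith
    qed
    then show "ennreal (k x y * ((f y)\<^sup>2 * v y)) \<le> ?l x y + ?h x y + ?h' x y + ?S y"
      "ennreal ((k x y)\<^sup>2 * ((v y)\<^sup>2 * f y)) \<le> ?l x y + ?h x y + ?h' x y + ?S y"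
      unfolding r[symmetric] by (auto intro: ennreal_leI)
  qed
  have "AE x in M. v x \<le> enn2real J \<and> f x \<le> enn2real J"
    using v_le f_le AE_space
  proof eventually_elim
    case (elim x)
    have "(\<integral>\<^sup>+y. ennreal (k x y * ((f y)\<^sup>2 * v y)) \<partial>M) \<le> J"
      "(\<integral>\<^sup>+y. ennreal ((k x y)\<^sup>2 * ((v y)\<^sup>2 * f y)) \<partial>M) \<le> J"
      by (rule order_trans[OF nn_integral_mono bound[OF elim(3)]], rule pt)+
    then have "ennreal (v x) \<le> J" "ennreal (f x) \<le> J"
      using elim by (meson order_trans)+
    moreover have "J = ennreal (enn2real J)" using J by simp
    ultimately have "ennreal (v x) \<le> ennreal (enn2real J)" "ennreal (f x) \<le> ennreal (enn2real J)"
      by simp_all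
    then show ?case by (simp add: ennreal_le_iff)
  qed
  then show ?thesis by blast
qed

end

subsection \<open>A class of smooth functions closed under differentiation\<close>

text \<open>Since \<open>smooth\<close> quantifies over all iterated partial derivatives, smoothness
  of explicit functions is obtained from a class closed under \<open>partial\<close>. In
  \<open>comp\<close> the outer function comes with the whole sequence of its derivatives, so that
  differentiation merely shifts the sequence; D is a set containing the range of f on which these
  derivatives exist.\<close>

inductive smooth_expr :: "(real ^ 3 \<Rightarrow> real) \<Rightarrow> bool" where
  const: "smooth_expr (\<lambda>x. c)"
| coord: "smooth_expr (\<lambda>x. x $ i)"
| add: "smooth_expr f \<Longrightarrow> smooth_expr g \<Longrightarrow> smooth_expr (\<lambda>x. f x + g x)"
| mult: "smooth_expr f \<Longrightarrow> smooth_expr g \<Longrightarrow> smooth_expr (\<lambda>x. f x * g x)"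
| comp: "smooth_expr f \<Longrightarrow> (\<And>x. f x \<in> D) \<Longrightarrow>
    (\<And>n t. t \<in> D \<Longrightarrow> (H n has_real_derivative H (Suc n) t) (at t)) \<Longrightarrow> smooth_expr (\<lambda>x. H (0::nat) (f x))"

lemma partial_eqI: "(f has_derivative f') (at x) \<Longrightarrow> partial j f x = f' (axis j 1)"
  unfolding partial_def by (simp add: frechet_derivative_at[symmetric])

lemma has_derivative_partial:
  assumes "f differentiable (at x)"
  shows "(f has_derivative frechet_derivative f (at x)) (at x)"
  using assms by (simp add: frechet_derivative_works)

lemma smooth_expr_differentiable:
  assumes "smooth_expr f"
  shows "(\<forall>x. f differentiable (at x)) \<and> (\<forall>j. smooth_expr (partial j f))"
  using assms
proof induction
  case (const c)
  have "partial j (\<lambda>x. c) = (\<lambda>x. 0)" for j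
    by (intro ext partial_eqI[THEN trans]) (auto intro!: derivative_eq_intros)
  then show ?case using smooth_expr.const by auto
next
  case (coord i)
  have d: "((\<lambda>x. x $ i) has_derivative (\<lambda>h. h $ i)) (at x)" for x :: "real ^ 3"
    by (rule bounded_linear_imp_has_derivative) (rule bounded_linear_vec_nth)
  then have "partial j (\<lambda>x. x $ i) = (\<lambda>x. axis j 1 $ i)" for j
    by (intro ext partial_eqI)
  then show ?case using smooth_expr.const d by (auto simp: differentiable_def)
next
  case (add f g)
  have d: "((\<lambda>x. f x + g x) has_derivative
      (\<lambda>h. frechet_derivative f (at x) h + frechet_derivative g (at x) h)) (at x)" for x
    using add by (intro has_derivative_add has_derivative_partial) auto
  have "partial j (\<lambda>x. f x + g x) = (\<lambda>x. partial j f x + partial j g x)" for j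
    by (intro ext partial_eqI[OF d, THEN trans]) (simp add: partial_def)
  then show ?case using add d smooth_expr.add by (auto simp: differentiable_def)
next
  case (mult f g)
  have d: "((\<lambda>x. f x * g x) has_derivative
      (\<lambda>h. f x * frechet_derivative g (at x) h + frechet_derivative f (at x) h * g x)) (at x)" for x
    using mult by (intro has_derivative_mult has_derivative_partial) auto
  have "partial j (\<lambda>x. f x * g x) = (\<lambda>x. f x * partial j g x + partial j f x * g x)" for j
    by (intro ext partial_eqI[OF d, THEN trans]) (simp add: partial_def)
  then show ?case using mult d smooth_expr.add smooth_expr.mult by (auto simp: differentiable_def)
next
  case (comp f D H)
  have d: "((\<lambda>x. H 0 (f x)) has_derivative
      (\<lambda>h. frechet_derivative f (at x) h * H (Suc 0) (f x))) (at x)" for x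
    using comp by (intro DERIV_compose_FDERIV has_derivative_partial) auto
  have "partial j (\<lambda>x. H 0 (f x)) = (\<lambda>x. partial j f x * H (Suc 0) (f x))" for j
    by (intro ext partial_eqI[OF d, THEN trans]) (simp add: partial_def)
  moreover have "smooth_expr (\<lambda>x. H (Suc 0) (f x))"
    using comp smooth_expr.comp[of f D "\<lambda>n. H (Suc n)"] by auto
  moreover have "(\<lambda>x. H 0 (f x)) differentiable (at x)" for x
    using d unfolding differentiable_def by blast
  ultimately show ?case using comp smooth_expr.mult by auto
qed

lemma smooth_expr_smooth:
  assumes "smooth_expr f"
  shows "smooth f"
  unfolding smooth_def
proof
  fix js
  have "smooth_expr (foldr partial js f)"
    using assms smooth_expr_differentiable by (induction js) auto
  then show "foldr partial js f differentiable_on UNIV"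
    using smooth_expr_differentiable by (auto simp: differentiable_on_def)
qed

lemma test_functionI:
  assumes "smooth_expr f" "\<And>x. dist a x > R \<Longrightarrow> f x = 0"
  shows "test_function f"
  unfolding test_function_def
proof
  show "smooth f" using assms smooth_expr_smooth by blast
  have "{x. f x \<noteq> 0} \<subseteq> cball a R"
    using assms(2) by (force simp: not_le[symmetric])
  then show "compact (closure {x. f x \<noteq> 0})"
    using bounded_cball bounded_subset compact_closure by blast
qed

subsection \<open>A cutoff function\<close>

lemma poly_times_exp_tendsto_0: "((\<lambda>x. poly p x * exp (- x)) \<longlongrightarrow> 0) (at_top :: real filter)"
proof -
  have "((\<lambda>x. \<Sum>i\<le>degree p. coeff p i * (x ^ i / exp x)) \<longlongrightarrow> (\<Sum>i\<le>degree p. coeff p i * 0)) (at_top :: real filter)"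
    by (intro tendsto_intros tendsto_power_div_exp_0)
  then show ?thesis
    by (simp add: poly_altdef sum_distrib_right exp_minus divide_inverse mult.assoc)
qed

text \<open>The n-th derivative of exp(-1/t) for t > 0 is P(1/t) exp(-1/t) with such a polynomial P.
  In terms of s = 1/t, differentiation replaces P by s^2 (P - P').\<close>

primrec flat_poly :: "nat \<Rightarrow> real poly" where
  "flat_poly 0 = 1"
| "flat_poly (Suc n) = [:0, 0, 1:] * (flat_poly n - pderiv (flat_poly n))"

definition flat :: "nat \<Rightarrow> real \<Rightarrow> real" where
  "flat n t = (if 0 < t then poly (flat_poly n) (1 / t) * exp (- (1 / t)) else 0)"

lemma flat_deriv: "(flat n has_real_derivative flat (Suc n) t) (at t)"
proof -
  consider "t > 0" | "t < 0" | "t = 0" by linarith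
  then show ?thesis
  proof cases
    case 1
    have "((\<lambda>t. poly (flat_poly n) (1 / t) * exp (- (1 / t))) has_real_derivative flat (Suc n) t) (at t)"
      using 1 by (auto intro!: derivative_eq_intros DERIV_chain2[OF poly_DERIV]
          simp: flat_def power2_eq_square field_simps)
    moreover have "\<forall>\<^sub>F s in nhds t. flat n s = poly (flat_poly n) (1 / s) * exp (- (1 / s))"
      using eventually_nhds_in_open[of "{0<..}" t] 1 by (auto simp: flat_def elim!: eventually_mono)
    ultimately show ?thesis by (subst DERIV_cong_ev[OF refl _ refl])
  next
    case 2
    have "((\<lambda>t. 0) has_real_derivative flat (Suc n) t) (at t)" using 2 by (simp add: flat_def)
    moreover have "\<forall>\<^sub>F s in nhds t. flat n s = 0"
      using eventually_nhds_in_open[of "{..<0}" t] 2 by (auto simp: flat_def elim!: eventually_mono)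
    ultimately show ?thesis by (subst DERIV_cong_ev[OF refl _ refl])
  next
    case 3
    have "((\<lambda>y. flat n y / y) \<longlongrightarrow> 0) (at 0)"
      unfolding filterlim_split_at
    proof (rule filterlim_split_at)
      have "\<forall>\<^sub>F y in at_left 0. flat n y / y = 0"
        by (auto simp: eventually_at_left_field flat_def intro!: exI[of _ "-1"])
      then show "((\<lambda>y. flat n y / y) \<longlongrightarrow> 0) (at_left 0)" by (rule tendsto_eventually)
      have "filterlim (\<lambda>y::real. 1 / y) at_top (at_right 0)"
        using filterlim_inverse_at_top_right by (simp add: divide_inverse)
      \<comment> \<open>The difference quotient at 0 divides by y, which multiplies the polynomial
        by its variable 1/y.\<close>
      then have "((\<lambda>y. poly (pCons 0 (flat_poly n)) (1 / y) * exp (- (1 / y))) \<longlongrightarrow> 0) (at_right 0)"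
        by (rule filterlim_compose[OF poly_times_exp_tendsto_0])
      moreover have "\<forall>\<^sub>F y in at_right 0. poly (pCons 0 (flat_poly n)) (1 / y) * exp (- (1 / y)) = flat n y / y"
        by (auto simp: eventually_at_right_field flat_def intro!: exI[of _ 1])
      ultimately show "((\<lambda>y. flat n y / y) \<longlongrightarrow> 0) (at_right 0)"
        by (rule Lim_transform_eventually)
    qed
    then show ?thesis using 3 by (simp add: has_field_derivative_iff flat_def)
  qed
qed

text \<open>The n-th derivative of e exp(-1/(1 - t)), which vanishes for t \<ge> 1 and has value 1
  at t = 0 only, not on a neighbourhood. This suffices, since it is applied to |x - a|^2 / R^2 with
  R tending to infinity.\<close>

definition cutoff :: "nat \<Rightarrow> real \<Rightarrow> real" where
  "cutoff n t = exp 1 * (-1) ^ n * flat n (1 - t)"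

lemma cutoff_deriv: "(cutoff n has_real_derivative cutoff (Suc n) t) (at t)"
proof -
  have "((\<lambda>t. flat n (1 - t)) has_real_derivative flat (Suc n) (1 - t) * (- 1)) (at t)"
    by (rule DERIV_chain2[OF flat_deriv]) (auto intro!: derivative_eq_intros)
  from DERIV_cmult[OF this, of "exp 1 * (-1) ^ n"] show ?thesis
    unfolding cutoff_def by (simp add: algebra_simps)
qed

lemma cutoff_0: "cutoff 0 0 = 1"
  by (simp add: cutoff_def flat_def exp_minus)

lemma cutoff_eq_0: "t \<ge> 1 \<Longrightarrow> cutoff n t = 0"
  by (simp add: cutoff_def flat_def)

lemma cutoff_cont: "continuous_on S (cutoff n)"
  using cutoff_deriv DERIV_continuous_on by (metis has_field_derivative_at_within)

lemma cutoff_bounded: "\<exists>C>0. \<forall>t\<ge>0. \<bar>cutoff n t\<bar> \<le> C"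
proof -
  have "compact (cutoff n ` {0..1})"
    by (intro compact_continuous_image cutoff_cont) auto
  then obtain C where C: "C > 0" "\<forall>x\<in>cutoff n ` {0..1}. norm x \<le> C"
    using compact_imp_bounded bounded_pos by metis
  have "\<bar>cutoff n t\<bar> \<le> C" if "t \<ge> 0" for t
    using that C cutoff_eq_0[of t n] by (cases "t \<le> 1") auto
  then show ?thesis using C by blast
qed

subsection \<open>Radial functions\<close>

text \<open>Radial functions are expressed through the squared distance, which is smooth at the
  centre, unlike the distance.\<close>

definition sqdist :: "real ^ 3 \<Rightarrow> real ^ 3 \<Rightarrow> real" where
  "sqdist a x = (norm (x - a))\<^sup>2"

lemma sqdist_eq: "sqdist a x = (\<Sum>i\<in>UNIV. (x $ i - a $ i)\<^sup>2)"
  unfolding sqdist_def power2_norm_eq_inner by (simp add: inner_vec_def power2_eq_square)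

lemma sqdist_nonneg [simp]: "0 \<le> sqdist a x"
  by (simp add: sqdist_def)

lemma coord_le_sqdist: "\<bar>x $ i - a $ i\<bar> \<le> sqrt (sqdist a x)"
  using component_le_norm_cart[of "x - a" i] by (simp add: sqdist_def)

lemma smooth_expr_coord_diff: "smooth_expr (\<lambda>x. x $ i - a $ i)"
  using smooth_expr.add[OF smooth_expr.coord smooth_expr.const, of i "- a $ i"] by simp

lemma smooth_expr_sqdist: "smooth_expr (sqdist a)"
proof -
  have "sqdist a = (\<lambda>x. (x $ 1 - a $ 1) * (x $ 1 - a $ 1) + (x $ 2 - a $ 2) * (x $ 2 - a $ 2)
      + (x $ 3 - a $ 3) * (x $ 3 - a $ 3))"
    by (rule ext) (simp add: sqdist_eq sum_3 power2_eq_square)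
  then show ?thesis
    by (simp only:) (intro smooth_expr.add smooth_expr.mult smooth_expr_coord_diff)
qed

lemma has_derivative_sqdist: "(sqdist a has_derivative (\<lambda>h. 2 * inner (x - a) h)) (at x)"
  unfolding sqdist_def power2_norm_eq_inner
  by (auto intro!: derivative_eq_intros simp: inner_commute)

lemma has_derivative_radial:
  assumes "(\<Phi> has_real_derivative \<Phi>') (at (sqdist a x))"
  shows "((\<lambda>x. \<Phi> (sqdist a x)) has_derivative (\<lambda>h. 2 * inner (x - a) h * \<Phi>')) (at x)"
  by (rule DERIV_compose_FDERIV[OF assms has_derivative_sqdist])

lemma partial_radial:
  assumes "\<And>t. t \<ge> 0 \<Longrightarrow> (\<Phi> has_real_derivative \<Phi>' t) (at t)"
  shows "partial j (\<lambda>x. \<Phi> (sqdist a x)) = (\<lambda>x. (x $ j - a $ j) * (2 * \<Phi>' (sqdist a x)))"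
  by (intro ext partial_eqI[OF has_derivative_radial[OF assms], THEN trans])
     (auto simp: inner_axis)

lemma partial_coord_radial:
  assumes "\<And>t. t \<ge> 0 \<Longrightarrow> (\<Phi> has_real_derivative \<Phi>' t) (at t)"
  shows "partial j (\<lambda>x. (x $ k - a $ k) * \<Phi> (sqdist a x)) =
    (\<lambda>x. (if j = k then \<Phi> (sqdist a x) else 0) + 2 * ((x $ k - a $ k) * (x $ j - a $ j)) * \<Phi>' (sqdist a x))"
proof
  fix x
  have "((\<lambda>x. x $ k - a $ k) has_derivative (\<lambda>h. h $ k)) (at x)"
    using has_derivative_diff[OF bounded_linear_imp_has_derivative[OF bounded_linear_vec_nth] has_derivative_const]
    by auto
  note d = has_derivative_mult[OF this has_derivative_radial[where a = a, OF assms[OF sqdist_nonneg]]]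
  show "partial j (\<lambda>x. (x $ k - a $ k) * \<Phi> (sqdist a x)) x =
     (if j = k then \<Phi> (sqdist a x) else 0) + 2 * ((x $ k - a $ k) * (x $ j - a $ j)) * \<Phi>' (sqdist a x)"
  proof (rule partial_eqI[OF d, THEN trans])
    have "axis j (1 :: real) $ k = (if j = k then 1 else 0)" by (simp add: axis_def)
    then show "(x $ k - a $ k) * (2 * inner (x - a) (axis j 1) * \<Phi>' (sqdist a x)) + axis j 1 $ k * \<Phi> (sqdist a x)
      = (if j = k then \<Phi> (sqdist a x) else 0) + 2 * ((x $ k - a $ k) * (x $ j - a $ j)) * \<Phi>' (sqdist a x)"
      by (simp add: inner_axis)
  qed
qed

subsection \<open>Regularised Newtonian potentials\<close>

primrec newton_coeff :: "nat \<Rightarrow> real" where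
  "newton_coeff 0 = 1"
| "newton_coeff (Suc n) = newton_coeff n * (- 1 / 2 - n)"

text \<open>The derivatives of \<open>t \<mapsto> 1 / sqrt (t + e)\<close>, where \<open>t\<close> stands for the squared distance.\<close>

definition newton :: "real \<Rightarrow> nat \<Rightarrow> real \<Rightarrow> real" where
  "newton e n t = newton_coeff n * (t + e) powr (- 1 / 2 - n)"

lemma newton_deriv: "t > - e \<Longrightarrow> (newton e n has_real_derivative newton e (Suc n) t) (at t)"
  unfolding newton_def by (auto intro!: derivative_eq_intros simp: algebra_simps)

lemma smooth_expr_newton: "e > 0 \<Longrightarrow> smooth_expr (\<lambda>x. newton e m (sqdist a x))"
proof -
  assume "e > 0"
  then have "- e < sqdist a x" for x using sqdist_nonneg[of a x] by linarith
  then show ?thesis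
    using smooth_expr.comp[OF smooth_expr_sqdist, of a "{-e<..}" "\<lambda>n. newton e (m + n)"] newton_deriv
    by auto
qed

text \<open>With m the smaller of 1 and e, t + e \<ge> m (1 + t); passing from e to the fixed weight
  1 + t costs a constant depending on e. This is harmless, because R tends to infinity while e is
  fixed.\<close>

lemma newton_bound:
  assumes "e > 0"
  shows "\<exists>C>0. \<forall>t\<ge>0. \<bar>newton e n t\<bar> \<le> C * (1 + t) powr (- 1 / 2 - n)"
proof -
  define m where "m = min 1 e"
  have m: "m > 0" "m \<le> 1" "m \<le> e" using assms by (auto simp: m_def)
  define C where "C = \<bar>newton_coeff n\<bar> * m powr (- 1 / 2 - n) + 1"
  have "\<bar>newton e n t\<bar> \<le> C * (1 + t) powr (- 1 / 2 - n)" if t: "t \<ge> 0" for t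
  proof -
    have "m * t \<le> 1 * t" using m t by (intro mult_right_mono) auto
    then have "m * (1 + t) \<le> t + e" using m by (simp add: algebra_simps)
    then have "(t + e) powr (- 1 / 2 - n) \<le> (m * (1 + t)) powr (- 1 / 2 - n)"
      using m t by (intro powr_mono2') auto
    also have "\<dots> = m powr (- 1 / 2 - n) * (1 + t) powr (- 1 / 2 - n)"
      using m t by (simp add: powr_mult)
    finally have "\<bar>newton_coeff n\<bar> * (t + e) powr (- 1 / 2 - n)
        \<le> \<bar>newton_coeff n\<bar> * (m powr (- 1 / 2 - n) * (1 + t) powr (- 1 / 2 - n))"
      by (intro mult_left_mono) auto
    also have "\<dots> \<le> C * (1 + t) powr (- 1 / 2 - n)"
      by (simp add: C_def algebra_simps)
    finally show ?thesis by (simp add: newton_def abs_mult)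
  qed
  moreover have "C > 0" unfolding C_def by (intro add_nonneg_pos) auto
  ultimately show ?thesis by blast
qed

text \<open>The product of the i-th derivative of t \<mapsto> cutoff (t / R^2) and the j-th
  derivative of the regularised kernel. By the Leibniz rule the derivatives of the cut-off kernel
  are sums of such products.\<close>

definition cut_newton :: "real \<Rightarrow> nat \<Rightarrow> nat \<Rightarrow> real \<Rightarrow> real \<Rightarrow> real" where
  "cut_newton e i j R t = cutoff i (t / R\<^sup>2) / (R\<^sup>2) ^ i * newton e j t"

lemma cut_newton_deriv:
  assumes "R > 0" "t > - e"
  shows "(cut_newton e i j R has_real_derivative cut_newton e (Suc i) j R t + cut_newton e i (Suc j) R t) (at t)"
proof -
  have 1: "((\<lambda>t. cutoff i (t / R\<^sup>2)) has_real_derivative cutoff (Suc i) (t / R\<^sup>2) * (1 / R\<^sup>2)) (at t)"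
    by (rule DERIV_chain2[OF cutoff_deriv DERIV_cdivide[OF DERIV_ident]])
  have 2: "((\<lambda>t. cutoff i (t / R\<^sup>2) / (R\<^sup>2) ^ i) has_real_derivative cutoff (Suc i) (t / R\<^sup>2) / (R\<^sup>2) ^ Suc i) (at t)"
  proof -
    have e: "x * (1 / c) / c ^ i = x / c ^ Suc i" for x c :: real by simp
    show ?thesis using DERIV_cdivide[OF 1, of "(R\<^sup>2) ^ i"] by (simp only: e)
  qed
  from DERIV_mult[OF 2 newton_deriv[OF assms(2)]] show ?thesis
    unfolding cut_newton_def by (simp add: algebra_simps)
qed

lemma smooth_expr_cut_newton:
  assumes "e > 0"
  shows "smooth_expr (\<lambda>x. cut_newton e 0 j R (sqdist a x))"
proof -
  have "smooth_expr (\<lambda>x. sqdist a x * (1 / R\<^sup>2))"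
    by (intro smooth_expr.mult smooth_expr_sqdist smooth_expr.const)
  then have "smooth_expr (\<lambda>x. cutoff 0 (sqdist a x / R\<^sup>2))"
    using smooth_expr.comp[of "\<lambda>x. sqdist a x * (1 / R\<^sup>2)" UNIV cutoff] cutoff_deriv by simp
  then show ?thesis
    unfolding cut_newton_def using smooth_expr.mult smooth_expr_newton[OF assms] by simp
qed

lemma cut_newton_eq_0:
  assumes "R > 0" "dist a x > R"
  shows "cut_newton e i j R (sqdist a x) = 0"
proof -
  have "R\<^sup>2 \<le> sqdist a x"
    using assms unfolding sqdist_def by (intro power_mono) (auto simp: dist_norm norm_minus_commute)
  then show ?thesis using assms by (simp add: cut_newton_def cutoff_eq_0)
qed

text \<open>On the support t \<le> R^2, and R \<ge> 1 then gives R^2 \<ge> (1 + t) / 2. A derivative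
  falling on the cutoff thus gains the same power of 1 + t as one falling on the kernel, with a
  constant independent of R.\<close>

lemma cut_newton_bound:
  assumes "e > 0"
  shows "\<exists>C>0. \<forall>R\<ge>1. \<forall>t\<ge>0. \<bar>cut_newton e i j R t\<bar> \<le> C * (1 + t) powr (- 1 / 2 - real (i + j))"
proof -
  obtain C1 where C1: "C1 > 0" "\<And>t. t \<ge> 0 \<Longrightarrow> \<bar>cutoff i t\<bar> \<le> C1" using cutoff_bounded[of i] by blast
  obtain C2 where C2: "C2 > 0" "\<And>t. t \<ge> 0 \<Longrightarrow> \<bar>newton e j t\<bar> \<le> C2 * (1 + t) powr (- 1 / 2 - j)"
    using newton_bound[OF assms, of j] by blast
  define C where "C = C1 * 2 ^ i * C2"
  have C: "C > 0" using C1 C2 by (simp add: C_def)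
  have "\<bar>cut_newton e i j R t\<bar> \<le> C * (1 + t) powr (- 1 / 2 - real (i + j))" if R: "R \<ge> 1" and t: "t \<ge> 0" for R t
  proof (cases "t \<le> R\<^sup>2")
    case True
    have R2: "1 \<le> R\<^sup>2" using R by (simp add: one_le_power)
    then have h: "(1 + t) / 2 \<le> R\<^sup>2" using True by simp
    have "\<bar>cutoff i (t / R\<^sup>2)\<bar> / (R\<^sup>2) ^ i \<le> C1 / (R\<^sup>2) ^ i"
      using C1 t by (intro divide_right_mono) auto
    also have "\<dots> \<le> C1 / (((1 + t) / 2) ^ i)"
      using True R R2 h t C1 by (intro divide_left_mono power_mono mult_pos_pos zero_less_power) auto
    also have "\<dots> = C1 * 2 ^ i * (1 + t) powr (- real i)"
      using t by (simp add: power_divide powr_minus_divide powr_realpow)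
    finally have 1: "\<bar>cutoff i (t / R\<^sup>2)\<bar> / (R\<^sup>2) ^ i \<le> C1 * 2 ^ i * (1 + t) powr (- real i)" .
    have "\<bar>cut_newton e i j R t\<bar> = \<bar>cutoff i (t / R\<^sup>2)\<bar> / (R\<^sup>2) ^ i * \<bar>newton e j t\<bar>"
      by (simp add: cut_newton_def abs_mult)
    also have "\<dots> \<le> (C1 * 2 ^ i * (1 + t) powr (- real i)) * (C2 * (1 + t) powr (- 1 / 2 - j))"
      using C1 C2 t by (intro mult_mono 1) auto
    also have "\<dots> = C * ((1 + t) powr (- real i) * (1 + t) powr (- 1 / 2 - j))"
      by (simp add: C_def mult_ac)
    also have "(1 + t) powr (- real i) * (1 + t) powr (- 1 / 2 - j) = (1 + t) powr (- 1 / 2 - real (i + j))"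
    proof -
      have "- 1 / 2 - real (i + j) = - real i + (- 1 / 2 - real j)" by simp
      then show ?thesis by (simp only: powr_add)
    qed
    finally show ?thesis .
  next
    case False
    then have "1 \<le> t / R\<^sup>2" using R by (simp add: field_simps)
    then have "cutoff i (t / R\<^sup>2) = 0" by (rule cutoff_eq_0)
    then show ?thesis using C by (simp add: cut_newton_def)
  qed
  then show ?thesis using C by blast
qed

text \<open>Every derivative of the cutoff brings a factor R^(-2), so only the terms in which the
  cutoff is not differentiated survive.\<close>

lemma cut_newton_limit:
  "(\<lambda>n. cut_newton e i j (real (Suc n)) t) \<longlonglongrightarrow> (if i = 0 then newton e j t else 0)"
proof -
  have inv: "(\<lambda>n. 1 / (real (Suc n))\<^sup>2) \<longlonglongrightarrow> 0"
    using tendsto_power[OF LIMSEQ_inverse_real_of_nat, of 2] by (simp add: inverse_eq_divide power_one_over)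
  have "(\<lambda>n. t * (1 / (real (Suc n))\<^sup>2)) \<longlonglongrightarrow> t * 0" by (intro tendsto_intros inv)
  then have c: "(\<lambda>n. cutoff i (t / (real (Suc n))\<^sup>2)) \<longlonglongrightarrow> cutoff i 0"
    using isCont_tendsto_compose[OF DERIV_isCont[OF cutoff_deriv[of i 0]]] by simp
  have "(\<lambda>n. (1 / (real (Suc n))\<^sup>2) ^ i) \<longlonglongrightarrow> 0 ^ i" by (rule tendsto_power[OF inv])
  with c have "(\<lambda>n. cutoff i (t / (real (Suc n))\<^sup>2) * (1 / (real (Suc n))\<^sup>2) ^ i * newton e j t)
      \<longlonglongrightarrow> cutoff i 0 * 0 ^ i * newton e j t"
    by (rule tendsto_mult[OF tendsto_mult tendsto_const])
  then show ?thesis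
    by (cases i) (simp_all add: cut_newton_def cutoff_0 power_one_over)
qed

lemma sqdist_measurable [measurable]: "sqdist a \<in> borel_measurable borel"
  unfolding sqdist_def by measurable

lemma newton_measurable [measurable]: "newton e n \<in> borel_measurable borel"
  unfolding newton_def by measurable

lemma cutoff_measurable [measurable]: "cutoff n \<in> borel_measurable borel"
  by (intro borel_measurable_continuous_onI cutoff_cont)

lemma cut_newton_measurable [measurable]: "cut_newton e i j R \<in> borel_measurable borel"
  unfolding cut_newton_def by measurable

text \<open>Dominated convergence with a multiple of the weighted function as majorant; the passages
  R to infinity below rest on it.\<close>

lemma weighted_integral_limit:
  fixes f :: "real ^ 3 \<Rightarrow> 'b::euclidean_space"
  assumes [measurable]: "f \<in> borel_measurable lborel" "\<And>n. K n \<in> borel_measurable lborel" "L \<in> borel_measurable lborel"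
    and int: "integrable lborel (\<lambda>x. (1 + sqdist a x) powr s *\<^sub>R f x)"
    and bound: "\<And>n x. \<bar>K n x\<bar> \<le> C * (1 + sqdist a x) powr s"
    and lim: "\<And>x. (\<lambda>n. K n x) \<longlonglongrightarrow> L x"
  shows "integrable lborel (\<lambda>x. L x *\<^sub>R f x)" "\<And>n. integrable lborel (\<lambda>x. K n x *\<^sub>R f x)"
    "(\<lambda>n. \<integral>x. K n x *\<^sub>R f x \<partial>lborel) \<longlonglongrightarrow> (\<integral>x. L x *\<^sub>R f x \<partial>lborel)"
proof -
  let ?w = "\<lambda>x. C * norm ((1 + sqdist a x) powr s *\<^sub>R f x)"
  have w: "integrable lborel ?w" using int by (intro integrable_mult_right integrable_norm)
  have b: "AE x in lborel. norm (K n x *\<^sub>R f x) \<le> ?w x" for n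
  proof (rule AE_I2)
    fix x
    have "\<bar>K n x\<bar> * norm (f x) \<le> (C * (1 + sqdist a x) powr s) * norm (f x)"
      by (intro mult_right_mono bound) auto
    then show "norm (K n x *\<^sub>R f x) \<le> ?w x" by simp
  qed
  have l: "AE x in lborel. (\<lambda>n. K n x *\<^sub>R f x) \<longlonglongrightarrow> L x *\<^sub>R f x"
    by (intro AE_I2 tendsto_scaleR lim tendsto_const)
  show "integrable lborel (\<lambda>x. L x *\<^sub>R f x)"
    by (rule integrable_dominated_convergence[OF _ _ w l b]) measurable
  show "integrable lborel (\<lambda>x. K n x *\<^sub>R f x)" for n
    by (rule integrable_dominated_convergence2[OF _ _ w l b]) measurable
  show "(\<lambda>n. \<integral>x. K n x *\<^sub>R f x \<partial>lborel) \<longlonglongrightarrow> (\<integral>x. L x *\<^sub>R f x \<partial>lborel)"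
    by (rule integral_dominated_convergence[OF _ _ w l b]) measurable
qed

lemma coord_mult_le_sqdist: "\<bar>(x $ k - a $ k) * (x $ j - a $ j)\<bar> \<le> sqdist a x"
proof -
  have "\<bar>(x $ k - a $ k) * (x $ j - a $ j)\<bar> \<le> sqrt (sqdist a x) * sqrt (sqdist a x)"
    unfolding abs_mult by (intro mult_mono coord_le_sqdist) auto
  then show ?thesis by simp
qed

lemma powr_weight_mult:
  fixes t s :: real
  assumes "t \<ge> 0"
  shows "t * (1 + t) powr (s - 1) \<le> (1 + t) powr s"
proof -
  have "t * (1 + t) powr (s - 1) \<le> (1 + t) powr 1 * (1 + t) powr (s - 1)"
    using assms by (intro mult_right_mono) auto
  also have "\<dots> = (1 + t) powr (1 + (s - 1))" by (simp only: powr_add)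
  finally show ?thesis by simp
qed

text \<open>Entries of the Jacobian of a radial field \<open>x \<mapsto> \<Phi> (|x|\<^sup>2) x\<close> with \<open>P = \<Phi>\<close>, \<open>P' = \<Phi>'\<close>.\<close>

definition radial_jacobian :: "(real \<Rightarrow> real) \<Rightarrow> (real \<Rightarrow> real) \<Rightarrow> 3 \<Rightarrow> 3 \<Rightarrow> real ^ 3 \<Rightarrow> real ^ 3 \<Rightarrow> real" where
  "radial_jacobian P P' k j a x =
     (if j = k then P (sqdist a x) else 0) + 2 * ((x $ k - a $ k) * (x $ j - a $ j)) * P' (sqdist a x)"

text \<open>The product of two coordinates is at most the squared distance and so costs one power of
  the weight; this is why P' has to decay one power faster than P.\<close>

lemma radial_jacobian_limit:
  fixes f :: "real ^ 3 \<Rightarrow> 'b::euclidean_space"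
  assumes [measurable]: "f \<in> borel_measurable lborel" "\<And>n. P n \<in> borel_measurable borel" "\<And>n. P' n \<in> borel_measurable borel"
      "Q \<in> borel_measurable borel" "Q' \<in> borel_measurable borel"
    and int: "integrable lborel (\<lambda>x. (1 + sqdist a x) powr (- 3 / 2) *\<^sub>R f x)"
    and b: "\<And>n t. t \<ge> 0 \<Longrightarrow> \<bar>P n t\<bar> \<le> C * (1 + t) powr (- 3 / 2)"
    and b': "\<And>n t. t \<ge> 0 \<Longrightarrow> \<bar>P' n t\<bar> \<le> C' * (1 + t) powr (- 5 / 2)"
    and l: "\<And>t. (\<lambda>n. P n t) \<longlonglongrightarrow> Q t" "\<And>t. (\<lambda>n. P' n t) \<longlonglongrightarrow> Q' t"
    and C: "C \<ge> 0" "C' \<ge> 0"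
  shows "integrable lborel (\<lambda>x. radial_jacobian Q Q' k j a x *\<^sub>R f x)"
    "(\<lambda>n. \<integral>x. radial_jacobian (P n) (P' n) k j a x *\<^sub>R f x \<partial>lborel)
      \<longlonglongrightarrow> (\<integral>x. radial_jacobian Q Q' k j a x *\<^sub>R f x \<partial>lborel)"
proof -
  have bound: "\<bar>radial_jacobian (P n) (P' n) k j a x\<bar> \<le> (C + 2 * C') * (1 + sqdist a x) powr (- 3 / 2)" for n x
  proof -
    let ?q = "sqdist a x"
    have "\<bar>(if j = k then P n ?q else 0)\<bar> \<le> C * (1 + ?q) powr (- 3 / 2)"
      using b[of ?q n] C by auto
    moreover have "\<bar>2 * ((x $ k - a $ k) * (x $ j - a $ j)) * P' n ?q\<bar> \<le> 2 * C' * (1 + ?q) powr (- 3 / 2)"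
    proof -
      have "\<bar>(x $ k - a $ k) * (x $ j - a $ j)\<bar> * \<bar>P' n ?q\<bar> \<le> ?q * (C' * (1 + ?q) powr (- 5 / 2))"
        by (intro mult_mono coord_mult_le_sqdist b') auto
      also have "\<dots> = C' * (?q * (1 + ?q) powr (- 3 / 2 - 1))" by simp
      also have "\<dots> \<le> C' * (1 + ?q) powr (- 3 / 2)"
        by (intro mult_left_mono powr_weight_mult C) auto
      finally show ?thesis by (simp add: abs_mult)
    qed
    ultimately show ?thesis
      unfolding radial_jacobian_def by (intro order_trans[OF abs_triangle_ineq]) (simp add: algebra_simps)
  qed
  have lim: "(\<lambda>n. radial_jacobian (P n) (P' n) k j a x) \<longlonglongrightarrow> radial_jacobian Q Q' k j a x" for x
    unfolding radial_jacobian_def by (cases "j = k") (auto intro!: tendsto_intros l)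
  have [measurable]: "radial_jacobian (P n) (P' n) k j a \<in> borel_measurable lborel" for n
    unfolding radial_jacobian_def by measurable
  have [measurable]: "radial_jacobian Q Q' k j a \<in> borel_measurable lborel"
    unfolding radial_jacobian_def by measurable
  show "integrable lborel (\<lambda>x. radial_jacobian Q Q' k j a x *\<^sub>R f x)"
    by (rule weighted_integral_limit(1)[OF _ _ _ int bound lim]) measurable
  show "(\<lambda>n. \<integral>x. radial_jacobian (P n) (P' n) k j a x *\<^sub>R f x \<partial>lborel)
      \<longlonglongrightarrow> (\<integral>x. radial_jacobian Q Q' k j a x *\<^sub>R f x \<partial>lborel)"
    by (rule weighted_integral_limit(3)[OF _ _ _ int bound lim]) measurable
qed

text \<open>Minus the Laplacian of (|x|^2 + e)^(-1/2), with t for |x|^2: up to normalisation an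
  approximate identity at length sqrt e, known as the Plummer density.\<close>

definition poisson_kernel :: "real \<Rightarrow> real \<Rightarrow> real" where
  "poisson_kernel e t = 3 * e * (t + e) powr (- 5 / 2)"

text \<open>In dimension 3 the field \<Phi>(|x|^2) x has divergence 3 \<Phi> + 2 |x|^2 \<Phi>'. Here
  \<Phi> is twice the derivative of the kernel in t, so the field is the gradient of the kernel and
  its divergence the Laplacian.\<close>

lemma trace_newton_jacobian:
  assumes "e > 0"
  shows "(\<Sum>j\<in>UNIV. radial_jacobian (\<lambda>t. 2 * newton e 1 t) (\<lambda>t. 2 * newton e 2 t) j j a x)
    = - poisson_kernel e (sqdist a x)"
proof -
  let ?q = "sqdist a x"
  have qe: "?q + e > 0" using assms sqdist_nonneg[of a x] by linarith
  have "(\<Sum>j\<in>UNIV. radial_jacobian (\<lambda>t. 2 * newton e 1 t) (\<lambda>t. 2 * newton e 2 t) j j a x)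
      = 3 * (2 * newton e 1 ?q) + 4 * newton e 2 ?q * (\<Sum>j\<in>UNIV. (x $ j - a $ j)\<^sup>2)"
    by (simp add: radial_jacobian_def sum_3 power2_eq_square algebra_simps)
  also have "\<dots> = 6 * newton e 1 ?q + 4 * ?q * newton e 2 ?q" by (simp add: sqdist_eq[symmetric])
  also have "\<dots> = - 3 * (?q + e) powr (- 3 / 2) + 3 * ?q * (?q + e) powr (- 5 / 2)"
    by (simp add: newton_def numeral_2_eq_2)
  also have "(?q + e) powr (- 3 / 2) = (?q + e) * (?q + e) powr (- 5 / 2)"
  proof -
    have "(?q + e) powr (- 3 / 2) = (?q + e) powr (1 + - 5 / 2)" by simp
    also have "\<dots> = (?q + e) powr 1 * (?q + e) powr (- 5 / 2)" by (simp only: powr_add)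
    finally show ?thesis using qe by simp
  qed
  finally show ?thesis by (simp add: poisson_kernel_def algebra_simps)
qed

text \<open>Two families of test functions are treated together: for c = 1 the cut-off kernel is
  differentiated twice; for c = 0 the gradient of the kernel is cut off and then differentiated
  once. The limits agree, since terms with a differentiated cutoff disappear.\<close>

lemma cut_newton_jacobian_limit:
  fixes f :: "real ^ 3 \<Rightarrow> 'b::euclidean_space"
  assumes e: "e > 0" and [measurable]: "f \<in> borel_measurable lborel"
    and int: "integrable lborel (\<lambda>x. (1 + sqdist a x) powr (- 3 / 2) *\<^sub>R f x)"
    and c: "c = 0 \<or> c = (1 :: real)"
  defines "P R t \<equiv> 2 * (c * cut_newton e 1 0 R t + cut_newton e 0 1 R t)"
    and "P' R t \<equiv> 2 * (c * cut_newton e 2 0 R t + (1 + c) * cut_newton e 1 1 R t + cut_newton e 0 2 R t)"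
  shows "(\<lambda>n. \<integral>x. radial_jacobian (P (real (Suc n))) (P' (real (Suc n))) k j a x *\<^sub>R f x \<partial>lborel)
      \<longlonglongrightarrow> (\<integral>x. radial_jacobian (\<lambda>t. 2 * newton e 1 t) (\<lambda>t. 2 * newton e 2 t) k j a x *\<^sub>R f x \<partial>lborel)"
    and "integrable lborel (\<lambda>x. radial_jacobian (\<lambda>t. 2 * newton e 1 t) (\<lambda>t. 2 * newton e 2 t) k j a x *\<^sub>R f x)"
proof -
  have "\<exists>C>0. \<forall>R\<ge>1. \<forall>t\<ge>0. \<bar>cut_newton e i l R t\<bar> \<le> C * (1 + t) powr (- 1 / 2 - real (i + l))" for i l
    by (rule cut_newton_bound[OF e])
  then obtain C where C: "\<And>i l. C i l > 0"
    "\<And>i l R t. R \<ge> 1 \<Longrightarrow> t \<ge> 0 \<Longrightarrow> \<bar>cut_newton e i l R t\<bar> \<le> C i l * (1 + t) powr (- 1 / 2 - real (i + l))"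
    by metis
  define D where "D = 2 * (C 1 0 + C 0 1)"
  define D' where "D' = 2 * (C 2 0 + 2 * C 1 1 + C 0 2)"
  have D: "D \<ge> 0" "D' \<ge> 0"
    using C(1)[of 1 0] C(1)[of 0 1] C(1)[of 2 0] C(1)[of 1 1] C(1)[of 0 2] by (auto simp: D_def D'_def)
  have b: "\<bar>P R t\<bar> \<le> D * (1 + t) powr (- 3 / 2)" if "R \<ge> 1" "t \<ge> 0" for R t
    using C(2)[OF that, of 1 0] C(2)[OF that, of 0 1] c unfolding P_def D_def
    by (auto simp: algebra_simps abs_le_iff)
  have b': "\<bar>P' R t\<bar> \<le> D' * (1 + t) powr (- 5 / 2)" if "R \<ge> 1" "t \<ge> 0" for R t
  proof -
    have "0 \<le> C 2 0 * (1 + t) powr (- 5 / 2)" "0 \<le> C 1 1 * (1 + t) powr (- 5 / 2)"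
      using C(1)[of 2 0] C(1)[of 1 1] by auto
    moreover have "\<bar>cut_newton e 2 0 R t\<bar> \<le> C 2 0 * (1 + t) powr (- 5 / 2)"
      "\<bar>cut_newton e 1 1 R t\<bar> \<le> C 1 1 * (1 + t) powr (- 5 / 2)"
      "\<bar>cut_newton e 0 2 R t\<bar> \<le> C 0 2 * (1 + t) powr (- 5 / 2)"
      using C(2)[OF that, of 2 0] C(2)[OF that, of 1 1] C(2)[OF that, of 0 2] by simp_all
    ultimately show ?thesis
      using c unfolding P'_def D'_def by (auto simp: algebra_simps abs_le_iff)
  qed
  have lim: "(\<lambda>n. cut_newton e i l (real (Suc n)) t) \<longlonglongrightarrow> (if i = 0 then newton e l t else 0)" for i l t
    by (rule cut_newton_limit)
  have l: "(\<lambda>n. P (real (Suc n)) t) \<longlonglongrightarrow> 2 * newton e 1 t" for t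
  proof -
    have "(\<lambda>n. P (real (Suc n)) t) \<longlonglongrightarrow> 2 * (c * 0 + newton e 1 t)"
      unfolding P_def using lim[of 1 0 t] lim[of 0 1 t] by (intro tendsto_intros) auto
    then show ?thesis by simp
  qed
  have l': "(\<lambda>n. P' (real (Suc n)) t) \<longlonglongrightarrow> 2 * newton e 2 t" for t
  proof -
    have "(\<lambda>n. P' (real (Suc n)) t) \<longlonglongrightarrow> 2 * (c * 0 + (1 + c) * 0 + newton e 2 t)"
      unfolding P'_def using lim[of 2 0 t] lim[of 1 1 t] lim[of 0 2 t] by (intro tendsto_intros) auto
    then show ?thesis by simp
  qed
  have [measurable]: "P R \<in> borel_measurable borel" "P' R \<in> borel_measurable borel" for R
    unfolding P_def P'_def by measurable
  have R1: "real (Suc n) \<ge> 1" for n by simp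
  show "(\<lambda>n. \<integral>x. radial_jacobian (P (real (Suc n))) (P' (real (Suc n))) k j a x *\<^sub>R f x \<partial>lborel)
      \<longlonglongrightarrow> (\<integral>x. radial_jacobian (\<lambda>t. 2 * newton e 1 t) (\<lambda>t. 2 * newton e 2 t) k j a x *\<^sub>R f x \<partial>lborel)"
    by (rule radial_jacobian_limit(2)[OF _ _ _ _ _ int b[OF R1] b'[OF R1] l l' D]) measurable
  show "integrable lborel (\<lambda>x. radial_jacobian (\<lambda>t. 2 * newton e 1 t) (\<lambda>t. 2 * newton e 2 t) k j a x *\<^sub>R f x)"
    by (rule radial_jacobian_limit(1)[OF _ _ _ _ _ int b[OF R1] b'[OF R1] l l' D]) measurable
qed

lemma radial_jacobian_sym: "radial_jacobian P P' k j a x = radial_jacobian P P' j k a x"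
  by (simp add: radial_jacobian_def mult.commute)

text \<open>The test function is the regularised kernel centred at a, cut off at radius R. Its
  second derivatives are controlled by the weight of power -3/2 and the function itself by that of
  power -1/2, which match the two integrability hypotheses.\<close>

lemma laplace_identity:
  fixes u g :: "real ^ 3 \<Rightarrow> real"
  assumes e: "e > 0" and [measurable]: "u \<in> borel_measurable lborel" "g \<in> borel_measurable lborel"
    and int_u: "integrable lborel (\<lambda>x. (1 + sqdist a x) powr (- 3 / 2) *\<^sub>R u x)"
    and int_g: "integrable lborel (\<lambda>x. (1 + sqdist a x) powr (- 1 / 2) *\<^sub>R g x)"
    and eq: "\<And>\<phi>. test_function \<phi> \<Longrightarrow>
      - (\<Sum>j\<in>UNIV. \<integral>x. partial j (partial j \<phi>) x *\<^sub>R u x \<partial>lborel) = (\<integral>x. \<phi> x *\<^sub>R g x \<partial>lborel)"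
  shows "(\<integral>x. poisson_kernel e (sqdist a x) *\<^sub>R u x \<partial>lborel) = (\<integral>x. newton e 0 (sqdist a x) *\<^sub>R g x \<partial>lborel)"
proof -
  define P where "P R t = 2 * (1 * cut_newton e 1 0 R t + cut_newton e 0 1 R t)" for R t
  define P' where "P' R t = 2 * (1 * cut_newton e 2 0 R t + (1 + 1) * cut_newton e 1 1 R t + cut_newton e 0 2 R t)" for R t
  let ?J = "radial_jacobian (\<lambda>t. 2 * newton e 1 t) (\<lambda>t. 2 * newton e 2 t)"
  have eqR: "- (\<Sum>j\<in>UNIV. \<integral>x. radial_jacobian (P R) (P' R) j j a x *\<^sub>R u x \<partial>lborel)
      = (\<integral>x. cut_newton e 0 0 R (sqdist a x) *\<^sub>R g x \<partial>lborel)" if R: "R > 0" for R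
  proof -
    let ?\<phi> = "\<lambda>x. cut_newton e 0 0 R (sqdist a x)"
    have "test_function ?\<phi>"
      using R cut_newton_eq_0 by (intro test_functionI[where a = a and R = R] smooth_expr_cut_newton e) auto
    moreover have "partial j ?\<phi> = (\<lambda>x. (x $ j - a $ j) * P R (sqdist a x))" for j
      unfolding P_def using e R
      by (subst partial_radial[where \<Phi>' = "\<lambda>t. cut_newton e 1 0 R t + cut_newton e 0 1 R t"])
        (auto intro!: cut_newton_deriv[where i = 0 and j = 0, simplified])
    moreover have "partial j (\<lambda>x. (x $ j - a $ j) * P R (sqdist a x)) = radial_jacobian (P R) (P' R) j j a" for j
    proof -
      have "(P R has_real_derivative P' R t) (at t)" if "t \<ge> 0" for t
      proof -
        have "t > - e" using that e by simp
        from cut_newton_deriv[OF R this, of 1 0] cut_newton_deriv[OF R this, of 0 1]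
        show ?thesis unfolding P_def P'_def
          by (auto intro!: derivative_eq_intros simp: numeral_2_eq_2)
      qed
      from partial_coord_radial[OF this] show ?thesis
        by (intro ext) (simp add: radial_jacobian_def)
    qed
    ultimately show ?thesis using eq[of ?\<phi>] by simp
  qed
  have "(\<lambda>n. - (\<Sum>j\<in>UNIV. \<integral>x. radial_jacobian (P (real (Suc n))) (P' (real (Suc n))) j j a x *\<^sub>R u x \<partial>lborel))
      \<longlonglongrightarrow> - (\<Sum>j\<in>UNIV. \<integral>x. ?J j j a x *\<^sub>R u x \<partial>lborel)"
    unfolding P_def P'_def
    by (intro tendsto_intros cut_newton_jacobian_limit(1)[OF e _ int_u]) auto
  also have "(\<Sum>j\<in>UNIV. \<integral>x. ?J j j a x *\<^sub>R u x \<partial>lborel) = (\<integral>x. (\<Sum>j\<in>UNIV. ?J j j a x) *\<^sub>R u x \<partial>lborel)"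
    unfolding scaleR_sum_left
    by (intro Bochner_Integration.integral_sum[symmetric] cut_newton_jacobian_limit(2)[OF e _ int_u, of 0]) auto
  also have "\<dots> = - (\<integral>x. poisson_kernel e (sqdist a x) *\<^sub>R u x \<partial>lborel)"
    unfolding trace_newton_jacobian[OF e] by simp
  finally have 1: "(\<lambda>n. \<integral>x. cut_newton e 0 0 (real (Suc n)) (sqdist a x) *\<^sub>R g x \<partial>lborel)
      \<longlonglongrightarrow> (\<integral>x. poisson_kernel e (sqdist a x) *\<^sub>R u x \<partial>lborel)"
    by (simp only: eqR of_nat_0_less_iff zero_less_Suc minus_minus)
  obtain C where C: "\<And>R t. R \<ge> 1 \<Longrightarrow> t \<ge> 0 \<Longrightarrow> \<bar>cut_newton e 0 0 R t\<bar> \<le> C * (1 + t) powr (- 1 / 2 - real (0 + 0))"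
    using cut_newton_bound[OF e, of 0 0] by blast
  have 2: "(\<lambda>n. \<integral>x. cut_newton e 0 0 (real (Suc n)) (sqdist a x) *\<^sub>R g x \<partial>lborel)
      \<longlonglongrightarrow> (\<integral>x. newton e 0 (sqdist a x) *\<^sub>R g x \<partial>lborel)"
  proof (rule weighted_integral_limit(3)[OF _ _ _ int_g])
    show "\<bar>cut_newton e 0 0 (real (Suc n)) (sqdist a x)\<bar> \<le> C * (1 + sqdist a x) powr (- 1 / 2)" for n x
      using C[of "real (Suc n)" "sqdist a x"] by simp
    show "(\<lambda>n. cut_newton e 0 0 (real (Suc n)) (sqdist a x)) \<longlonglongrightarrow> newton e 0 (sqdist a x)" for x
      using cut_newton_limit[of e 0 0] by simp
  qed measurable
  show ?thesis by (rule LIMSEQ_unique[OF 1 2])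
qed

text \<open>The square of the Dirac operator in integrated form: L j is the matrix with index j, J
  multiplication by the imaginary unit. Testing with the cut-off k-th derivative of the kernel shows
  that the sum over j of L j (A k j) is J (H k), where A k j integrates a Hessian entry against
  \<psi>. Applying L k and summing over k, the symmetry of the Hessian and anticommutation leave its
  trace only.\<close>

lemma dirac_identity:
  fixes \<psi> h :: "real ^ 3 \<Rightarrow> 'b::euclidean_space" and L :: "3 \<Rightarrow> 'b \<Rightarrow> 'b" and J :: "'b \<Rightarrow> 'b"
  assumes e: "e > 0" and [measurable]: "\<psi> \<in> borel_measurable lborel" "h \<in> borel_measurable lborel"
    and int_\<psi>: "integrable lborel (\<lambda>x. (1 + sqdist a x) powr (- 3 / 2) *\<^sub>R \<psi> x)"
    and int_h: "integrable lborel (\<lambda>x. (1 + sqdist a x) powr (- 1) *\<^sub>R h x)"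
    and L: "\<And>j. bounded_linear (L j)" and J: "bounded_linear J"
    and anticomm: "\<And>j k v. L j (L k v) + L k (L j v) = (if j = k then 2 else 0) *\<^sub>R v"
    and eq: "\<And>\<phi>. test_function \<phi> \<Longrightarrow>
      (\<Sum>j\<in>UNIV. L j (\<integral>x. partial j \<phi> x *\<^sub>R \<psi> x \<partial>lborel)) = - J (\<integral>x. \<phi> x *\<^sub>R h x \<partial>lborel)"
  shows "(\<integral>x. poisson_kernel e (sqdist a x) *\<^sub>R \<psi> x \<partial>lborel)
    = (\<Sum>k\<in>UNIV. - L k (J (\<integral>x. ((x $ k - a $ k) * (sqdist a x + e) powr (- 3 / 2)) *\<^sub>R h x \<partial>lborel)))"
proof -
  define P where "P R t = 2 * (0 * cut_newton e 1 0 R t + cut_newton e 0 1 R t)" for R t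
  define P' where "P' R t = 2 * (0 * cut_newton e 2 0 R t + (1 + 0) * cut_newton e 1 1 R t + cut_newton e 0 2 R t)" for R t
  let ?J = "radial_jacobian (\<lambda>t. 2 * newton e 1 t) (\<lambda>t. 2 * newton e 2 t)"
  define A where "A k j = (\<integral>x. ?J k j a x *\<^sub>R \<psi> x \<partial>lborel)" for k j
  define H where "H k = (\<integral>x. ((x $ k - a $ k) * (sqdist a x + e) powr (- 3 / 2)) *\<^sub>R h x \<partial>lborel)" for k
  interpret L: bounded_linear "L j" for j by (rule L)
  interpret J: bounded_linear J by (rule J)
  have eqR: "(\<Sum>j\<in>UNIV. L j (\<integral>x. radial_jacobian (P R) (P' R) k j a x *\<^sub>R \<psi> x \<partial>lborel))
      = - J (\<integral>x. ((x $ k - a $ k) * P R (sqdist a x)) *\<^sub>R h x \<partial>lborel)" if R: "R > 0" for R k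
  proof -
    let ?\<phi> = "\<lambda>x. (x $ k - a $ k) * P R (sqdist a x)"
    have "smooth_expr ?\<phi>"
      unfolding P_def using smooth_expr_cut_newton[OF e, of 1 R a]
      by (auto intro!: smooth_expr.mult smooth_expr_coord_diff smooth_expr.const)
    then have "test_function ?\<phi>"
      by (rule test_functionI[where a = a and R = R]) (simp add: P_def cut_newton_eq_0 R)
    moreover have "partial j ?\<phi> = radial_jacobian (P R) (P' R) k j a" for j
    proof -
      have "(P R has_real_derivative P' R t) (at t)" if "t \<ge> 0" for t
      proof -
        have "t > - e" using that e by simp
        from cut_newton_deriv[OF R this, of 0 1]
        show ?thesis unfolding P_def P'_def
          by (auto intro!: derivative_eq_intros simp: numeral_2_eq_2)
      qed
      from partial_coord_radial[OF this] show ?thesis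
        by (intro ext) (simp add: radial_jacobian_def)
    qed
    ultimately show ?thesis using eq[of ?\<phi>] by simp
  qed
  have AH: "(\<Sum>j\<in>UNIV. L j (A k j)) = J (H k)" for k
  proof -
    have 1: "(\<lambda>n. \<Sum>j\<in>UNIV. L j (\<integral>x. radial_jacobian (P (real (Suc n))) (P' (real (Suc n))) k j a x *\<^sub>R \<psi> x \<partial>lborel))
      \<longlonglongrightarrow> (\<Sum>j\<in>UNIV. L j (A k j))"
      unfolding P_def P'_def A_def
      by (intro tendsto_sum L.tendsto cut_newton_jacobian_limit(1)[OF e _ int_\<psi>]) auto
    obtain C where C: "C > 0" "\<And>R t. R \<ge> 1 \<Longrightarrow> t \<ge> 0 \<Longrightarrow> \<bar>cut_newton e 0 1 R t\<bar> \<le> C * (1 + t) powr (- 1 / 2 - real (0 + 1))"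
      using cut_newton_bound[OF e, of 0 1] by blast
    have 2: "(\<lambda>n. \<integral>x. ((x $ k - a $ k) * P (real (Suc n)) (sqdist a x)) *\<^sub>R h x \<partial>lborel)
      \<longlonglongrightarrow> (\<integral>x. ((x $ k - a $ k) * (2 * newton e 1 (sqdist a x))) *\<^sub>R h x \<partial>lborel)"
    proof (rule weighted_integral_limit(3)[OF _ _ _ int_h])
      show "\<bar>(x $ k - a $ k) * P (real (Suc n)) (sqdist a x)\<bar> \<le> (2 * C) * (1 + sqdist a x) powr (- 1)" for n x
      proof -
        let ?q = "sqdist a x"
        \<comment> \<open>One coordinate costs half a power of the weight: 1/2 - 3/2 = -1, the power
          in \<open>int_h\<close>.\<close>
        have "\<bar>x $ k - a $ k\<bar> \<le> sqrt ?q" by (rule coord_le_sqdist)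
        also have "\<dots> \<le> (1 + ?q) powr (1 / 2)" by (simp add: powr_half_sqrt)
        finally have x: "\<bar>x $ k - a $ k\<bar> \<le> (1 + ?q) powr (1 / 2)" .
        have "\<bar>P (real (Suc n)) ?q\<bar> \<le> 2 * (C * (1 + ?q) powr (- 3 / 2))"
          using C(2)[of "real (Suc n)" ?q] by (simp add: P_def)
        then have "\<bar>(x $ k - a $ k) * P (real (Suc n)) ?q\<bar> \<le> (1 + ?q) powr (1 / 2) * (2 * (C * (1 + ?q) powr (- 3 / 2)))"
          unfolding abs_mult by (intro mult_mono x) auto
        also have "\<dots> = 2 * C * ((1 + ?q) powr (1 / 2) * (1 + ?q) powr (- 3 / 2))" by simp
        also have "(1 + ?q) powr (1 / 2) * (1 + ?q) powr (- 3 / 2) = (1 + ?q) powr (1 / 2 + - 3 / 2)"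
          by (simp only: powr_add)
        finally show ?thesis by simp
      qed
      show "(\<lambda>n. (x $ k - a $ k) * P (real (Suc n)) (sqdist a x)) \<longlonglongrightarrow> (x $ k - a $ k) * (2 * newton e 1 (sqdist a x))" for x
        using cut_newton_limit[of e 0 1] unfolding P_def by (auto intro!: tendsto_intros)
      show "(\<lambda>x. (x $ k - a $ k) * P (real (Suc n)) (sqdist a x)) \<in> borel_measurable lborel" for n
        unfolding P_def by measurable
    qed measurable
    \<comment> \<open>The first coefficient of the kernel's derivatives is -1/2; the sign it leaves
      cancels the one in \<open>eqR\<close>.\<close>
    have "((x $ k - a $ k) * (2 * newton e 1 (sqdist a x))) = - ((x $ k - a $ k) * (sqdist a x + e) powr (- 3 / 2))" for x
      by (simp add: newton_def)
    then have 3: "(\<integral>x. ((x $ k - a $ k) * (2 * newton e 1 (sqdist a x))) *\<^sub>R h x \<partial>lborel) = - H k"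
      by (simp add: H_def)
    have "(\<lambda>n. - J (\<integral>x. ((x $ k - a $ k) * P (real (Suc n)) (sqdist a x)) *\<^sub>R h x \<partial>lborel)) \<longlonglongrightarrow> - J (- H k)"
      unfolding 3[symmetric] by (intro tendsto_minus J.tendsto 2)
    then have "(\<lambda>n. \<Sum>j\<in>UNIV. L j (\<integral>x. radial_jacobian (P (real (Suc n))) (P' (real (Suc n))) k j a x *\<^sub>R \<psi> x \<partial>lborel))
      \<longlonglongrightarrow> J (H k)"
      by (simp add: eqR J.neg)
    then show ?thesis using 1 LIMSEQ_unique by blast
  qed
  have "(\<Sum>k\<in>UNIV. L k (J (H k))) = (\<Sum>k\<in>UNIV. \<Sum>j\<in>UNIV. L k (L j (A k j)))"
    by (simp add: AH[symmetric] L.sum)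
  \<comment> \<open>Renaming the indices and using the symmetry of A, the double sum equals the one
    with the two matrices in reverse order; the mean of the two consists of anticommutators.\<close>
  also have "\<dots> = (1 / 2) *\<^sub>R ((\<Sum>k\<in>UNIV. \<Sum>j\<in>UNIV. L k (L j (A k j))) + (\<Sum>k\<in>UNIV. \<Sum>j\<in>UNIV. L j (L k (A k j))))"
  proof -
    have "(\<Sum>k\<in>UNIV. \<Sum>j\<in>UNIV. L j (L k (A k j))) = (\<Sum>k\<in>UNIV. \<Sum>j\<in>UNIV. L k (L j (A k j)))"
      by (subst sum.swap) (simp add: A_def radial_jacobian_sym)
    then show ?thesis by (simp add: scaleR_2[symmetric])
  qed
  also have "\<dots> = (1 / 2) *\<^sub>R (\<Sum>k\<in>UNIV. \<Sum>j\<in>UNIV. (if k = j then 2 else 0) *\<^sub>R A k j)"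
    unfolding sum.distrib[symmetric] anticomm ..
  also have "\<dots> = (\<Sum>k\<in>UNIV. A k k)"
    by (simp add: if_distrib[of "\<lambda>c. c *\<^sub>R _"] scaleR_sum_right[symmetric] cong: if_cong)
  also have "\<dots> = (\<integral>x. (\<Sum>j\<in>UNIV. ?J j j a x) *\<^sub>R \<psi> x \<partial>lborel)"
    unfolding scaleR_sum_left A_def
    by (intro Bochner_Integration.integral_sum[symmetric] cut_newton_jacobian_limit(2)[OF e _ int_\<psi>, of 0]) auto
  also have "\<dots> = - (\<integral>x. poisson_kernel e (sqdist a x) *\<^sub>R \<psi> x \<partial>lborel)"
    unfolding trace_newton_jacobian[OF e] by simp
  finally show ?thesis unfolding H_def[symmetric] by (simp add: sum_negf)
qed

subsection \<open>The Newtonian kernel and its Kelvin transform\<close>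

abbreviation unit_vol :: real where
  "unit_vol \<equiv> measure lborel (ball (0 :: real ^ 3) 1)"

lemma emeasure_ball_3: "r \<ge> 0 \<Longrightarrow> emeasure lborel (ball (c :: real ^ 3) r) = ennreal (unit_vol * r ^ 3)"
  using content_ball_conv_unit_ball[of r c] emeasure_lborel_ball_finite[of c r]
  by (simp add: emeasure_eq_ennreal_measure less_top mult.commute)

text \<open>The superlevel set at height t is the ball of radius 1/t about x without its centre, by
  the convention 1/0 = 0.\<close>

interpretation newton: weak_kernel lborel "\<lambda>x y :: real ^ 3. 1 / norm (x - y)" unit_vol
proof
  show "(\<lambda>(x, y). 1 / norm (x - y :: real ^ 3)) \<in> borel_measurable (lborel \<Otimes>\<^sub>M lborel)"
    by measurable
  fix x :: "real ^ 3" and t :: real assume "t > 0"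
  have "{y \<in> space lborel. t < 1 / norm (x - y)} \<subseteq> ball x (1 / t)"
  proof
    fix y assume "y \<in> {y \<in> space lborel. t < 1 / norm (x - y)}"
    then have "t < 1 / norm (x - y)" by simp
    moreover from this have "norm (x - y) > 0" using \<open>t > 0\<close> by (cases "norm (x - y) = 0") auto
    ultimately show "y \<in> ball x (1 / t)" using \<open>t > 0\<close> by (simp add: dist_norm field_simps)
  qed
  then have "emeasure lborel {y \<in> space lborel. t < 1 / norm (x - y)} \<le> emeasure lborel (ball x (1 / t))"
    by (intro emeasure_mono) auto
  also have "\<dots> = ennreal (unit_vol / t ^ 3)" using \<open>t > 0\<close> by (simp add: emeasure_ball_3 power_one_over)
  finally show "emeasure lborel {y \<in> space lborel. t < 1 / norm (x - y)} \<le> ennreal (unit_vol / t ^ 3)" .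
qed (auto simp: norm_minus_commute)

text \<open>Lebesgue measure transported by the inversion \<open>x \<mapsto> x / |x|\<^sup>2\<close>.\<close>

definition kelvin_measure :: "(real ^ 3) measure" where
  "kelvin_measure = density lborel (\<lambda>y. ennreal (1 / norm y ^ 6))"

lemma sets_kelvin_measure [measurable_cong, simp]: "sets kelvin_measure = sets borel"
  by (simp add: kelvin_measure_def)

lemma space_kelvin_measure [simp]: "space kelvin_measure = UNIV"
  by (simp add: kelvin_measure_def)

text \<open>The density |y|^(-6) is the sixth power of the Newtonian kernel at 0, so this is an
  instance of the estimate for small kernel values. Under inversion the set is a punctured ball of
  radius 1/r.\<close>

lemma kelvin_tail:
  assumes "r > 0"
  shows "emeasure kelvin_measure {y. r < norm y} \<le> ennreal (weak_low_const unit_vol 6 / r ^ 3)"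
proof -
  have "emeasure kelvin_measure {y. r < norm y} = (\<integral>\<^sup>+(y :: real ^ 3). ennreal (1 / norm y ^ 6) * indicator {y. r < norm y} y \<partial>lborel)"
    unfolding kelvin_measure_def by (subst emeasure_density) auto
  also have "\<dots> \<le> (\<integral>\<^sup>+(y :: real ^ 3). ennreal (if 1 / norm (0 - y) \<le> 1 / r then (1 / norm (0 - y)) powr 6 else 0) \<partial>lborel)"
  proof (intro nn_integral_mono)
    fix y :: "real ^ 3"
    show "ennreal (1 / norm y ^ 6) * indicator {y. r < norm y} y
        \<le> ennreal (if 1 / norm (0 - y) \<le> 1 / r then (1 / norm (0 - y)) powr 6 else 0)"
      using assms by (auto simp: indicator_def power_one_over intro!: divide_left_mono)
  qed
  also have "\<dots> \<le> ennreal (weak_low_const unit_vol 6 * (1 / r) powr (6 - 3))"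
    using assms by (intro newton.k_low) auto
  also have "(1 / r) powr (6 - 3) = 1 / r ^ 3" using assms by (simp add: power_one_over)
  finally show ?thesis by simp
qed

text \<open>216 = 64 (3/2)^3: in the ball near x the density is at most 64 |x|^(-6) and the radius
  at most (3/2) |x|^2 / t. The factor 8 belongs to the tail beyond t/2.\<close>

definition kelvin_const :: real where
  "kelvin_const = 216 * unit_vol + 8 * weak_low_const unit_vol 6"

text \<open>The distance between x / |x|^2 and y / |y|^2 is |x - y| / (|x| |y|), so this is the
  Newtonian kernel in inverted coordinates. The weak bound is checked directly: the superlevel set
  is covered by a ball about x and a neighbourhood of infinity.\<close>

interpretation kelvin: weak_kernel kelvin_measure "\<lambda>x y :: real ^ 3. norm x * norm y / norm (x - y)" kelvin_const
proof (intro weak_kernel.intro weak_kernel_axioms.intro)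
  show "sigma_finite_measure kelvin_measure"
    unfolding kelvin_measure_def 
    by (subst sigma_finite_measure.sigma_finite_iff_density_finite[OF sigma_finite_lborel]) auto
  have [measurable_cong]: "sets (kelvin_measure \<Otimes>\<^sub>M kelvin_measure) = sets (borel \<Otimes>\<^sub>M borel)"
    by (intro sets_pair_measure_cong) auto
  show "(\<lambda>(x, y). norm x * norm y / norm (x - y :: real ^ 3)) \<in> borel_measurable (kelvin_measure \<Otimes>\<^sub>M kelvin_measure)"
    by measurable
  have w0: "weak_low_const unit_vol 6 \<ge> 0" by (intro weak_low_const_nonneg) auto
  then show "0 \<le> kelvin_const" by (simp add: kelvin_const_def)
  fix x :: "real ^ 3" and t :: real assume t: "t > 0"
  let ?S = "{y. t < norm x * norm y / norm (x - y)}"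
  \<comment> \<open>The first entry keeps |y| \<ge> |x| / 2 in the ball, which bounds the density.
    The second is what t |x - y| < |x| |y| yields there, because |y| \<le> (3/2) |x|.\<close>
  define R where "R = min (norm x / 2) (3 / 2 * (norm x)\<^sup>2 / t)"
  let ?B = "ball x R"
  let ?T = "{y. t / 2 < norm y}"
  have sub: "?S \<subseteq> ?B \<union> ?T"
  proof
    fix y assume "y \<in> ?S"
    then have y: "t < norm x * norm y / norm (x - y)" by simp
    then have d: "norm (x - y) > 0" using t by (cases "norm (x - y) = 0") auto
    then have y2: "t * norm (x - y) < norm x * norm y" using y by (simp add: field_simps)
    show "y \<in> ?B \<union> ?T"
    proof (cases "norm (x - y) < norm x / 2")
      case True
      have "norm y \<le> norm x + norm (x - y)" using norm_triangle_ineq4[of x "x - y"] by simp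
      then have "norm y \<le> 3 / 2 * norm x" using True by linarith
      then have "norm x * norm y \<le> norm x * (3 / 2 * norm x)" by (intro mult_left_mono) auto
      then have "t * norm (x - y) < 3 / 2 * (norm x)\<^sup>2" using y2 by (simp add: power2_eq_square)
      then have "norm (x - y) < 3 / 2 * (norm x)\<^sup>2 / t" using t by (simp add: field_simps)
      then show ?thesis using True by (simp add: R_def dist_norm)
    next
      case False
      then have "norm x * norm y \<le> (2 * norm (x - y)) * norm y" by (intro mult_right_mono) auto
      then have "t * norm (x - y) < 2 * norm y * norm (x - y)" using y2 by (simp add: mult_ac)
      then have "t < 2 * norm y" using d by simp
      then show ?thesis by simp
    qed
  qed
  have "emeasure kelvin_measure ?B \<le> ennreal (216 * unit_vol / t ^ 3)"
  proof (cases "x = 0")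
    case True
    then show ?thesis by (simp add: R_def)
  next
    case False
    then have x: "norm x > 0" by simp
    have R: "R \<ge> 0" "R \<le> 3 / 2 * (norm x)\<^sup>2 / t" using t by (auto simp: R_def)
    have "emeasure kelvin_measure ?B = (\<integral>\<^sup>+y. ennreal (1 / norm y ^ 6) * indicator ?B y \<partial>lborel)"
      unfolding kelvin_measure_def by (subst emeasure_density) auto
    also have "\<dots> \<le> (\<integral>\<^sup>+y. ennreal (64 / norm x ^ 6) * indicator ?B y \<partial>lborel)"
    proof (intro nn_integral_mono)
      fix y
      have "1 / norm y ^ 6 \<le> 64 / norm x ^ 6" if "y \<in> ?B"
      proof -
        have "norm x \<le> norm y + norm (x - y)" using norm_triangle_ineq[of y "x - y"] by simp
        then have "norm x / 2 \<le> norm y" using that by (simp add: R_def dist_norm)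
        moreover from this have "(norm x / 2) ^ 6 \<le> norm y ^ 6" by (intro power_mono) auto
        ultimately have "1 / norm y ^ 6 \<le> 1 / (norm x / 2) ^ 6"
          using x by (intro divide_left_mono mult_pos_pos zero_less_power) auto
        then show ?thesis by (simp add: power_divide)
      qed
      then show "ennreal (1 / norm y ^ 6) * indicator ?B y \<le> ennreal (64 / norm x ^ 6) * indicator ?B y"
        by (auto simp: indicator_def intro!: ennreal_leI)
    qed
    also have "\<dots> = ennreal (64 / norm x ^ 6) * ennreal (unit_vol * R ^ 3)"
      using R by (simp add: nn_integral_cmult_indicator emeasure_ball_3)
    also have "\<dots> = ennreal (64 / norm x ^ 6 * (unit_vol * R ^ 3))" using R by (intro ennreal_mult[symmetric]) auto
    also have "\<dots> \<le> ennreal (64 / norm x ^ 6 * (unit_vol * (3 / 2 * (norm x)\<^sup>2 / t) ^ 3))"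
      using R by (intro ennreal_leI mult_left_mono power_mono) auto
    also have "64 / norm x ^ 6 * (unit_vol * (3 / 2 * (norm x)\<^sup>2 / t) ^ 3) = 216 * unit_vol / t ^ 3"
      using x by (simp add: power_divide power_mult_distrib flip: power_mult)
    finally show ?thesis .
  qed
  moreover have "emeasure kelvin_measure ?T \<le> ennreal (8 * weak_low_const unit_vol 6 / t ^ 3)"
    using kelvin_tail[of "t / 2"] t by (simp add: power_divide mult.commute)
  moreover have "emeasure kelvin_measure ?S \<le> emeasure kelvin_measure ?B + emeasure kelvin_measure ?T"
    by (intro order_trans[OF emeasure_mono[OF sub]] emeasure_subadditive) auto
  ultimately have "emeasure kelvin_measure ?S \<le> ennreal (216 * unit_vol / t ^ 3) + ennreal (8 * weak_low_const unit_vol 6 / t ^ 3)"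
    by (meson add_mono order_trans)
  also have "\<dots> = ennreal (kelvin_const / t ^ 3)"
    using t w0 by (simp add: kelvin_const_def add_divide_distrib ennreal_plus[symmetric] del: ennreal_plus)
  finally show "emeasure kelvin_measure {y \<in> space kelvin_measure. t < norm x * norm y / norm (x - y)} \<le> ennreal (kelvin_const / t ^ 3)"
    by simp
qed (auto simp: norm_minus_commute mult.commute)

subsection \<open>Integrable weights\<close>

text \<open>In the unit ball about a the weight is at most 1. Outside it is at most |x - a|^(-2s), a
  power above 3 of the Newtonian kernel in the region where that kernel is at most 1.\<close>

lemma weight_finite:
  assumes "s > 3 / 2"
  shows "(\<integral>\<^sup>+x. ennreal ((1 + sqdist a x) powr - s) \<partial>lborel) < \<infinity>"
proof -
  have "(\<integral>\<^sup>+x. ennreal ((1 + sqdist a x) powr - s) \<partial>lborel)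
      \<le> (\<integral>\<^sup>+x. indicator (ball a 1) x + ennreal (if 1 / norm (a - x) \<le> 1 then (1 / norm (a - x)) powr (2 * s) else 0) \<partial>lborel)"
  proof (intro nn_integral_mono)
    fix x
    show "ennreal ((1 + sqdist a x) powr - s)
      \<le> indicator (ball a 1) x + ennreal (if 1 / norm (a - x) \<le> 1 then (1 / norm (a - x)) powr (2 * s) else 0)"
    proof (cases "norm (a - x) < 1")
      case True
      have "(1 + sqdist a x) powr - s \<le> (1 + sqdist a x) powr 0"
        using assms by (intro powr_mono) auto
      also have "\<dots> = 1"
      proof -
        have "1 + sqdist a x > 0" using sqdist_nonneg[of a x] by linarith
        then show ?thesis by simp
      qed
      finally have "ennreal ((1 + sqdist a x) powr - s) \<le> indicator (ball a 1) x"
        using True by (simp add: dist_norm)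
      then show ?thesis by (simp add: add_increasing2)
    next
      case False
      define d where "d = norm (a - x)"
      have d: "d \<ge> 1" using False by (simp add: d_def)
      have "(1 + sqdist a x) powr - s \<le> (d powr 2) powr - s"
        using d assms by (intro powr_mono2') (auto simp: sqdist_def d_def norm_minus_commute)
      also have "\<dots> = d powr - (2 * s)" by (subst powr_powr) simp
      also have "\<dots> = (1 / d) powr (2 * s)"
        using d by (simp add: powr_divide powr_minus_divide)
      finally have "ennreal ((1 + sqdist a x) powr - s) \<le> ennreal ((1 / d) powr (2 * s))" by (rule ennreal_leI)
      moreover have "1 / d \<le> 1" using d by simp
      ultimately show ?thesis by (simp add: d_def add_increasing)
    qed
  qed
  also have "\<dots> = emeasure lborel (ball a 1) + (\<integral>\<^sup>+x. ennreal (if 1 / norm (a - x) \<le> 1 then (1 / norm (a - x)) powr (2 * s) else 0) \<partial>lborel)"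
  proof -
    have [measurable]: "ball a 1 \<in> sets borel" by simp
    show ?thesis by (subst nn_integral_add) auto
  qed
  also have "\<dots> < \<infinity>"
    using newton.k_low[of a "2 * s" 1] assms emeasure_lborel_ball_finite[of a 1]
    by (auto simp: le_less_trans)
  finally show ?thesis .
qed

lemma integrable_boundI:
  fixes f :: "'a \<Rightarrow> 'b::{banach, second_countable_topology}"
  assumes [measurable]: "f \<in> borel_measurable M" "b \<in> borel_measurable M" "c \<in> borel_measurable M"
    and "\<And>x. norm (f x) \<le> b x + c x" "\<And>x. 0 \<le> b x" "\<And>x. 0 \<le> c x"
    and "(\<integral>\<^sup>+x. ennreal (b x) \<partial>M) < \<infinity>" "(\<integral>\<^sup>+x. ennreal (c x) \<partial>M) < \<infinity>"
  shows "integrable M f"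
proof (rule integrableI_bounded)
  have "(\<integral>\<^sup>+x. ennreal (norm (f x)) \<partial>M) \<le> (\<integral>\<^sup>+x. ennreal (b x) + ennreal (c x) \<partial>M)"
    using assms by (intro nn_integral_mono) (auto simp: ennreal_plus[symmetric] simp del: ennreal_plus intro: ennreal_leI)
  also have "\<dots> = (\<integral>\<^sup>+x. ennreal (b x) \<partial>M) + (\<integral>\<^sup>+x. ennreal (c x) \<partial>M)"
    by (rule nn_integral_add) auto
  also have "\<dots> < \<infinity>" using assms by simp
  finally show "(\<integral>\<^sup>+x. ennreal (norm (f x)) \<partial>M) < \<infinity>" .
qed fact

text \<open>Young's inequality with weights 5/6 and 1/6: the power 3/2 becomes (3/2)(6/5) = 9/5,
  still above the threshold 3/2.\<close>

lemma weight_L6: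
  fixes u :: "real ^ 3 \<Rightarrow> 'b::euclidean_space"
  assumes [measurable]: "u \<in> borel_measurable lborel" and "(\<integral>\<^sup>+x. ennreal (norm (u x) ^ 6) \<partial>lborel) < \<infinity>"
  shows "integrable lborel (\<lambda>x. (1 + sqdist a x) powr (- 3 / 2) *\<^sub>R u x)"
proof (rule integrable_boundI)
  fix x
  have "(1 + sqdist a x) powr (- 3 / 2) * norm (u x)
      = ((1 + sqdist a x) powr - (9 / 5)) powr (5 / 6) * (norm (u x) ^ 6) powr (1 / 6)"
    by (cases "u x = 0") (auto simp: powr_powr simp flip: powr_numeral)
  also have "\<dots> \<le> (1 + sqdist a x) powr - (9 / 5) + norm (u x) ^ 6"
    by (rule powr_mult_powr_le_add) auto
  finally show "norm ((1 + sqdist a x) powr (- 3 / 2) *\<^sub>R u x) \<le> (1 + sqdist a x) powr - (9 / 5) + norm (u x) ^ 6"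
    by simp
qed (use assms weight_finite[of "9 / 5" a] in auto)

text \<open>With weights 2/3 and 1/3 the power 3/2 becomes 9/4.\<close>

lemma weight_L3:
  fixes u :: "real ^ 3 \<Rightarrow> 'b::euclidean_space"
  assumes [measurable]: "u \<in> borel_measurable lborel" and "(\<integral>\<^sup>+x. ennreal (norm (u x) ^ 3) \<partial>lborel) < \<infinity>"
  shows "integrable lborel (\<lambda>x. (1 + sqdist a x) powr (- 3 / 2) *\<^sub>R u x)"
proof (rule integrable_boundI)
  fix x
  have "(1 + sqdist a x) powr (- 3 / 2) * norm (u x)
      = ((1 + sqdist a x) powr - (9 / 4)) powr (2 / 3) * (norm (u x) ^ 3) powr (1 / 3)"
    by (cases "u x = 0") (auto simp: powr_powr simp flip: powr_numeral)
  also have "\<dots> \<le> (1 + sqdist a x) powr - (9 / 4) + norm (u x) ^ 3"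
    by (rule powr_mult_powr_le_add) auto
  finally show "norm ((1 + sqdist a x) powr (- 3 / 2) *\<^sub>R u x) \<le> (1 + sqdist a x) powr - (9 / 4) + norm (u x) ^ 3"
    by simp
qed (use assms weight_finite[of "9 / 4" a] in auto)

text \<open>The weight of power -1/2 takes the place of the kernel in
  \<open>mult3_le_powers\<close>. It has no singularity, and its sixth power is integrable over the
  whole space.\<close>

lemma weight_products:
  fixes g :: "real ^ 3 \<Rightarrow> 'b::euclidean_space" and v f :: "real ^ 3 \<Rightarrow> real"
  assumes [measurable]: "g \<in> borel_measurable lborel" "v \<in> borel_measurable lborel" "f \<in> borel_measurable lborel"
    and v: "\<And>x. v x \<ge> 0" "(\<integral>\<^sup>+x. ennreal (v x ^ 6) \<partial>lborel) < \<infinity>"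
    and f: "\<And>x. f x \<ge> 0" "(\<integral>\<^sup>+x. ennreal (f x ^ 3) \<partial>lborel) < \<infinity>"
  shows "(\<And>x. norm (g x) \<le> (f x)\<^sup>2 * v x) \<Longrightarrow> integrable lborel (\<lambda>x. (1 + sqdist a x) powr (- 1 / 2) *\<^sub>R g x)"
    and "(\<And>x. norm (g x) \<le> (v x)\<^sup>2 * f x) \<Longrightarrow> integrable lborel (\<lambda>x. (1 + sqdist a x) powr (- 1) *\<^sub>R g x)"
proof -
  define k where "k x = (1 + sqdist a x) powr (- 1 / 2)" for x
  have k0: "k x \<ge> 0" for x by (simp add: k_def)
  have [simp]: "1 + sqdist a x > 0" for x using sqdist_nonneg[of a x] by linarith
  have k_pos: "k x > 0" for x using powr_gt_zero[of "1 + sqdist a x"] by (simp add: k_def less_imp_neq[symmetric])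
  have k6: "k x ^ 6 = (1 + sqdist a x) powr - 3" for x
  proof -
    have "k x ^ 6 = k x powr 6" using k_pos[of x] by simp
    then show ?thesis by (simp add: k_def powr_powr)
  qed
  have k2: "(k x)\<^sup>2 = (1 + sqdist a x) powr - 1" for x
  proof -
    have "(k x)\<^sup>2 = k x powr 2" using k_pos[of x] by simp
    then show ?thesis by (simp add: k_def powr_powr)
  qed
  have [measurable]: "k \<in> borel_measurable lborel" unfolding k_def by measurable
  have c: "(\<integral>\<^sup>+x. ennreal (f x ^ 3 + v x ^ 6) \<partial>lborel) < \<infinity>"
  proof -
    have "(\<integral>\<^sup>+x. ennreal (f x ^ 3 + v x ^ 6) \<partial>lborel) = (\<integral>\<^sup>+x. ennreal (f x ^ 3) + ennreal (v x ^ 6) \<partial>lborel)"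
      using f v by (intro nn_integral_cong) simp
    also have "\<dots> < \<infinity>" using f v by (simp add: nn_integral_add)
    finally show ?thesis .
  qed
  have kk: "(\<integral>\<^sup>+x. ennreal (k x ^ 6) \<partial>lborel) < \<infinity>" unfolding k6 by (rule weight_finite) simp
  show "integrable lborel (\<lambda>x. (1 + sqdist a x) powr (- 1 / 2) *\<^sub>R g x)" if g: "\<And>x. norm (g x) \<le> (f x)\<^sup>2 * v x"
    unfolding k_def[symmetric]
  proof (rule integrable_boundI[OF _ _ _ _ _ _ kk c])
    fix x
    have "norm (k x *\<^sub>R g x) \<le> k x * ((f x)\<^sup>2 * v x)" using g[of x] k0[of x] by (simp add: mult_left_mono)
    also have "\<dots> \<le> k x ^ 6 + (f x ^ 3 + v x ^ 6)"
      using mult3_le_powers(1)[OF k0 v(1) f(1), of x x x] by simp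
    finally show "norm (k x *\<^sub>R g x) \<le> k x ^ 6 + (f x ^ 3 + v x ^ 6)" .
  qed (use k0 v f in auto)
  show "integrable lborel (\<lambda>x. (1 + sqdist a x) powr (- 1) *\<^sub>R g x)" if g: "\<And>x. norm (g x) \<le> (v x)\<^sup>2 * f x"
    unfolding k2[symmetric]
  proof (rule integrable_boundI[OF _ _ _ _ _ _ kk c])
    fix x
    have "norm ((k x)\<^sup>2 *\<^sub>R g x) \<le> (k x)\<^sup>2 * ((v x)\<^sup>2 * f x)" using g[of x] k0[of x] by (simp add: mult_left_mono)
    also have "\<dots> \<le> k x ^ 6 + (f x ^ 3 + v x ^ 6)"
      using mult3_le_powers(2)[OF k0 v(1) f(1), of x x x] by simp
    finally show "norm ((k x)\<^sup>2 *\<^sub>R g x) \<le> k x ^ 6 + (f x ^ 3 + v x ^ 6)" .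
  qed (use k0 v f in auto)
qed

subsection \<open>Integrating over boxes\<close>

lemma sqdist_measurable_comp [measurable (raw)]:
  assumes [measurable]: "f \<in> borel_measurable M" "g \<in> borel_measurable M"
  shows "(\<lambda>z. sqdist (f z) (g z)) \<in> borel_measurable M"
  unfolding sqdist_def by measurable

text \<open>Lebesgue differentiation with cubes that have the point as a corner: the difference D
  has integral 0 over every box, so all its averages vanish, and they converge to D off a negligible
  set.\<close>

lemma AE_eq_from_boxes:
  fixes F G :: "real ^ 3 \<Rightarrow> 'b::euclidean_space"
  assumes [measurable]: "F \<in> borel_measurable lborel" "G \<in> borel_measurable lborel"
    and F: "\<And>l r. integrable lborel (\<lambda>x. indicator (cbox l r) x *\<^sub>R F x)"
    and G: "\<And>l r. integrable lborel (\<lambda>x. indicator (cbox l r) x *\<^sub>R G x)"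
    and eq: "\<And>l r. (\<integral>x. indicator (cbox l r) x *\<^sub>R F x \<partial>lborel) = (\<integral>x. indicator (cbox l r) x *\<^sub>R G x \<partial>lborel)"
  shows "AE x in lborel. F x = G x"
proof -
  define D where "D x = F x - G x" for x
  have [measurable]: "D \<in> borel_measurable lborel" unfolding D_def by measurable
  have "((\<lambda>x. indicator (cbox l r) x *\<^sub>R D x) has_integral 0) UNIV" for l r
  proof -
    have "integrable lborel (\<lambda>x. indicator (cbox l r) x *\<^sub>R D x)"
      using Bochner_Integration.integrable_diff[OF F G, of l r l r] by (simp add: D_def scaleR_diff_right)
    moreover have "(\<integral>x. indicator (cbox l r) x *\<^sub>R D x \<partial>lborel) = 0"
      using Bochner_Integration.integral_diff[OF F G, of l r l r] eq[of l r] by (simp add: D_def scaleR_diff_right)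
    ultimately show ?thesis using has_integral_integral_lborel by metis
  qed
  moreover have "(\<lambda>x. indicator (cbox l r) x *\<^sub>R D x) = (\<lambda>x. if x \<in> cbox l r then D x else 0)" for l r
    by (auto simp: indicator_def)
  ultimately have D0: "(D has_integral 0) (cbox l r)" for l r
    using has_integral_restrict_UNIV[of "cbox l r" D 0] by metis
  obtain N where N: "negligible N" "\<And>x e. \<lbrakk>x \<notin> N; 0 < e\<rbrakk> \<Longrightarrow>
       \<exists>d>0. \<forall>h. 0 < h \<and> h < d \<longrightarrow> norm (integral (cbox x (x + h *\<^sub>R One)) D /\<^sub>R h ^ DIM(real ^ 3) - D x) < e"
    using integrable_ccontinuous_explicit[of D] D0 by blast
  have "D x = 0" if x: "x \<notin> N" for x
  proof (rule ccontr)
    assume "D x \<noteq> 0"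
    then obtain d where "d > 0" "\<forall>h. 0 < h \<and> h < d \<longrightarrow> norm (integral (cbox x (x + h *\<^sub>R One)) D /\<^sub>R h ^ DIM(real ^ 3) - D x) < norm (D x)"
      using N(2)[OF x, of "norm (D x)"] by auto
    then have "norm (integral (cbox x (x + (d / 2) *\<^sub>R One)) D /\<^sub>R (d / 2) ^ DIM(real ^ 3) - D x) < norm (D x)"
      by auto
    then show False using D0[THEN integral_unique] by simp
  qed
  then have "{x. F x \<noteq> G x} \<subseteq> N" by (auto simp: D_def)
  then have "negligible {x. F x \<noteq> G x}" using N(1) negligible_subset by blast
  then have "{x. F x \<noteq> G x} \<in> null_sets lebesgue" by (simp add: negligible_iff_null_sets)
  then have "emeasure lebesgue {x. F x \<noteq> G x} = 0" by auto
  moreover have "{x. F x \<noteq> G x} \<in> sets lborel" by measurable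
  ultimately have "{x. F x \<noteq> G x} \<in> null_sets lborel" by (auto simp: null_sets_def)
  then show ?thesis by (rule AE_I') auto
qed

section \<open>Mollification at scale 1/(n + 1), integrated over boxes\<close>

lemma lborel_integral_scale:
  fixes f :: "real ^ 3 \<Rightarrow> real"
  assumes [measurable]: "f \<in> borel_measurable borel" and "c > 0" and "\<And>x. f x \<ge> 0"
  shows "(\<integral>\<^sup>+x. ennreal (f x) \<partial>lborel) = ennreal (c ^ 3) * (\<integral>\<^sup>+x. ennreal (f (t + c *\<^sub>R x)) \<partial>lborel)"
proof -
  have "(\<integral>\<^sup>+x. ennreal (f x) \<partial>lborel) = (\<integral>\<^sup>+x. ennreal (f x) \<partial>density (distr lborel borel (\<lambda>x. t + c *\<^sub>R x)) (\<lambda>_. \<bar>c\<bar> ^ DIM(real ^ 3)))"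
    using assms(2) lborel_affine[of c t] by simp
  also have "\<dots> = (\<integral>\<^sup>+x. ennreal (\<bar>c\<bar> ^ DIM(real ^ 3)) * ennreal (f (t + c *\<^sub>R x)) \<partial>lborel)"
    by (subst nn_integral_density) (simp_all add: nn_integral_distr)
  also have "\<dots> = ennreal (c ^ 3) * (\<integral>\<^sup>+x. ennreal (f (t + c *\<^sub>R x)) \<partial>lborel)"
    using assms(2) by (simp add: nn_integral_cmult)
  finally show ?thesis .
qed

text \<open>A square, so that the length sqrt e is 1/(n + 1) and rescaling space by this factor
  reduces the kernel to e = 1.\<close>

definition reg_eps :: "nat \<Rightarrow> real" where
  "reg_eps n = (1 / real (Suc n))\<^sup>2"

lemma reg_eps_pos [simp]: "reg_eps n > 0" by (simp add: reg_eps_def)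

lemma reg_eps_tendsto: "reg_eps \<longlonglongrightarrow> 0"
proof -
  have "(\<lambda>n. (1 / real (Suc n))\<^sup>2) \<longlonglongrightarrow> 0\<^sup>2"
    by (intro tendsto_power) (use LIMSEQ_inverse_real_of_nat in \<open>simp add: inverse_eq_divide\<close>)
  then show ?thesis by (simp add: reg_eps_def[abs_def])
qed

text \<open>The value is 4 pi, but it is kept as a symbol; its positivity allows division by
  it.\<close>

definition poisson_mass :: real where
  "poisson_mass = (\<integral>b. poisson_kernel 1 (sqdist 0 b) \<partial>lborel)"

lemma poisson_measurable [measurable]: "poisson_kernel e \<in> borel_measurable borel"
  unfolding poisson_kernel_def by measurable

lemma poisson_nonneg: "e \<ge> 0 \<Longrightarrow> poisson_kernel e t \<ge> 0"
  by (simp add: poisson_kernel_def)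

lemma poisson_1_integrable: "integrable lborel (\<lambda>b. poisson_kernel 1 (sqdist 0 b))"
proof (rule integrableI_bounded)
  have "(\<integral>\<^sup>+x. ennreal (norm (poisson_kernel 1 (sqdist 0 x))) \<partial>lborel)
      = (\<integral>\<^sup>+x. ennreal 3 * ennreal ((1 + sqdist 0 x) powr - (5 / 2)) \<partial>lborel)"
    by (intro nn_integral_cong, subst ennreal_mult[symmetric]) (auto simp: poisson_kernel_def add.commute)
  also have "\<dots> < \<infinity>"
    using weight_finite[of "5 / 2" 0] by (simp add: nn_integral_cmult ennreal_mult_less_top)
  finally show "(\<integral>\<^sup>+x. ennreal (norm (poisson_kernel 1 (sqdist 0 x))) \<partial>lborel) < \<infinity>" .
qed simp

lemma poisson_mass_pos: "poisson_mass > 0"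
proof -
  have pos: "poisson_kernel 1 (sqdist 0 b) > 0" for b
  proof -
    have "sqdist 0 b + 1 > 0" using sqdist_nonneg[of 0 b] by linarith
    then show ?thesis by (simp add: poisson_kernel_def)
  qed
  have "poisson_mass \<noteq> 0"
  proof
    assume "poisson_mass = 0"
    then have "AE b in lborel. poisson_kernel 1 (sqdist 0 b) = 0"
      unfolding poisson_mass_def
      using integral_nonneg_eq_0_iff_AE[OF poisson_1_integrable] by (simp add: poisson_nonneg)
    then have "AE b in (lborel :: (real ^ 3) measure). False"
      by (rule eventually_mono) (metis pos less_irrefl)
    then have "ae_filter (lborel :: (real ^ 3) measure) = bot" by (simp add: trivial_limit_def[symmetric] eventually_False)
    then show False by (simp add: ae_filter_eq_bot_iff)
  qed
  moreover have "poisson_mass \<ge> 0"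
    unfolding poisson_mass_def by (intro integral_nonneg_AE) (simp add: poisson_nonneg)
  ultimately show ?thesis by simp
qed

lemma sqdist_commute: "sqdist a x = sqdist x a"
  by (simp add: sqdist_def norm_minus_commute)

lemma poisson_scale:
  assumes "c > 0"
  shows "c ^ 3 * poisson_kernel (c\<^sup>2) (sqdist y (y + c *\<^sub>R b)) = poisson_kernel 1 (sqdist 0 b)"
proof -
  have q: "sqdist 0 b + 1 > 0" using sqdist_nonneg[of 0 b] by linarith
  have "sqdist y (y + c *\<^sub>R b) + c\<^sup>2 = c\<^sup>2 * (sqdist 0 b + 1)"
    by (simp add: sqdist_def power_mult_distrib algebra_simps)
  then have "(sqdist y (y + c *\<^sub>R b) + c\<^sup>2) powr (- 5 / 2) = (c\<^sup>2) powr (- 5 / 2) * (sqdist 0 b + 1) powr (- 5 / 2)"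
    using q by (simp add: powr_mult)
  also have "(c\<^sup>2) powr (- 5 / 2) = 1 / c ^ 5"
  proof -
    have "(c\<^sup>2) powr (- 5 / 2) = (c powr 2) powr (- 5 / 2)" using assms by simp
    also have "\<dots> = c powr - 5" by (subst powr_powr) simp
    finally show ?thesis using assms by (simp add: powr_minus_divide)
  qed
  finally show ?thesis
    using assms by (simp add: poisson_kernel_def field_simps eval_nat_numeral)
qed

text \<open>The indicator of Q mollified by the unnormalised approximate identity. It is
  ennreal-valued so that Fubini's theorem applies before anything is known to be finite.\<close>

definition box_poisson :: "(real ^ 3) set \<Rightarrow> nat \<Rightarrow> real ^ 3 \<Rightarrow> ennreal" where
  "box_poisson Q n y = (\<integral>\<^sup>+a. ennreal (indicator Q a * poisson_kernel (reg_eps n) (sqdist a y)) \<partial>lborel)"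

lemma box_poisson_eq:
  assumes [measurable]: "Q \<in> sets borel"
  shows "box_poisson Q n y
    = (\<integral>\<^sup>+b. ennreal (indicator Q (y + (1 / real (Suc n)) *\<^sub>R b) * poisson_kernel 1 (sqdist 0 b)) \<partial>lborel)"
proof -
  let ?c = "1 / real (Suc n)"
  have "box_poisson Q n y = ennreal (?c ^ 3) * (\<integral>\<^sup>+b. ennreal (indicator Q (y + ?c *\<^sub>R b)
      * poisson_kernel (reg_eps n) (sqdist (y + ?c *\<^sub>R b) y)) \<partial>lborel)"
    unfolding box_poisson_def
    by (rule lborel_integral_scale) (auto intro!: mult_nonneg_nonneg poisson_nonneg simp: less_imp_le)
  also have "\<dots> = (\<integral>\<^sup>+b. ennreal (?c ^ 3) * ennreal (indicator Q (y + ?c *\<^sub>R b)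
      * poisson_kernel (reg_eps n) (sqdist (y + ?c *\<^sub>R b) y)) \<partial>lborel)"
    by (rule nn_integral_cmult[symmetric]) measurable
  also have "\<dots> = (\<integral>\<^sup>+b. ennreal (indicator Q (y + ?c *\<^sub>R b) * poisson_kernel 1 (sqdist 0 b)) \<partial>lborel)"
  proof (intro nn_integral_cong)
    fix b
    have "?c ^ 3 * poisson_kernel (reg_eps n) (sqdist (y + ?c *\<^sub>R b) y) = poisson_kernel 1 (sqdist 0 b)"
      using poisson_scale[of ?c y b] by (simp add: reg_eps_def sqdist_commute)
    then show "ennreal (?c ^ 3) * ennreal (indicator Q (y + ?c *\<^sub>R b) * poisson_kernel (reg_eps n) (sqdist (y + ?c *\<^sub>R b) y))
        = ennreal (indicator Q (y + ?c *\<^sub>R b) * poisson_kernel 1 (sqdist 0 b))"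
      by (subst ennreal_mult[symmetric])
        (auto simp: indicator_def less_imp_le intro!: poisson_nonneg simp del: power_divide)
  qed
  finally show ?thesis .
qed

lemma box_poisson_le_mass:
  assumes "Q \<in> sets borel"
  shows "box_poisson Q n y \<le> ennreal poisson_mass"
proof -
  have "box_poisson Q n y \<le> (\<integral>\<^sup>+b. ennreal (poisson_kernel 1 (sqdist 0 b)) \<partial>lborel)"
    unfolding box_poisson_eq[OF assms]
    by (intro nn_integral_mono ennreal_leI) (auto simp: indicator_def poisson_nonneg)
  also have "\<dots> = ennreal poisson_mass"
    unfolding poisson_mass_def
    by (rule nn_integral_eq_integral[OF poisson_1_integrable]) (simp add: poisson_nonneg)
  finally show ?thesis .
qed

text \<open>After rescaling, y + b/(n + 1) is for each fixed b eventually on the same side of the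
  boundary of the box as y. Points of the boundary are excluded; they form a null set.\<close>

lemma box_poisson_tendsto:
  assumes "y \<notin> cbox l r - box l r"
  shows "(\<lambda>n. enn2real (box_poisson (cbox l r) n y)) \<longlonglongrightarrow> poisson_mass * indicator (cbox l r) y"
proof -
  let ?Q = "cbox l r"
  have eq: "enn2real (box_poisson ?Q n y)
      = (\<integral>b. indicator ?Q (y + (1 / real (Suc n)) *\<^sub>R b) * poisson_kernel 1 (sqdist 0 b) \<partial>lborel)" for n
    by (subst box_poisson_eq, simp, subst integral_eq_nn_integral) (auto simp: indicator_def poisson_nonneg)
  have ind: "(\<lambda>n. indicator ?Q (y + (1 / real (Suc n)) *\<^sub>R b) :: real) \<longlonglongrightarrow> indicator ?Q y" for b
  proof -
    have "(\<lambda>n. y + (1 / real (Suc n)) *\<^sub>R b) \<longlonglongrightarrow> y + 0 *\<^sub>R b"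
      using LIMSEQ_inverse_real_of_nat by (intro tendsto_intros) (simp add: inverse_eq_divide)
    then have lim: "(\<lambda>n. y + (1 / real (Suc n)) *\<^sub>R b) \<longlonglongrightarrow> y" by simp
    consider "y \<in> box l r" | "y \<in> - cbox l r" using assms by auto
    then have "\<forall>\<^sub>F n in sequentially. indicator ?Q (y + (1 / real (Suc n)) *\<^sub>R b) = (indicator ?Q y :: real)"
    proof cases
      case 1
      then have "\<forall>\<^sub>F n in sequentially. y + (1 / real (Suc n)) *\<^sub>R b \<in> box l r"
        using topological_tendstoD[OF lim open_box] by blast
      then show ?thesis
      proof eventually_elim
        case (elim n)
        then show ?case using 1 box_subset_cbox[of l r] by (simp add: indicator_def subset_eq)
      qed
    next
      case 2
      have "open (- cbox l r)" by (simp add: closed_cbox open_Compl)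
      then have "\<forall>\<^sub>F n in sequentially. y + (1 / real (Suc n)) *\<^sub>R b \<in> - cbox l r"
        using topological_tendstoD[OF lim _ 2] by blast
      then show ?thesis using 2 by (auto elim!: eventually_mono)
    qed
    then show ?thesis by (rule tendsto_eventually)
  qed
  have "(\<lambda>n. \<integral>b. indicator ?Q (y + (1 / real (Suc n)) *\<^sub>R b) * poisson_kernel 1 (sqdist 0 b) \<partial>lborel)
      \<longlonglongrightarrow> (\<integral>b. indicator ?Q y * poisson_kernel 1 (sqdist 0 b) \<partial>lborel)"
  proof (rule integral_dominated_convergence[OF _ _ poisson_1_integrable])
    show "AE b in lborel. (\<lambda>n. indicator ?Q (y + (1 / real (Suc n)) *\<^sub>R b) * poisson_kernel 1 (sqdist 0 b))
        \<longlonglongrightarrow> indicator ?Q y * poisson_kernel 1 (sqdist 0 b)"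
      by (intro AE_I2 tendsto_mult ind tendsto_const)
    show "AE b in lborel. norm (indicator ?Q (y + (1 / real (Suc n)) *\<^sub>R b) * poisson_kernel 1 (sqdist 0 b))
        \<le> poisson_kernel 1 (sqdist 0 b)" for n
      by (auto simp: indicator_def poisson_nonneg)
  qed measurable
  then show ?thesis unfolding eq by (simp add: poisson_mass_def mult.commute)
qed

text \<open>Far from the box, the distance to any of its points is comparable to the distance to the origin.\<close>

lemma box_far_bound:
  fixes K :: "'i \<Rightarrow> real ^ 3 \<Rightarrow> real ^ 3 \<Rightarrow> real"
  assumes Q [measurable]: "Q \<in> sets borel" and L: "L \<ge> 1" "Q \<subseteq> ball 0 L"
    and far: "\<And>i a y. y \<noteq> a \<Longrightarrow> K i a y \<le> c * (1 / norm (a - y)) powr \<rho>" and "c \<ge> 0" "\<rho> > 0"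
    and near: "\<And>i y. (\<integral>\<^sup>+a. ennreal (indicator Q a * K i a y) \<partial>lborel) \<le> ennreal B" and "B \<ge> 0"
  shows "\<exists>C\<ge>0. \<forall>i y. (\<integral>\<^sup>+a. ennreal (indicator Q a * K i a y) \<partial>lborel) \<le> ennreal (C * (1 + sqdist 0 y) powr (- \<rho> / 2))"
proof -
  define v where "v = measure lborel Q"
  have Qf: "emeasure lborel Q = ennreal v"
  proof -
    have "emeasure lborel Q \<le> emeasure lborel (ball (0 :: real ^ 3) L)"
      using L by (intro emeasure_mono) auto
    also have "\<dots> < \<infinity>" by (rule emeasure_lborel_ball_finite)
    finally show ?thesis by (simp add: v_def emeasure_eq_ennreal_measure less_top)
  qed
  \<comment> \<open>The first term serves |y| \<ge> 2 L, where |a - y| \<ge> |y| / 2 and hence 1 +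
    |y|^2 \<le> 8 |a - y|^2; the second serves the smaller y, for which the weight is bounded
    below.\<close>
  define C where "C = c * v * (8 powr (\<rho> / 2)) + B * (1 + 4 * L\<^sup>2) powr (\<rho> / 2)"
  have v0: "v \<ge> 0" by (simp add: v_def)
  have "(\<integral>\<^sup>+a. ennreal (indicator Q a * K i a y) \<partial>lborel) \<le> ennreal (C * (1 + sqdist 0 y) powr (- \<rho> / 2))" for i y
  proof -
    let ?q = "1 + sqdist 0 y"
    have q: "?q > 0" using sqdist_nonneg[of 0 y] by linarith
    show ?thesis
    proof (cases "norm y \<ge> 2 * L")
      case True
      have "(\<integral>\<^sup>+a. ennreal (indicator Q a * K i a y) \<partial>lborel)
          \<le> (\<integral>\<^sup>+a. ennreal (c * (8 powr (\<rho> / 2) * ?q powr (- \<rho> / 2))) * indicator Q a \<partial>lborel)"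
      proof (intro nn_integral_mono)
        fix a
        have "K i a y \<le> c * (8 powr (\<rho> / 2) * ?q powr (- \<rho> / 2))" if a: "a \<in> Q"
        proof -
          have "norm a < L" using a L by auto
          then have d: "norm y / 2 \<le> norm (a - y)" "norm y > 0"
            using True norm_triangle_ineq2[of y a] L by (auto simp: norm_minus_commute)
          have "?q \<le> 2 * (norm y)\<^sup>2"
            using True L one_le_power[of "norm y" 2] by (simp add: sqdist_def)
          also have "\<dots> \<le> 8 * (norm (a - y))\<^sup>2" using power_mono[OF d(1), of 2] by (simp add: power_divide)
          finally have *: "?q / 8 \<le> (norm (a - y))\<^sup>2" by simp
          have ay: "norm (a - y) > 0" using d by linarith
          have "(1 / norm (a - y)) powr \<rho> = ((norm (a - y))\<^sup>2) powr (- \<rho> / 2)"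
          proof -
            have "((norm (a - y))\<^sup>2) powr (- \<rho> / 2) = (norm (a - y) powr 2) powr (- \<rho> / 2)" using ay by simp
            also have "\<dots> = norm (a - y) powr - \<rho>" by (subst powr_powr) simp
            finally show ?thesis using ay by (simp add: powr_minus_divide powr_divide)
          qed
          also have "\<dots> \<le> (?q / 8) powr (- \<rho> / 2)"
            using * q assms(6) by (intro powr_mono2') auto
          also have "\<dots> = 8 powr (\<rho> / 2) * ?q powr (- \<rho> / 2)"
            using q by (simp add: powr_divide powr_minus_divide)
          finally have "(1 / norm (a - y)) powr \<rho> \<le> 8 powr (\<rho> / 2) * ?q powr (- \<rho> / 2)" .
          moreover have "y \<noteq> a" using ay by auto
          ultimately show ?thesis using far[of y a i] assms(5) by (meson mult_left_mono order_trans)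
        qed
        then show "ennreal (indicator Q a * K i a y) \<le> ennreal (c * (8 powr (\<rho> / 2) * ?q powr (- \<rho> / 2))) * indicator Q a"
          by (auto simp: indicator_def intro!: ennreal_leI)
      qed
      also have "\<dots> = ennreal (c * (8 powr (\<rho> / 2) * ?q powr (- \<rho> / 2)) * v)"
        using assms(5) v0 by (simp add: nn_integral_cmult_indicator Qf ennreal_mult)
      also have "\<dots> \<le> ennreal (C * ?q powr (- \<rho> / 2))"
      proof (rule ennreal_leI)
        have "0 \<le> B * (1 + 4 * L\<^sup>2) powr (\<rho> / 2) * ?q powr (- \<rho> / 2)" using assms by simp
        then show "c * (8 powr (\<rho> / 2) * ?q powr (- \<rho> / 2)) * v \<le> C * ?q powr (- \<rho> / 2)"
          by (simp add: C_def algebra_simps)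
      qed
      finally show ?thesis .
    next
      case False
      then have "(norm y)\<^sup>2 \<le> (2 * L)\<^sup>2" by (intro power_mono) auto
      then have "?q \<le> 1 + 4 * L\<^sup>2" by (simp add: sqdist_def power_mult_distrib)
      then have "(1 + 4 * L\<^sup>2) powr (- \<rho> / 2) \<le> ?q powr (- \<rho> / 2)"
        using q assms(6) by (intro powr_mono2') auto
      then have "(1 + 4 * L\<^sup>2) powr (\<rho> / 2) * (1 + 4 * L\<^sup>2) powr (- \<rho> / 2) \<le> (1 + 4 * L\<^sup>2) powr (\<rho> / 2) * ?q powr (- \<rho> / 2)"
        by (intro mult_left_mono) auto
      moreover have "(1 + 4 * L\<^sup>2) powr (\<rho> / 2) * (1 + 4 * L\<^sup>2) powr (- \<rho> / 2) = 1"
      proof -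
        have "1 + 4 * L\<^sup>2 > 0" using L by (simp add: add_pos_nonneg)
        then show ?thesis by (simp add: powr_minus)
      qed
      ultimately have "B * 1 \<le> B * ((1 + 4 * L\<^sup>2) powr (\<rho> / 2) * ?q powr (- \<rho> / 2))"
        using assms by (intro mult_left_mono) auto
      moreover have "0 \<le> c * v * 8 powr (\<rho> / 2) * ?q powr (- \<rho> / 2)" using assms v0 by simp
      ultimately have "B \<le> C * ?q powr (- \<rho> / 2)"
        by (simp add: C_def algebra_simps)
      then show ?thesis using near[where i = i and y = y] ennreal_leI order_trans by blast
    qed
  qed
  moreover have "C \<ge> 0" using assms v0 by (simp add: C_def)
  ultimately show ?thesis by blast
qed

lemma ex_ball_cbox: "\<exists>L\<ge>1. cbox l r \<subseteq> ball (0 :: real ^ 3) L"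
proof -
  obtain L where "L > 0" "cbox l r \<subseteq> ball 0 L"
    using bounded_cbox[of l r] bounded_subset_ballD by blast
  then show ?thesis by (intro exI[of _ "max 1 L"]) (auto simp: subset_eq less_max_iff_disj)
qed

text \<open>One factor e is absorbed by |a - y|^2 + e, which makes the bound uniform in e. The cube
  is not integrable at the centre, so it is used only far from the box, the near field being
  governed by the mass.\<close>

lemma poisson_le_cube:
  assumes "y \<noteq> a" "e > 0"
  shows "poisson_kernel e (sqdist a y) \<le> 3 * (1 / norm (a - y)) powr 3"
proof -
  let ?q = "sqdist a y"
  have q: "?q > 0" using assms by (simp add: sqdist_def)
  have "e * (?q + e) powr (- 5 / 2) \<le> (?q + e) powr 1 * (?q + e) powr (- 5 / 2)"
    using assms q by (intro mult_right_mono) auto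
  also have "\<dots> = (?q + e) powr (1 + - 5 / 2)" by (simp only: powr_add)
  also have "\<dots> \<le> ?q powr (1 + - 5 / 2)" using assms q by (intro powr_mono2') auto
  also have "\<dots> = (norm (a - y) powr 2) powr (- 3 / 2)"
    using assms by (simp add: sqdist_def norm_minus_commute)
  also have "\<dots> = norm (a - y) powr - 3" by (subst powr_powr) simp
  also have "\<dots> = (1 / norm (a - y)) powr 3"
    using assms by (simp add: powr_minus_divide powr_divide)
  finally show ?thesis by (simp add: poisson_kernel_def)
qed

text \<open>Fubini's theorem moves the mollification from \<psi> to the indicator of the box. There
  it converges off the boundary and stays below a multiple of the weight of power -3/2, which comes
  from the cubic decay of the kernel.\<close>

lemma poisson_box_limit:
  fixes \<psi> :: "real ^ 3 \<Rightarrow> 'b::euclidean_space"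
  assumes [measurable]: "\<psi> \<in> borel_measurable lborel"
    and int: "integrable lborel (\<lambda>y. (1 + sqdist 0 y) powr (- 3 / 2) *\<^sub>R \<psi> y)"
  shows "(\<lambda>n. \<integral>a. indicator (cbox l r) a *\<^sub>R (\<integral>y. poisson_kernel (reg_eps n) (sqdist a y) *\<^sub>R \<psi> y \<partial>lborel) \<partial>lborel)
      \<longlonglongrightarrow> poisson_mass *\<^sub>R (\<integral>y. indicator (cbox l r) y *\<^sub>R \<psi> y \<partial>lborel)"
    and "integrable lborel (\<lambda>y. indicator (cbox l r) y *\<^sub>R \<psi> y)"
proof -
  let ?Q = "cbox l r"
  let ?w = "\<lambda>y. (1 + sqdist 0 y) powr (- 3 / 2)"
  obtain L where L: "L \<ge> 1" "?Q \<subseteq> ball 0 L" using ex_ball_cbox by blast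
  define p where "p n y = enn2real (box_poisson ?Q n y)" for n y
  have bp: "box_poisson ?Q n y = (\<integral>\<^sup>+a. ennreal (indicator ?Q a * poisson_kernel (reg_eps n) (sqdist a y)) \<partial>lborel)" for n y
    by (simp add: box_poisson_def)
  have "\<exists>C\<ge>0. \<forall>n y. (\<integral>\<^sup>+a. ennreal (indicator ?Q a * poisson_kernel (reg_eps n) (sqdist a y)) \<partial>lborel)
      \<le> ennreal (C * (1 + sqdist 0 y) powr (- 3 / 2))"
  proof -
    have far: "\<And>n a y. y \<noteq> a \<Longrightarrow> poisson_kernel (reg_eps n) (sqdist a y) \<le> 3 * (1 / norm (a - y)) powr 3"
      by (rule poisson_le_cube) auto
    have near: "\<And>n y. (\<integral>\<^sup>+a. ennreal (indicator ?Q a * poisson_kernel (reg_eps n) (sqdist a y)) \<partial>lborel) \<le> ennreal poisson_mass"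
      unfolding bp[symmetric] by (rule box_poisson_le_mass) simp
    show ?thesis
      by (rule box_far_bound[OF _ L far _ _ near]) (use poisson_mass_pos in auto)
  qed
  then obtain C where C: "C \<ge> 0" "\<And>n y. box_poisson ?Q n y \<le> ennreal (C * ?w y)"
    unfolding bp by blast
  have fin: "ennreal (p n y) = box_poisson ?Q n y" for n y
    unfolding p_def using C(2)[of n y] by (intro ennreal_enn2real) (auto simp: less_top[symmetric] top_unique)
  have p: "p n y \<ge> 0" "p n y \<le> C * ?w y" for n y
    using C(2)[of n y] C(1) unfolding fin[symmetric] by (auto simp: p_def)
  have [measurable]: "box_poisson ?Q n \<in> borel_measurable lborel" for n
    unfolding box_poisson_def by measurable
  have [measurable]: "p n \<in> borel_measurable lborel" for n unfolding p_def by measurable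
  have w: "integrable lborel (\<lambda>y. C * norm (?w y *\<^sub>R \<psi> y))"
    using int by (intro integrable_mult_right integrable_norm)
  have dom: "AE y in lborel. norm (p n y *\<^sub>R \<psi> y) \<le> C * norm (?w y *\<^sub>R \<psi> y)" for n
  proof (rule AE_I2)
    fix y
    have "p n y * norm (\<psi> y) \<le> (C * ?w y) * norm (\<psi> y)" by (intro mult_right_mono p) auto
    then show "norm (p n y *\<^sub>R \<psi> y) \<le> C * norm (?w y *\<^sub>R \<psi> y)" using p(1)[of n y] by simp
  qed
  have "AE y in lborel. y \<notin> ?Q - box l r"
  proof -
    have "?Q - box l r \<in> null_sets lborel"
      using emeasure_lborel_cbox_eq[of l r] emeasure_lborel_box_eq[of l r] emeasure_lborel_cbox_finite[of l r]
      by (auto simp: null_sets_def emeasure_Diff box_subset_cbox less_top)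
    then show ?thesis by (rule AE_not_in)
  qed
  then have lim: "AE y in lborel. (\<lambda>n. p n y *\<^sub>R \<psi> y) \<longlonglongrightarrow> (poisson_mass * indicator ?Q y) *\<^sub>R \<psi> y"
  proof eventually_elim
    case (elim y)
    show ?case unfolding p_def by (intro tendsto_scaleR tendsto_const box_poisson_tendsto elim)
  qed
  have l: "(\<lambda>n. \<integral>y. p n y *\<^sub>R \<psi> y \<partial>lborel) \<longlonglongrightarrow> (\<integral>y. (poisson_mass * indicator ?Q y) *\<^sub>R \<psi> y \<partial>lborel)"
    by (rule integral_dominated_convergence[OF _ _ w lim dom]) measurable
  have "integrable lborel (\<lambda>y. (poisson_mass * indicator ?Q y) *\<^sub>R \<psi> y)"
    by (rule integrable_dominated_convergence[OF _ _ w lim dom]) measurable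
  then have "integrable lborel (\<lambda>y. (1 / poisson_mass) *\<^sub>R (poisson_mass * indicator ?Q y) *\<^sub>R \<psi> y)"
    by (rule integrable_scaleR_right)
  then show "integrable lborel (\<lambda>y. indicator ?Q y *\<^sub>R \<psi> y)" using poisson_mass_pos by simp
  have "(\<integral>a. indicator ?Q a *\<^sub>R (\<integral>y. poisson_kernel (reg_eps n) (sqdist a y) *\<^sub>R \<psi> y \<partial>lborel) \<partial>lborel)
      = (\<integral>y. p n y *\<^sub>R \<psi> y \<partial>lborel)" for n
  proof -
    define f where "f a y = (indicator ?Q a * poisson_kernel (reg_eps n) (sqdist a y)) *\<^sub>R \<psi> y" for a y
    have e: "reg_eps n \<ge> 0" by (simp add: less_imp_le)
    have [measurable]: "(\<lambda>(a, y). f a y) \<in> borel_measurable (lborel \<Otimes>\<^sub>M lborel)"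
      unfolding f_def by measurable
    have nf: "ennreal (norm (f a y)) = ennreal (indicator ?Q a * poisson_kernel (reg_eps n) (sqdist a y)) * ennreal (norm (\<psi> y))" for a y
      using poisson_nonneg[OF e] by (simp add: f_def ennreal_mult[symmetric] abs_mult)
    have "integrable (lborel \<Otimes>\<^sub>M lborel) (case_prod f)"
    proof (rule integrableI_bounded)
      have "(\<integral>\<^sup>+z. ennreal (norm (case_prod f z)) \<partial>(lborel \<Otimes>\<^sub>M lborel)) = (\<integral>\<^sup>+a. \<integral>\<^sup>+y. ennreal (norm (f a y)) \<partial>lborel \<partial>lborel)"
        by (subst lborel.nn_integral_fst[symmetric]) (auto simp: split_beta')
      also have "\<dots> = (\<integral>\<^sup>+y. \<integral>\<^sup>+a. ennreal (norm (f a y)) \<partial>lborel \<partial>lborel)"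
        by (rule lborel_pair.Fubini'[symmetric]) measurable
      also have "\<dots> = (\<integral>\<^sup>+y. box_poisson ?Q n y * ennreal (norm (\<psi> y)) \<partial>lborel)"
        unfolding nf bp by (intro nn_integral_cong nn_integral_multc) measurable
      also have "\<dots> \<le> (\<integral>\<^sup>+y. ennreal (C * norm (?w y *\<^sub>R \<psi> y)) \<partial>lborel)"
      proof (intro nn_integral_mono)
        fix y
        have "box_poisson ?Q n y * ennreal (norm (\<psi> y)) \<le> ennreal (C * ?w y) * ennreal (norm (\<psi> y))"
          by (intro mult_right_mono C) auto
        also have "\<dots> = ennreal (C * ?w y * norm (\<psi> y))"
          using C(1) by (intro ennreal_mult[symmetric]) auto
        also have "C * ?w y * norm (\<psi> y) = C * norm (?w y *\<^sub>R \<psi> y)" by simp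
        finally show "box_poisson ?Q n y * ennreal (norm (\<psi> y)) \<le> ennreal (C * norm (?w y *\<^sub>R \<psi> y))" .
      qed
      also have "\<dots> = ennreal (\<integral>y. C * norm (?w y *\<^sub>R \<psi> y) \<partial>lborel)"
        using C(1) by (intro nn_integral_eq_integral[OF w]) simp
      also have "\<dots> < \<infinity>" by simp
      finally show "(\<integral>\<^sup>+z. ennreal (norm (case_prod f z)) \<partial>(lborel \<Otimes>\<^sub>M lborel)) < \<infinity>" .
    qed measurable
    then have "(\<integral>y. (\<integral>a. f a y \<partial>lborel) \<partial>lborel) = (\<integral>a. (\<integral>y. f a y \<partial>lborel) \<partial>lborel)"
      by (rule lborel_pair.Fubini_integral)
    moreover have "(\<integral>a. f a y \<partial>lborel) = p n y *\<^sub>R \<psi> y" for y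
    proof -
      have "(\<integral>a. indicator ?Q a * poisson_kernel (reg_eps n) (sqdist a y) \<partial>lborel) = p n y"
        unfolding p_def bp by (subst integral_eq_nn_integral) (auto simp: poisson_nonneg[OF e])
      moreover have "integrable lborel (\<lambda>a. indicator ?Q a * poisson_kernel (reg_eps n) (sqdist a y))"
        using fin[of n y] by (intro integrableI_nonneg) (auto simp: bp[symmetric] poisson_nonneg[OF e] simp flip: fin)
      ultimately show ?thesis unfolding f_def by simp
    qed
    moreover have "(\<integral>y. f a y \<partial>lborel) = indicator ?Q a *\<^sub>R (\<integral>y. poisson_kernel (reg_eps n) (sqdist a y) *\<^sub>R \<psi> y \<partial>lborel)" for a
      unfolding f_def by (simp add: scaleR_scaleR[symmetric] del: scaleR_scaleR)
    ultimately show ?thesis by simp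
  qed
  then show "(\<lambda>n. \<integral>a. indicator ?Q a *\<^sub>R (\<integral>y. poisson_kernel (reg_eps n) (sqdist a y) *\<^sub>R \<psi> y \<partial>lborel) \<partial>lborel)
      \<longlonglongrightarrow> poisson_mass *\<^sub>R (\<integral>y. indicator ?Q y *\<^sub>R \<psi> y \<partial>lborel)"
    using l by (simp add: scaleR_scaleR[symmetric] del: scaleR_scaleR)
qed

text \<open>For \<rho> < 3 the singularity is integrable, with a bound independent of y: kernel
  values above 1 are controlled by the weak type, those below 1 by the volume of the box. Far away
  \<open>box_far_bound\<close> supplies the decay.\<close>

lemma box_riesz_bound:
  assumes \<rho>: "0 < \<rho>" "\<rho> < 3"
  shows "\<exists>C\<ge>0. \<forall>y. (\<integral>\<^sup>+a. ennreal (indicator (cbox l r) a * (1 / norm (a - y)) powr \<rho>) \<partial>lborel)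
    \<le> ennreal (C * (1 + sqdist 0 y) powr (- \<rho> / 2))"
proof -
  let ?Q = "cbox l r :: (real ^ 3) set"
  obtain L where L: "L \<ge> 1" "?Q \<subseteq> ball 0 L" using ex_ball_cbox by blast
  define v where "v = measure lborel ?Q"
  have Qf: "emeasure lborel ?Q = ennreal v"
    using emeasure_lborel_cbox_finite[of l r] by (simp add: v_def emeasure_eq_ennreal_measure less_top)
  define B where "B = v + weak_high_const unit_vol \<rho>"
  have h: "weak_high_const unit_vol \<rho> \<ge> 0" using \<rho> by (intro weak_high_const_nonneg) auto
  have near: "(\<integral>\<^sup>+a. ennreal (indicator ?Q a * (1 / norm (a - y)) powr \<rho>) \<partial>lborel) \<le> ennreal B" for y
  proof -
    have "(\<integral>\<^sup>+a. ennreal (indicator ?Q a * (1 / norm (a - y)) powr \<rho>) \<partial>lborel)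
        \<le> (\<integral>\<^sup>+a. indicator ?Q a + ennreal (if 1 < 1 / norm (y - a) then (1 / norm (y - a)) powr \<rho> else 0) \<partial>lborel)"
    proof (intro nn_integral_mono)
      fix a
      show "ennreal (indicator ?Q a * (1 / norm (a - y)) powr \<rho>)
        \<le> indicator ?Q a + ennreal (if 1 < 1 / norm (y - a) then (1 / norm (y - a)) powr \<rho> else 0)"
      proof (cases "1 < 1 / norm (y - a)")
        case True
        then show ?thesis by (auto simp: indicator_def norm_minus_commute add_increasing)
      next
        case False
        then have "(1 / norm (a - y)) powr \<rho> \<le> 1 powr \<rho>"
          using \<rho> by (intro powr_mono2) (auto simp: norm_minus_commute)
        then show ?thesis using False by (auto simp: indicator_def intro!: ennreal_leI)
      qed
    qed
    also have "\<dots> = emeasure lborel ?Q + (\<integral>\<^sup>+a. ennreal (if 1 < 1 / norm (y - a) then (1 / norm (y - a)) powr \<rho> else 0) \<partial>lborel)"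
      by (subst nn_integral_add) auto
    also have "\<dots> \<le> ennreal v + ennreal (weak_high_const unit_vol \<rho>)"
      unfolding Qf using newton.k_high[of y \<rho> 1] \<rho> by (intro add_left_mono) auto
    also have "\<dots> = ennreal B" using h by (simp add: B_def v_def)
    finally show ?thesis .
  qed
  \<comment> \<open>A single kernel, regarded as a family indexed by one point.\<close>
  have "\<exists>C\<ge>0. \<forall>(i::unit) y. (\<integral>\<^sup>+a. ennreal (indicator ?Q a * (1 / norm (a - y)) powr \<rho>) \<partial>lborel)
    \<le> ennreal (C * (1 + sqdist 0 y) powr (- \<rho> / 2))"
    using near h \<rho> by (intro box_far_bound[OF _ L, where c = 1 and B = B]) (auto simp: B_def v_def)
  then show ?thesis by auto
qed

text \<open>The integral B of the majorant may be infinite at some a, but its integral over the box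
  is finite by Fubini, so B is finite for almost every a in the box. Dominated convergence is used
  twice: in y for such a, and then in a.\<close>

lemma potential_box_limit:
  fixes G :: "real ^ 3 \<Rightarrow> 'b::euclidean_space" and K :: "real ^ 3 \<Rightarrow> real"
  assumes \<rho>: "0 < \<rho>" "\<rho> < 3"
    and [measurable]: "G \<in> borel_measurable lborel" "\<And>n. Kn n \<in> borel_measurable borel" "K \<in> borel_measurable borel"
    and bound: "\<And>n z. z \<noteq> 0 \<Longrightarrow> \<bar>Kn n z\<bar> \<le> (1 / norm z) powr \<rho>"
    and lim: "\<And>z. z \<noteq> 0 \<Longrightarrow> (\<lambda>n. Kn n z) \<longlonglongrightarrow> K z"
    and int: "integrable lborel (\<lambda>y. (1 + sqdist 0 y) powr (- \<rho> / 2) *\<^sub>R G y)"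
  shows "integrable lborel (\<lambda>a. indicator (cbox l r) a *\<^sub>R (\<integral>y. K (y - a) *\<^sub>R G y \<partial>lborel))"
    and "\<And>n. integrable lborel (\<lambda>a. indicator (cbox l r) a *\<^sub>R (\<integral>y. Kn n (y - a) *\<^sub>R G y \<partial>lborel))"
    and "(\<lambda>n. \<integral>a. indicator (cbox l r) a *\<^sub>R (\<integral>y. Kn n (y - a) *\<^sub>R G y \<partial>lborel) \<partial>lborel)
      \<longlonglongrightarrow> (\<integral>a. indicator (cbox l r) a *\<^sub>R (\<integral>y. K (y - a) *\<^sub>R G y \<partial>lborel) \<partial>lborel)"
proof -
  let ?Q = "cbox l r"
  define b where "b a y = (1 / norm (a - y)) powr \<rho> * norm (G y)" for a y
  have [measurable]: "(\<lambda>(a, y). b a y) \<in> borel_measurable (lborel \<Otimes>\<^sub>M lborel)" unfolding b_def by measurable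
  have b0: "b a y \<ge> 0" for a y by (simp add: b_def)
  have [measurable]: "b a \<in> borel_measurable lborel" for a unfolding b_def by measurable
  define B where "B a = (\<integral>\<^sup>+y. ennreal (b a y) \<partial>lborel)" for a
  have [measurable]: "B \<in> borel_measurable lborel" unfolding B_def by measurable
  obtain C where C: "C \<ge> 0" "\<And>y. (\<integral>\<^sup>+a. ennreal (indicator ?Q a * (1 / norm (a - y)) powr \<rho>) \<partial>lborel)
    \<le> ennreal (C * (1 + sqdist 0 y) powr (- \<rho> / 2))"
    using box_riesz_bound[OF \<rho>] by blast
  have "(\<integral>\<^sup>+a. indicator ?Q a * B a \<partial>lborel) = (\<integral>\<^sup>+a. \<integral>\<^sup>+y. indicator ?Q a * ennreal (b a y) \<partial>lborel \<partial>lborel)"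
    unfolding B_def by (intro nn_integral_cong nn_integral_cmult[symmetric]) measurable
  also have "\<dots> = (\<integral>\<^sup>+y. \<integral>\<^sup>+a. indicator ?Q a * ennreal (b a y) \<partial>lborel \<partial>lborel)"
    by (rule lborel_pair.Fubini'[symmetric]) measurable
  also have "\<dots> = (\<integral>\<^sup>+y. (\<integral>\<^sup>+a. ennreal (indicator ?Q a * (1 / norm (a - y)) powr \<rho>) \<partial>lborel) * ennreal (norm (G y)) \<partial>lborel)"
  proof (intro nn_integral_cong)
    fix y
    have "(\<integral>\<^sup>+a. indicator ?Q a * ennreal (b a y) \<partial>lborel)
        = (\<integral>\<^sup>+a. ennreal (indicator ?Q a * (1 / norm (a - y)) powr \<rho>) * ennreal (norm (G y)) \<partial>lborel)"
      by (intro nn_integral_cong) (auto simp: b_def indicator_def ennreal_mult[symmetric])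
    then show "(\<integral>\<^sup>+a. indicator ?Q a * ennreal (b a y) \<partial>lborel)
        = (\<integral>\<^sup>+a. ennreal (indicator ?Q a * (1 / norm (a - y)) powr \<rho>) \<partial>lborel) * ennreal (norm (G y))"
      by (simp add: nn_integral_multc)
  qed
  also have "\<dots> \<le> (\<integral>\<^sup>+y. ennreal C * ennreal (norm ((1 + sqdist 0 y) powr (- \<rho> / 2) *\<^sub>R G y)) \<partial>lborel)"
  proof (intro nn_integral_mono)
    fix y
    have "(\<integral>\<^sup>+a. ennreal (indicator ?Q a * (1 / norm (a - y)) powr \<rho>) \<partial>lborel) * ennreal (norm (G y))
        \<le> ennreal (C * (1 + sqdist 0 y) powr (- \<rho> / 2)) * ennreal (norm (G y))"
      by (intro mult_right_mono C) auto
    also have "\<dots> = ennreal C * ennreal (norm ((1 + sqdist 0 y) powr (- \<rho> / 2) *\<^sub>R G y))"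
      using C(1) by (simp add: ennreal_mult mult.assoc)
    finally show "(\<integral>\<^sup>+a. ennreal (indicator ?Q a * (1 / norm (a - y)) powr \<rho>) \<partial>lborel) * ennreal (norm (G y))
        \<le> ennreal C * ennreal (norm ((1 + sqdist 0 y) powr (- \<rho> / 2) *\<^sub>R G y))" .
  qed
  also have "\<dots> = ennreal C * (\<integral>\<^sup>+y. ennreal (norm ((1 + sqdist 0 y) powr (- \<rho> / 2) *\<^sub>R G y)) \<partial>lborel)"
    by (rule nn_integral_cmult) measurable
  also have "\<dots> < \<infinity>" using int by (simp add: integrable_iff_bounded ennreal_mult_less_top)
  finally have B_fin: "(\<integral>\<^sup>+a. indicator ?Q a * B a \<partial>lborel) < \<infinity>" .
  define D where "D a = indicator ?Q a * enn2real (B a)" for a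
  have D0: "D a \<ge> 0" for a by (simp add: D_def)
  have [measurable]: "D \<in> borel_measurable lborel" unfolding D_def by measurable
  have "AE a in lborel. indicator ?Q a * B a \<noteq> \<infinity>"
    using B_fin by (intro nn_integral_PInf_AE) auto
  then have AE_B: "AE a in lborel. a \<in> ?Q \<longrightarrow> B a < \<infinity>"
    by (rule eventually_mono) (auto simp: less_top)
  have D_int: "integrable lborel D"
  proof (rule integrableI_bounded)
    have "(\<integral>\<^sup>+a. ennreal (norm (D a)) \<partial>lborel) = (\<integral>\<^sup>+a. indicator ?Q a * B a \<partial>lborel)"
      using AE_B by (intro nn_integral_cong_AE) (auto simp: D_def indicator_def elim!: eventually_mono)
    then show "(\<integral>\<^sup>+a. ennreal (norm (D a)) \<partial>lborel) < \<infinity>" using B_fin by simp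
  qed measurable
  \<comment> \<open>The kernels are controlled only away from 0; the point y = a is discarded as a
    null set.\<close>
  have pt: "AE y in lborel. norm (Kn n (y - a) *\<^sub>R G y) \<le> b a y" for n a
    using AE_lborel_singleton[of a]
  proof eventually_elim
    case (elim y)
    then show ?case unfolding b_def
      using mult_right_mono[OF bound[of "y - a" n], of "norm (G y)"] by (simp add: norm_minus_commute)
  qed
  have ptl: "AE y in lborel. (\<lambda>n. Kn n (y - a) *\<^sub>R G y) \<longlonglongrightarrow> K (y - a) *\<^sub>R G y" for a
    using AE_lborel_singleton[of a]
    by eventually_elim (auto intro!: tendsto_scaleR lim)
  have b_int: "integrable lborel (b a)" if "B a < \<infinity>" for a
    using that by (intro integrableI_nonneg) (auto simp: B_def b_def)
  have U_lim: "AE a in lborel. (\<lambda>n. indicator ?Q a *\<^sub>R (\<integral>y. Kn n (y - a) *\<^sub>R G y \<partial>lborel))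
      \<longlonglongrightarrow> indicator ?Q a *\<^sub>R (\<integral>y. K (y - a) *\<^sub>R G y \<partial>lborel)"
    using AE_B
  proof eventually_elim
    case (elim a)
    show ?case
    proof (cases "a \<in> ?Q")
      case True
      have "(\<lambda>n. \<integral>y. Kn n (y - a) *\<^sub>R G y \<partial>lborel) \<longlonglongrightarrow> (\<integral>y. K (y - a) *\<^sub>R G y \<partial>lborel)"
        by (rule integral_dominated_convergence[OF _ _ b_int ptl pt]) (use elim True in auto)
      then show ?thesis by (intro tendsto_scaleR tendsto_const)
    qed simp
  qed
  have U_bound: "AE a in lborel. norm (indicator ?Q a *\<^sub>R (\<integral>y. Kn n (y - a) *\<^sub>R G y \<partial>lborel)) \<le> D a" for n
    using AE_B
  proof eventually_elim
    case (elim a)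
    show ?case
    proof (cases "a \<in> ?Q")
      case True
      have "norm (\<integral>y. Kn n (y - a) *\<^sub>R G y \<partial>lborel) \<le> (\<integral>y. b a y \<partial>lborel)"
        by (rule order_trans[OF integral_norm_bound integral_mono_AE']) (use elim True b_int b0 pt in auto)
      also have "\<dots> = enn2real (B a)"
        unfolding B_def by (rule integral_eq_nn_integral) (auto simp: b_def)
      finally show ?thesis using True by (simp add: D_def)
    qed (simp add: D_def)
  qed
  show "integrable lborel (\<lambda>a. indicator ?Q a *\<^sub>R (\<integral>y. K (y - a) *\<^sub>R G y \<partial>lborel))"
    by (rule integrable_dominated_convergence[OF _ _ D_int U_lim U_bound]) measurable
  show "integrable lborel (\<lambda>a. indicator ?Q a *\<^sub>R (\<integral>y. Kn n (y - a) *\<^sub>R G y \<partial>lborel))" for n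
    by (rule integrable_dominated_convergence2[OF _ _ D_int U_lim U_bound]) measurable
  show "(\<lambda>n. \<integral>a. indicator ?Q a *\<^sub>R (\<integral>y. Kn n (y - a) *\<^sub>R G y \<partial>lborel) \<partial>lborel)
      \<longlonglongrightarrow> (\<integral>a. indicator ?Q a *\<^sub>R (\<integral>y. K (y - a) *\<^sub>R G y \<partial>lborel) \<partial>lborel)"
    by (rule integral_dominated_convergence[OF _ _ D_int U_lim U_bound]) measurable
qed

subsection \<open>From distributions to integral equations\<close>

lemma newton_reg_bound:
  assumes "z \<noteq> 0" "e > 0"
  shows "(sqdist 0 z + e) powr (- 1 / 2) \<le> 1 / norm z"
    and "(sqdist 0 z + e) powr (- 3 / 2) \<le> 1 / norm z ^ 3"
proof -
  have q: "sqdist 0 z > 0" "sqdist 0 z = norm z powr 2" using assms by (auto simp: sqdist_def)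
  have "(sqdist 0 z + e) powr (- 1 / 2) \<le> (norm z powr 2) powr (- 1 / 2)"
    using assms q by (intro powr_mono2') auto
  also have "\<dots> = norm z powr (- 1)" by (subst powr_powr) simp
  finally show "(sqdist 0 z + e) powr (- 1 / 2) \<le> 1 / norm z" using assms by (simp add: powr_minus_divide)
  have "(sqdist 0 z + e) powr (- 3 / 2) \<le> (norm z powr 2) powr (- 3 / 2)"
    using assms q by (intro powr_mono2') auto
  also have "\<dots> = norm z powr (- 3)" by (subst powr_powr) simp
  finally show "(sqdist 0 z + e) powr (- 3 / 2) \<le> 1 / norm z ^ 3" using assms by (simp add: powr_minus_divide)
qed

lemma newton_reg_tendsto:
  assumes "z \<noteq> 0"
  shows "(\<lambda>n. (sqdist 0 z + reg_eps n) powr (- 1 / 2)) \<longlonglongrightarrow> 1 / norm z"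
    and "(\<lambda>n. (sqdist 0 z + reg_eps n) powr (- 3 / 2)) \<longlonglongrightarrow> 1 / norm z ^ 3"
proof -
  have q: "sqdist 0 z \<noteq> 0" "sqdist 0 z = norm z powr 2" using assms by (auto simp: sqdist_def)
  have lim: "(\<lambda>n. sqdist 0 z + reg_eps n) \<longlonglongrightarrow> sqdist 0 z"
    using tendsto_add[OF tendsto_const reg_eps_tendsto, of "sqdist 0 z"] by simp
  have "sqdist 0 z powr (- 1 / 2) = norm z powr (- 1)" unfolding q(2) by (subst powr_powr) simp
  then have "sqdist 0 z powr (- 1 / 2) = 1 / norm z" using assms by (simp add: powr_minus_divide)
  then show "(\<lambda>n. (sqdist 0 z + reg_eps n) powr (- 1 / 2)) \<longlonglongrightarrow> 1 / norm z"
    using tendsto_powr[OF lim tendsto_const q(1), of "- 1 / 2"] by simp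
  have "sqdist 0 z powr (- 3 / 2) = norm z powr (- 3)" unfolding q(2) by (subst powr_powr) simp
  then have "sqdist 0 z powr (- 3 / 2) = 1 / norm z ^ 3" using assms by (simp add: powr_minus_divide)
  then show "(\<lambda>n. (sqdist 0 z + reg_eps n) powr (- 3 / 2)) \<longlonglongrightarrow> 1 / norm z ^ 3"
    using tendsto_powr[OF lim tendsto_const q(1), of "- 3 / 2"] by simp
qed

lemma vec_nth_measurable [measurable (raw)]:
  fixes f :: "'a \<Rightarrow> real ^ 3"
  assumes "f \<in> borel_measurable M"
  shows "(\<lambda>x. f x $ k) \<in> borel_measurable M"
  by (rule measurable_compose[OF assms])
     (intro borel_measurable_continuous_onI continuous_on_component continuous_on_id)

lemma sqdist_shift: "sqdist a y = sqdist 0 (y - a)"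
  by (simp add: sqdist_def)

text \<open>For e > 0 the mollified u equals the regularised potential of g at every a. Integrated
  over a box, both sides converge, and the integrals over boxes determine a function almost
  everywhere.\<close>

lemma newton_representation:
  fixes u g :: "real ^ 3 \<Rightarrow> real"
  assumes [measurable]: "u \<in> borel_measurable lborel" "g \<in> borel_measurable lborel"
    and int_u: "\<And>a. integrable lborel (\<lambda>x. (1 + sqdist a x) powr (- 3 / 2) *\<^sub>R u x)"
    and int_g: "\<And>a. integrable lborel (\<lambda>x. (1 + sqdist a x) powr (- 1 / 2) *\<^sub>R g x)"
    and eq: "\<And>\<phi>. test_function \<phi> \<Longrightarrow>
      - (\<Sum>j\<in>UNIV. \<integral>x. partial j (partial j \<phi>) x *\<^sub>R u x \<partial>lborel) = (\<integral>x. \<phi> x *\<^sub>R g x \<partial>lborel)"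
  shows "AE a in lborel. poisson_mass *\<^sub>R u a = (\<integral>y. (1 / norm (y - a)) *\<^sub>R g y \<partial>lborel)"
proof -
  define Kn where "Kn n z = (sqdist 0 z + reg_eps n) powr (- 1 / 2)" for n and z :: "real ^ 3"
  have Kn_meas [measurable]: "Kn n \<in> borel_measurable borel" for n unfolding Kn_def by measurable
  have K_bound: "\<bar>Kn n z\<bar> \<le> (1 / norm z) powr 1" if "z \<noteq> 0" for n z
    using newton_reg_bound(1)[OF that, of "reg_eps n"] by (simp add: Kn_def)
  have K_lim: "(\<lambda>n. Kn n z) \<longlonglongrightarrow> 1 / norm z" if "z \<noteq> 0" for z
    unfolding Kn_def using that by (rule newton_reg_tendsto)
  note P = potential_box_limit[where \<rho> = 1 and Kn = Kn and K = "\<lambda>z. 1 / norm z" and G = g,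
      OF _ _ _ Kn_meas _ K_bound K_lim int_g[of 0], simplified]
  have id: "(\<integral>y. poisson_kernel (reg_eps n) (sqdist a y) *\<^sub>R u y \<partial>lborel) = (\<integral>y. Kn n (y - a) *\<^sub>R g y \<partial>lborel)" for n a
    using laplace_identity[OF reg_eps_pos _ _ int_u int_g eq, of n a]
    by (simp add: newton_def Kn_def sqdist_shift[of a])
  show ?thesis
  proof (rule AE_eq_from_boxes)
    fix l r :: "real ^ 3"
    note U = poisson_box_limit[OF _ int_u[of 0], of l r]
    have "(\<lambda>n. \<integral>a. indicator (cbox l r) a *\<^sub>R (\<integral>y. Kn n (y - a) *\<^sub>R g y \<partial>lborel) \<partial>lborel)
      \<longlonglongrightarrow> poisson_mass *\<^sub>R (\<integral>y. indicator (cbox l r) y *\<^sub>R u y \<partial>lborel)"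
      using U(1) unfolding id by simp
    then have "poisson_mass *\<^sub>R (\<integral>y. indicator (cbox l r) y *\<^sub>R u y \<partial>lborel)
        = (\<integral>a. indicator (cbox l r) a *\<^sub>R (\<integral>y. (1 / norm (y - a)) *\<^sub>R g y \<partial>lborel) \<partial>lborel)"
      using P(3)[of l r] by (intro LIMSEQ_unique) auto
    then show "(\<integral>x. indicator (cbox l r) x *\<^sub>R poisson_mass *\<^sub>R u x \<partial>lborel)
        = (\<integral>a. indicator (cbox l r) a *\<^sub>R (\<integral>y. (1 / norm (y - a)) *\<^sub>R g y \<partial>lborel) \<partial>lborel)"
      by (simp add: mult.left_commute)
    show "integrable lborel (\<lambda>x. indicator (cbox l r) x *\<^sub>R poisson_mass *\<^sub>R u x)"
      using integrable_scaleR_right[OF U(2), of poisson_mass] by (simp add: mult.left_commute)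
    show "integrable lborel (\<lambda>a. indicator (cbox l r) a *\<^sub>R (\<integral>y. (1 / norm (y - a)) *\<^sub>R g y \<partial>lborel))"
      using P(1)[of l r] by simp
  qed measurable
qed

text \<open>The kernels are coordinates of the gradient of the Newtonian kernel, bounded by its
  square, whence \<rho> = 2. The bounded linear maps M k, which collect matrix, imaginary unit and
  sign, commute with integrals and limits.\<close>

lemma dirac_representation:
  fixes \<psi> h :: "real ^ 3 \<Rightarrow> 'b::euclidean_space" and L :: "3 \<Rightarrow> 'b \<Rightarrow> 'b" and J :: "'b \<Rightarrow> 'b"
  assumes [measurable]: "\<psi> \<in> borel_measurable lborel" "h \<in> borel_measurable lborel"
    and int_\<psi>: "\<And>a. integrable lborel (\<lambda>x. (1 + sqdist a x) powr (- 3 / 2) *\<^sub>R \<psi> x)"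
    and int_h: "\<And>a. integrable lborel (\<lambda>x. (1 + sqdist a x) powr (- 1) *\<^sub>R h x)"
    and L: "\<And>j. bounded_linear (L j)" and J: "bounded_linear J"
    and anticomm: "\<And>j k v. L j (L k v) + L k (L j v) = (if j = k then 2 else 0) *\<^sub>R v"
    and eq: "\<And>\<phi>. test_function \<phi> \<Longrightarrow>
      (\<Sum>j\<in>UNIV. L j (\<integral>x. partial j \<phi> x *\<^sub>R \<psi> x \<partial>lborel)) = - J (\<integral>x. \<phi> x *\<^sub>R h x \<partial>lborel)"
  shows "AE a in lborel. poisson_mass *\<^sub>R \<psi> a
    = (\<Sum>k\<in>UNIV. - L k (J (\<integral>y. ((y - a) $ k / norm (y - a) ^ 3) *\<^sub>R h y \<partial>lborel)))"
proof -
  define M where "M k v = - L k (J v)" for k v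
  have M: "bounded_linear (M k)" for k
    unfolding M_def using bounded_linear_minus[OF bounded_linear_compose[OF L J]] by simp
  then have M_meas [measurable]: "M k \<in> borel_measurable borel" for k
    by (intro borel_measurable_continuous_onI linear_continuous_on)
  interpret M: bounded_linear "M k" for k by (rule M)
  define Kn where "Kn k n z = z $ k * (sqdist 0 z + reg_eps n) powr (- 3 / 2)" for k n and z :: "real ^ 3"
  have Kn_meas [measurable]: "Kn k n \<in> borel_measurable borel" for k n unfolding Kn_def by measurable
  have K_bound: "\<bar>Kn k n z\<bar> \<le> (1 / norm z) powr 2" if "z \<noteq> 0" for k n z
  proof -
    have "\<bar>Kn k n z\<bar> \<le> norm z * (1 / norm z ^ 3)"
      unfolding Kn_def abs_mult using newton_reg_bound(2)[OF that, of "reg_eps n"] component_le_norm_cart[of z k]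
      by (intro mult_mono) auto
    also have "\<dots> = (1 / norm z)\<^sup>2" using that by (simp add: power_divide eval_nat_numeral)
    finally show ?thesis using that by simp
  qed
  have K_lim: "(\<lambda>n. Kn k n z) \<longlonglongrightarrow> z $ k / norm z ^ 3" if "z \<noteq> 0" for k z
    unfolding Kn_def using tendsto_mult[OF tendsto_const newton_reg_tendsto(2)[OF that], of "z $ k"] by simp
  have int_h': "integrable lborel (\<lambda>y. (1 + sqdist 0 y) powr (- 2 / 2) *\<^sub>R h y)" using int_h[of 0] by simp
  note P = potential_box_limit[where \<rho> = 2 and Kn = "Kn k" and K = "\<lambda>z. z $ k / norm z ^ 3" and G = h for k,
      OF _ _ _ Kn_meas _ K_bound K_lim int_h']
  have id: "(\<integral>y. poisson_kernel (reg_eps n) (sqdist a y) *\<^sub>R \<psi> y \<partial>lborel) = (\<Sum>k\<in>UNIV. M k (\<integral>y. Kn k n (y - a) *\<^sub>R h y \<partial>lborel))" for n a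
    using dirac_identity[OF reg_eps_pos _ _ int_\<psi> int_h L J anticomm eq, of n a]
    by (simp add: M_def Kn_def sqdist_shift[of a])
  let ?U = "\<lambda>a. \<Sum>k\<in>UNIV. M k (\<integral>y. ((y - a) $ k / norm (y - a) ^ 3) *\<^sub>R h y \<partial>lborel)"
  have "AE a in lborel. poisson_mass *\<^sub>R \<psi> a = ?U a"
  proof (rule AE_eq_from_boxes)
    fix l r :: "real ^ 3"
    let ?i = "indicator (cbox l r) :: real ^ 3 \<Rightarrow> real"
    note U = poisson_box_limit[OF _ int_\<psi>[of 0], of l r]
    have Pi: "integrable lborel (\<lambda>a. ?i a *\<^sub>R (\<integral>y. ((y - a) $ k / norm (y - a) ^ 3) *\<^sub>R h y \<partial>lborel))"
        "\<And>n. integrable lborel (\<lambda>a. ?i a *\<^sub>R (\<integral>y. Kn k n (y - a) *\<^sub>R h y \<partial>lborel))"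
        "(\<lambda>n. \<integral>a. ?i a *\<^sub>R (\<integral>y. Kn k n (y - a) *\<^sub>R h y \<partial>lborel) \<partial>lborel)
          \<longlonglongrightarrow> (\<integral>a. ?i a *\<^sub>R (\<integral>y. ((y - a) $ k / norm (y - a) ^ 3) *\<^sub>R h y \<partial>lborel) \<partial>lborel)" for k
      by (rule P; simp)+
    have swap: "(\<integral>a. ?i a *\<^sub>R (\<Sum>k\<in>UNIV. M k (V k a)) \<partial>lborel) = (\<Sum>k\<in>UNIV. M k (\<integral>a. ?i a *\<^sub>R V k a \<partial>lborel))"
      "integrable lborel (\<lambda>a. ?i a *\<^sub>R (\<Sum>k\<in>UNIV. M k (V k a)))"
      if "\<And>k. integrable lborel (\<lambda>a. ?i a *\<^sub>R V k a)" for V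
    proof -
      have e: "?i a *\<^sub>R (\<Sum>k\<in>UNIV. M k (V k a)) = (\<Sum>k\<in>UNIV. M k (?i a *\<^sub>R V k a))" for a
        by (simp add: scaleR_sum_right M.scaleR)
      have i: "integrable lborel (\<lambda>a. M k (?i a *\<^sub>R V k a))" for k
        by (rule integrable_bounded_linear[OF M that])
      show "integrable lborel (\<lambda>a. ?i a *\<^sub>R (\<Sum>k\<in>UNIV. M k (V k a)))"
        unfolding e by (intro Bochner_Integration.integrable_sum i)
      show "(\<integral>a. ?i a *\<^sub>R (\<Sum>k\<in>UNIV. M k (V k a)) \<partial>lborel) = (\<Sum>k\<in>UNIV. M k (\<integral>a. ?i a *\<^sub>R V k a \<partial>lborel))"
        unfolding e using i by (subst Bochner_Integration.integral_sum) (auto intro!: sum.cong integral_bounded_linear[OF M that])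
    qed
    have s: "(\<integral>a. ?i a *\<^sub>R (\<Sum>k\<in>UNIV. M k (\<integral>y. Kn k n (y - a) *\<^sub>R h y \<partial>lborel)) \<partial>lborel)
      = (\<Sum>k\<in>UNIV. M k (\<integral>a. ?i a *\<^sub>R (\<integral>y. Kn k n (y - a) *\<^sub>R h y \<partial>lborel) \<partial>lborel))" for n
      by (rule swap(1)) (rule Pi(2))
    have "(\<lambda>n. \<Sum>k\<in>UNIV. M k (\<integral>a. ?i a *\<^sub>R (\<integral>y. Kn k n (y - a) *\<^sub>R h y \<partial>lborel) \<partial>lborel))
      \<longlonglongrightarrow> poisson_mass *\<^sub>R (\<integral>y. ?i y *\<^sub>R \<psi> y \<partial>lborel)"
      using U(1) unfolding id s by simp
    moreover have "(\<lambda>n. \<Sum>k\<in>UNIV. M k (\<integral>a. ?i a *\<^sub>R (\<integral>y. Kn k n (y - a) *\<^sub>R h y \<partial>lborel) \<partial>lborel))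
      \<longlonglongrightarrow> (\<Sum>k\<in>UNIV. M k (\<integral>a. ?i a *\<^sub>R (\<integral>y. ((y - a) $ k / norm (y - a) ^ 3) *\<^sub>R h y \<partial>lborel) \<partial>lborel))"
      by (intro tendsto_sum M.tendsto Pi)
    ultimately have "poisson_mass *\<^sub>R (\<integral>y. ?i y *\<^sub>R \<psi> y \<partial>lborel)
        = (\<Sum>k\<in>UNIV. M k (\<integral>a. ?i a *\<^sub>R (\<integral>y. ((y - a) $ k / norm (y - a) ^ 3) *\<^sub>R h y \<partial>lborel) \<partial>lborel))"
      by (rule LIMSEQ_unique)
    also have "\<dots> = (\<integral>a. ?i a *\<^sub>R ?U a \<partial>lborel)" by (rule swap(1)[OF Pi(1), symmetric])
    finally have U_eq: "poisson_mass *\<^sub>R (\<integral>y. ?i y *\<^sub>R \<psi> y \<partial>lborel) = (\<integral>a. ?i a *\<^sub>R ?U a \<partial>lborel)" .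
    have c: "?i x *\<^sub>R poisson_mass *\<^sub>R \<psi> x = poisson_mass *\<^sub>R ?i x *\<^sub>R \<psi> x" for x
      by (rule scaleR_left_commute)
    show "(\<integral>x. ?i x *\<^sub>R poisson_mass *\<^sub>R \<psi> x \<partial>lborel) = (\<integral>a. ?i a *\<^sub>R ?U a \<partial>lborel)"
      unfolding c U_eq[symmetric] by (rule integral_scaleR_right)
    show "integrable lborel (\<lambda>x. ?i x *\<^sub>R poisson_mass *\<^sub>R \<psi> x)"
      unfolding c by (intro integrable_scaleR_right U(2)) simp
    show "integrable lborel (\<lambda>a. ?i a *\<^sub>R ?U a)" by (rule swap(2)[OF Pi(1)])
  qed measurable
  then show ?thesis by (simp add: M_def)
qed

subsection \<open>Pointwise decay from the integral inequalities\<close>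

lemma (in weak_kernel) scaled_weak_kernel:
  assumes "c > 0"
  shows "weak_kernel M (\<lambda>x y. c * k x y) (A * c ^ 3)"
proof
  show "(\<lambda>(x, y). c * k x y) \<in> borel_measurable (M \<Otimes>\<^sub>M M)" by measurable
  fix x and t :: real assume x: "x \<in> space M" and t: "t > 0"
  have "{y \<in> space M. t < c * k x y} = {y \<in> space M. t / c < k x y}"
    using assms by (auto simp: field_simps)
  then have "emeasure M {y \<in> space M. t < c * k x y} \<le> ennreal (A / (t / c) ^ 3)"
    using k_weak[OF x, of "t / c"] t assms by simp
  then show "emeasure M {y \<in> space M. t < c * k x y} \<le> ennreal (A * c ^ 3 / t ^ 3)"
    by (simp add: power_divide)
qed (use assms A_nonneg k_nonneg k_sym in auto)

text \<open>The density vanishes at 0 only, where 1/0 = 0, and a point is a null set.\<close>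

lemma AE_kelvin_iff:
  assumes "Measurable.pred borel P"
  shows "(AE x in kelvin_measure. P x) \<longleftrightarrow> (AE x in lborel. P x)"
proof -
  have "(AE x in kelvin_measure. P x) \<longleftrightarrow> (AE x in lborel. 0 < ennreal (1 / norm x ^ 6) \<longrightarrow> P x)"
    unfolding kelvin_measure_def by (subst AE_density) auto
  also have "\<dots> \<longleftrightarrow> (AE x in lborel. P x)"
    using AE_lborel_singleton[of "0 :: real ^ 3"] by (intro eventually_subst) (auto elim: eventually_mono)
  finally show ?thesis .
qed

lemma AE_kelvinI: "AE x in lborel. P x \<Longrightarrow> AE x in kelvin_measure. P x"
  unfolding kelvin_measure_def by (subst AE_density) (auto elim: eventually_mono)

lemma nn_integral_kelvin:
  assumes [measurable]: "F \<in> borel_measurable borel"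
  shows "(\<integral>\<^sup>+x. F x \<partial>kelvin_measure) = (\<integral>\<^sup>+x. ennreal (1 / norm x ^ 6) * F x \<partial>lborel)"
  unfolding kelvin_measure_def by (rule nn_integral_density) measurable

text \<open>The powers match exactly: |x|^(-6) w^6 = v^6 and |x|^(-6) h^3 = f^3 away from 0, and in
  both inequalities the density |y|^(-6) cancels all powers of |y|, leaving the factor |x| in the
  first and |x|^2 in the second. Bounds on v, f and on w, h then add up to the two decay
  rates.\<close>

theorem decay_from_integral_inequalities:
  fixes v f :: "real ^ 3 \<Rightarrow> real"
  assumes [measurable]: "v \<in> borel_measurable borel" "f \<in> borel_measurable borel"
    and v0: "\<And>x. 0 \<le> v x" and f0: "\<And>x. 0 \<le> f x"
    and v6: "(\<integral>\<^sup>+x. ennreal (v x ^ 6) \<partial>lborel) < \<infinity>" and f3: "(\<integral>\<^sup>+x. ennreal (f x ^ 3) \<partial>lborel) < \<infinity>"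
    and c: "c > 0"
    and v_le: "AE x in lborel. ennreal (v x) \<le> (\<integral>\<^sup>+y. ennreal (c * (1 / norm (x - y)) * ((f y)\<^sup>2 * v y)) \<partial>lborel)"
    and f_le: "AE x in lborel. ennreal (f x) \<le> (\<integral>\<^sup>+y. ennreal ((c * (1 / norm (x - y)))\<^sup>2 * ((v y)\<^sup>2 * f y)) \<partial>lborel)"
  shows "\<exists>B>0. AE x in lborel. v x * (1 + norm x) \<le> B \<and> f x * (1 + (norm x)\<^sup>2) \<le> B"
proof -
  interpret N: weak_kernel lborel "\<lambda>x y :: real ^ 3. c * (1 / norm (x - y))" "unit_vol * c ^ 3"
    by (rule newton.scaled_weak_kernel[OF c])
  interpret K: weak_kernel kelvin_measure "\<lambda>x y :: real ^ 3. c * (norm x * norm y / norm (x - y))" "kelvin_const * c ^ 3"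
    by (rule kelvin.scaled_weak_kernel[OF c])
  obtain B1 where B1: "AE x in lborel. v x \<le> B1 \<and> f x \<le> B1"
    using N.coupled_potentials_bounded[OF _ _ v0 f0 v6 f3 v_le f_le] by auto
  define w where "w x = norm x * v x" for x
  define h where "h x = (norm x)\<^sup>2 * f x" for x
  have [measurable]: "w \<in> borel_measurable borel" "h \<in> borel_measurable borel"
    unfolding w_def h_def by measurable
  have w6: "(\<integral>\<^sup>+x. ennreal (w x ^ 6) \<partial>kelvin_measure) < \<infinity>"
  proof -
    have "(\<integral>\<^sup>+x. ennreal (w x ^ 6) \<partial>kelvin_measure) = (\<integral>\<^sup>+x. ennreal (1 / norm x ^ 6) * ennreal (w x ^ 6) \<partial>lborel)"
      by (rule nn_integral_kelvin) measurable
    also have "\<dots> \<le> (\<integral>\<^sup>+x. ennreal (v x ^ 6) \<partial>lborel)"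
      by (intro nn_integral_mono) (auto simp: w_def ennreal_mult[symmetric] power_mult_distrib)
    finally show ?thesis using v6 by simp
  qed
  have h3: "(\<integral>\<^sup>+x. ennreal (h x ^ 3) \<partial>kelvin_measure) < \<infinity>"
  proof -
    have "(\<integral>\<^sup>+x. ennreal (h x ^ 3) \<partial>kelvin_measure) = (\<integral>\<^sup>+x. ennreal (1 / norm x ^ 6) * ennreal (h x ^ 3) \<partial>lborel)"
      by (rule nn_integral_kelvin) measurable
    also have "\<dots> \<le> (\<integral>\<^sup>+x. ennreal (f x ^ 3) \<partial>lborel)"
      using f0 by (intro nn_integral_mono) (auto simp: h_def ennreal_mult[symmetric] power_mult_distrib simp flip: power_mult)
    finally show ?thesis using f3 by simp
  qed
  have w_eq: "ennreal (norm x) * (\<integral>\<^sup>+y. ennreal (c * (1 / norm (x - y)) * ((f y)\<^sup>2 * v y)) \<partial>lborel)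
      = (\<integral>\<^sup>+y. ennreal (c * (norm x * norm y / norm (x - y)) * ((h y)\<^sup>2 * w y)) \<partial>kelvin_measure)" for x
  proof -
    have "(\<integral>\<^sup>+y. ennreal (c * (norm x * norm y / norm (x - y)) * ((h y)\<^sup>2 * w y)) \<partial>kelvin_measure)
        = (\<integral>\<^sup>+y. ennreal (1 / norm y ^ 6) * ennreal (c * (norm x * norm y / norm (x - y)) * ((h y)\<^sup>2 * w y)) \<partial>lborel)"
      by (rule nn_integral_kelvin) measurable
    also have "\<dots> = (\<integral>\<^sup>+y. ennreal (norm x) * ennreal (c * (1 / norm (x - y)) * ((f y)\<^sup>2 * v y)) \<partial>lborel)"
    proof (rule nn_integral_cong_AE)
      show "AE y in lborel. ennreal (1 / norm y ^ 6) * ennreal (c * (norm x * norm y / norm (x - y)) * ((h y)\<^sup>2 * w y))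
          = ennreal (norm x) * ennreal (c * (1 / norm (x - y)) * ((f y)\<^sup>2 * v y))"
        using AE_lborel_singleton[of "0 :: real ^ 3"]
      proof eventually_elim
        case (elim y)
        have "1 / norm y ^ 6 * (c * (norm x * norm y / norm (x - y)) * ((h y)\<^sup>2 * w y))
            = norm x * (c * (1 / norm (x - y)) * ((f y)\<^sup>2 * v y))"
          using elim by (simp add: h_def w_def field_simps eval_nat_numeral)
        then show ?case using c v0 f0 by (subst (1 2) ennreal_mult[symmetric]) (auto simp: w_def)
      qed
    qed
    also have "\<dots> = ennreal (norm x) * (\<integral>\<^sup>+y. ennreal (c * (1 / norm (x - y)) * ((f y)\<^sup>2 * v y)) \<partial>lborel)"
      by (rule nn_integral_cmult) measurable
    finally show ?thesis by simp
  qed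
  have h_eq: "ennreal ((norm x)\<^sup>2) * (\<integral>\<^sup>+y. ennreal ((c * (1 / norm (x - y)))\<^sup>2 * ((v y)\<^sup>2 * f y)) \<partial>lborel)
      = (\<integral>\<^sup>+y. ennreal ((c * (norm x * norm y / norm (x - y)))\<^sup>2 * ((w y)\<^sup>2 * h y)) \<partial>kelvin_measure)" for x
  proof -
    have "(\<integral>\<^sup>+y. ennreal ((c * (norm x * norm y / norm (x - y)))\<^sup>2 * ((w y)\<^sup>2 * h y)) \<partial>kelvin_measure)
        = (\<integral>\<^sup>+y. ennreal (1 / norm y ^ 6) * ennreal ((c * (norm x * norm y / norm (x - y)))\<^sup>2 * ((w y)\<^sup>2 * h y)) \<partial>lborel)"
      by (rule nn_integral_kelvin) measurable
    also have "\<dots> = (\<integral>\<^sup>+y. ennreal ((norm x)\<^sup>2) * ennreal ((c * (1 / norm (x - y)))\<^sup>2 * ((v y)\<^sup>2 * f y)) \<partial>lborel)"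
    proof (rule nn_integral_cong_AE)
      show "AE y in lborel. ennreal (1 / norm y ^ 6) * ennreal ((c * (norm x * norm y / norm (x - y)))\<^sup>2 * ((w y)\<^sup>2 * h y))
          = ennreal ((norm x)\<^sup>2) * ennreal ((c * (1 / norm (x - y)))\<^sup>2 * ((v y)\<^sup>2 * f y))"
        using AE_lborel_singleton[of "0 :: real ^ 3"]
      proof eventually_elim
        case (elim y)
        have "1 / norm y ^ 6 * ((c * (norm x * norm y / norm (x - y)))\<^sup>2 * ((w y)\<^sup>2 * h y))
            = (norm x)\<^sup>2 * ((c * (1 / norm (x - y)))\<^sup>2 * ((v y)\<^sup>2 * f y))"
          using elim by (simp add: h_def w_def field_simps eval_nat_numeral)
        then show ?case using c v0 f0 by (subst (1 2) ennreal_mult[symmetric]) (auto simp: h_def)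
      qed
    qed
    also have "\<dots> = ennreal ((norm x)\<^sup>2) * (\<integral>\<^sup>+y. ennreal ((c * (1 / norm (x - y)))\<^sup>2 * ((v y)\<^sup>2 * f y)) \<partial>lborel)"
      by (rule nn_integral_cmult) measurable
    finally show ?thesis by simp
  qed
  have "AE x in lborel. ennreal (w x) \<le> (\<integral>\<^sup>+y. ennreal (c * (norm x * norm y / norm (x - y)) * ((h y)\<^sup>2 * w y)) \<partial>kelvin_measure)"
    using v_le
  proof eventually_elim
    case (elim x)
    have "ennreal (w x) = ennreal (norm x) * ennreal (v x)" by (simp add: w_def ennreal_mult v0)
    also have "\<dots> \<le> ennreal (norm x) * (\<integral>\<^sup>+y. ennreal (c * (1 / norm (x - y)) * ((f y)\<^sup>2 * v y)) \<partial>lborel)"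
      by (intro mult_left_mono elim) simp
    finally show ?case unfolding w_eq .
  qed
  then have w_le: "AE x in kelvin_measure. ennreal (w x) \<le> (\<integral>\<^sup>+y. ennreal (c * (norm x * norm y / norm (x - y)) * ((h y)\<^sup>2 * w y)) \<partial>kelvin_measure)"
    by (rule AE_kelvinI)
  have "AE x in lborel. ennreal (h x) \<le> (\<integral>\<^sup>+y. ennreal ((c * (norm x * norm y / norm (x - y)))\<^sup>2 * ((w y)\<^sup>2 * h y)) \<partial>kelvin_measure)"
    using f_le
  proof eventually_elim
    case (elim x)
    have "ennreal (h x) = ennreal ((norm x)\<^sup>2) * ennreal (f x)" by (simp add: h_def ennreal_mult f0)
    also have "\<dots> \<le> ennreal ((norm x)\<^sup>2) * (\<integral>\<^sup>+y. ennreal ((c * (1 / norm (x - y)))\<^sup>2 * ((v y)\<^sup>2 * f y)) \<partial>lborel)"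
      by (intro mult_left_mono elim) simp
    finally show ?case unfolding h_eq .
  qed
  then have h_le: "AE x in kelvin_measure. ennreal (h x) \<le> (\<integral>\<^sup>+y. ennreal ((c * (norm x * norm y / norm (x - y)))\<^sup>2 * ((w y)\<^sup>2 * h y)) \<partial>kelvin_measure)"
    by (rule AE_kelvinI)
  have wh0: "0 \<le> w x" "0 \<le> h x" for x using v0 f0 by (auto simp: w_def h_def)
  obtain B2 where "AE x in kelvin_measure. w x \<le> B2 \<and> h x \<le> B2"
    using K.coupled_potentials_bounded[OF _ _ wh0 w6 h3 w_le h_le] by auto
  then have B2: "AE x in lborel. w x \<le> B2 \<and> h x \<le> B2"
    by (subst (asm) AE_kelvin_iff) auto
  have "AE x in lborel. v x * (1 + norm x) \<le> \<bar>B1\<bar> + \<bar>B2\<bar> + 1 \<and> f x * (1 + (norm x)\<^sup>2) \<le> \<bar>B1\<bar> + \<bar>B2\<bar> + 1"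
    using B1 B2 by eventually_elim (auto simp: w_def h_def algebra_simps)
  then show ?thesis by (intro exI[of _ "\<bar>B1\<bar> + \<bar>B2\<bar> + 1"]) auto
qed

subsection \<open>Continuity and asymptotics of potentials\<close>

text \<open>The form N z / |z|^3 covers both kernels: N z = |z|^2 with p = 1 is the Newtonian one, N
  z = z_k with p = 2 gives the coordinates of its gradient up to sign.\<close>

lemma potential_kernel_bound:
  fixes z :: "real ^ 3" and p :: nat
  assumes "\<bar>N z\<bar> \<le> norm z ^ (3 - p)" "p \<le> 3"
  shows "\<bar>N z / norm z ^ 3\<bar> \<le> (1 / norm z) ^ p"
proof (cases "z = 0")
  case False
  have "\<bar>N z / norm z ^ 3\<bar> \<le> norm z ^ (3 - p) / norm z ^ 3"
    using assms by (simp add: divide_right_mono)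
  also have "\<dots> = (1 / norm z) ^ p"
  proof -
    have "norm z ^ 3 = norm z ^ (3 - p) * norm z ^ p" using assms by (simp add: power_add[symmetric])
    then show ?thesis using False by (simp add: power_one_over)
  qed
  finally show ?thesis .
qed simp

text \<open>Freezing the denominator below |z| = 1/n makes the kernel bounded and changes it only
  for |z| < 1/n, where both versions are at most |z|^(-p).\<close>

lemma truncated_kernel_bounds:
  fixes z :: "real ^ 3" and p :: nat and n :: nat
  assumes N: "\<bar>N z\<bar> \<le> norm z ^ (3 - p)" and p: "p \<in> {1, 2}" and n: "n > 0"
  defines "T \<equiv> N z / max (norm z) (1 / real n) ^ 3"
  shows "\<bar>T\<bar> \<le> real n ^ p" and "\<bar>N z / norm z ^ 3 - T\<bar> \<le> 2 * (if real n < 1 / norm z then (1 / norm z) ^ p else 0)"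
proof -
  let ?m = "max (norm z) (1 / real n)"
  have m: "?m > 0" "1 / real n \<le> ?m" "norm z \<le> ?m" using n by (auto simp: less_max_iff_disj)
  have "\<bar>T\<bar> \<le> ?m ^ (3 - p) / ?m ^ 3"
    unfolding T_def abs_divide using m N by (auto intro!: divide_right_mono order_trans[OF N] power_mono)
  also have "\<dots> = (1 / ?m) ^ p"
  proof -
    have "?m ^ 3 = ?m ^ (3 - p) * ?m ^ p" using p by (auto simp: eval_nat_numeral)
    then show ?thesis using m by (simp add: power_one_over)
  qed
  finally have "\<bar>T\<bar> \<le> (1 / ?m) ^ p" .
  also have "\<dots> \<le> real n ^ p"
  proof (intro power_mono)
    have "1 / ?m \<le> 1 / (1 / real n)" using m n by (intro divide_left_mono mult_pos_pos) auto
    then show "1 / ?m \<le> real n" by simp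
  qed (use m in simp)
  finally show "\<bar>T\<bar> \<le> real n ^ p" .
  show "\<bar>N z / norm z ^ 3 - T\<bar> \<le> 2 * (if real n < 1 / norm z then (1 / norm z) ^ p else 0)"
  proof (cases "z = 0")
    case True
    then have "N z = 0" using N p by auto
    then show ?thesis using True by (simp add: T_def)
  next
    case False
    show ?thesis
    proof (cases "real n < 1 / norm z")
      case True
      have "\<bar>T\<bar> \<le> \<bar>N z\<bar> / norm z ^ 3"
        unfolding T_def abs_divide using m False by (auto intro!: divide_left_mono power_mono mult_pos_pos)
      moreover have "\<bar>N z / norm z ^ 3\<bar> \<le> (1 / norm z) ^ p" using p by (intro potential_kernel_bound N) auto
      ultimately have "\<bar>T\<bar> \<le> (1 / norm z) ^ p" "\<bar>N z / norm z ^ 3\<bar> \<le> (1 / norm z) ^ p"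
        by (simp_all add: abs_divide)
      then have "\<bar>N z / norm z ^ 3 - T\<bar> \<le> 2 * (1 / norm z) ^ p" by linarith
      then show ?thesis using True by simp
    next
      case f: False
      then have "1 / real n \<le> norm z" using False n by (simp add: field_simps not_less)
      then have "?m = norm z" by simp
      then show ?thesis using f by (simp add: T_def)
    qed
  qed
qed

text \<open>The weak type gives n^(p - 3), which is at most 1/n because p \<le> 2.\<close>

lemma nn_integral_near:
  fixes p n :: nat and a :: "real ^ 3"
  assumes "p \<in> {1, 2}" "n > 0"
  shows "(\<integral>\<^sup>+y. ennreal (if real n < 1 / norm (y - a) then (1 / norm (y - a)) ^ p else 0) \<partial>lborel)
    \<le> ennreal (weak_high_const unit_vol p / n)"
proof -
  have h: "weak_high_const unit_vol p \<ge> 0" using assms by (intro weak_high_const_nonneg) auto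
  have "(\<integral>\<^sup>+y. ennreal (if real n < 1 / norm (y - a) then (1 / norm (y - a)) ^ p else 0) \<partial>lborel)
      = (\<integral>\<^sup>+y. ennreal (if real n < 1 / norm (a - y) then (1 / norm (a - y)) powr p else 0) \<partial>lborel)"
  proof (intro nn_integral_cong)
    fix y
    show "ennreal (if real n < 1 / norm (y - a) then (1 / norm (y - a)) ^ p else 0)
        = ennreal (if real n < 1 / norm (a - y) then (1 / norm (a - y)) powr p else 0)"
    proof (cases "y = a")
      case False
      then show ?thesis by (simp add: powr_realpow norm_minus_commute)
    qed simp
  qed
  also have "\<dots> \<le> ennreal (weak_high_const unit_vol p * real n powr (real p - 3))"
    using assms by (intro newton.k_high) auto
  also have "\<dots> \<le> ennreal (weak_high_const unit_vol p / n)"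
  proof (rule ennreal_leI)
    have "real n powr (real p - 3) \<le> real n powr (- 1)" using assms by (intro powr_mono) auto
    also have "\<dots> = 1 / n" using assms by (simp add: powr_minus_divide)
    finally show "weak_high_const unit_vol p * real n powr (real p - 3) \<le> weak_high_const unit_vol p / n"
      using h mult_left_mono by fastforce
  qed
  finally show ?thesis .
qed

lemma decaying_integrable:
  fixes G :: "real ^ 3 \<Rightarrow> 'b::euclidean_space"
  assumes [measurable]: "G \<in> borel_measurable lborel"
    and bd: "AE y in lborel. norm (G y) \<le> C * (1 + sqdist 0 y) powr - 2"
  shows "integrable lborel G"
proof (rule Bochner_Integration.integrable_bound)
  have "integrable lborel (\<lambda>y. (1 + sqdist 0 y) powr - 2)"
    using weight_finite[of 2 0] by (intro integrableI_nonneg) auto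
  then show "integrable lborel (\<lambda>y. C * (1 + sqdist 0 y) powr - 2)" by (rule integrable_mult_right)
  show "AE y in lborel. norm (G y) \<le> norm (C * (1 + sqdist 0 y) powr - 2)"
    using bd by eventually_elim auto
qed measurable

text \<open>Near the singularity G is bounded by C and the kernel is integrable; elsewhere the
  kernel is at most 1 and G is integrable.\<close>

lemma bounded_potential_integrable:
  fixes G :: "real ^ 3 \<Rightarrow> 'b::euclidean_space" and p :: nat
  assumes N [measurable]: "N \<in> borel_measurable borel" "\<And>z. \<bar>N z\<bar> \<le> norm z ^ (3 - p)" and p: "p \<in> {1, 2}"
    and [measurable]: "G \<in> borel_measurable lborel"
    and bd: "AE y in lborel. norm (G y) \<le> C * (1 + sqdist 0 y) powr - 2" and C: "C \<ge> 0"
  shows "integrable lborel (\<lambda>y. (N (y - a) / norm (y - a) ^ 3) *\<^sub>R G y)"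
proof (rule Bochner_Integration.integrable_bound)
  let ?k = "\<lambda>y. if real 1 < 1 / norm (y - a) then (1 / norm (y - a)) ^ p else 0"
  have "(\<integral>\<^sup>+y. ennreal (?k y) \<partial>lborel) < \<infinity>"
    using nn_integral_near[OF p, of 1 a] by (simp add: le_less_trans)
  then have "integrable lborel ?k" by (intro integrableI_nonneg) auto
  then have i: "integrable lborel (\<lambda>y. C * ?k y)" by (rule integrable_mult_right)
  have g: "integrable lborel (\<lambda>y. norm (G y))"
    by (intro integrable_norm decaying_integrable[OF _ bd]) measurable
  show "integrable lborel (\<lambda>y. norm (G y) + C * ?k y)"
    by (intro Bochner_Integration.integrable_add i g)
  show "AE y in lborel. norm ((N (y - a) / norm (y - a) ^ 3) *\<^sub>R G y) \<le> norm (norm (G y) + C * ?k y)"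
    using bd
  proof eventually_elim
    case (elim y)
    have "C * (1 + sqdist 0 y) powr - 2 \<le> C * 1"
    proof (intro mult_left_mono C)
      have "(1 + sqdist 0 y) powr - 2 \<le> (1 + sqdist 0 y) powr 0" by (intro powr_mono) auto
      also have "\<dots> \<le> 1" by (simp add: powr_def)
      finally show "(1 + sqdist 0 y) powr - 2 \<le> 1" .
    qed
    then have GC: "norm (G y) \<le> C" using elim by simp
    have "\<bar>N (y - a) / norm (y - a) ^ 3\<bar> \<le> (1 / norm (y - a)) ^ p"
      using N(2) p by (intro potential_kernel_bound) auto
    then have "norm ((N (y - a) / norm (y - a) ^ 3) *\<^sub>R G y) \<le> (1 / norm (y - a)) ^ p * norm (G y)"
      unfolding norm_scaleR by (intro mult_right_mono) auto
    also have "\<dots> \<le> norm (G y) + C * ?k y"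
    proof (cases "1 < 1 / norm (y - a)")
      case True
      then have "(1 / norm (y - a)) ^ p * norm (G y) \<le> (1 / norm (y - a)) ^ p * C"
        using GC by (intro mult_left_mono) auto
      then show ?thesis using True by (simp add: mult.commute add_increasing)
    next
      case False
      then have "(1 / norm (y - a)) ^ p \<le> 1" by (intro power_le_one) auto
      then have "(1 / norm (y - a)) ^ p * norm (G y) \<le> 1 * norm (G y)" by (intro mult_right_mono) auto
      then show ?thesis using False by simp
    qed
    finally show ?case by simp
  qed
qed measurable

text \<open>Potentials with truncated kernels are continuous by dominated convergence. They
  approximate the potential uniformly in a, since the error involves only the ball of radius 1/(n +
  1) about a, where G is bounded by C.\<close>

lemma potential_continuous:
  fixes G :: "real ^ 3 \<Rightarrow> 'b::euclidean_space" and p :: nat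
  assumes cont: "continuous_on UNIV N" and N: "\<And>z. \<bar>N z\<bar> \<le> norm z ^ (3 - p)" and p: "p \<in> {1, 2}"
    and [measurable]: "G \<in> borel_measurable lborel"
    and bd: "AE y in lborel. norm (G y) \<le> C * (1 + sqdist 0 y) powr - 2" and C: "C \<ge> 0"
  shows "continuous_on UNIV (\<lambda>a. \<integral>y. (N (y - a) / norm (y - a) ^ 3) *\<^sub>R G y \<partial>lborel)"
proof -
  have [measurable]: "N \<in> borel_measurable borel" by (intro borel_measurable_continuous_onI cont)
  define T where "T n z = N z / max (norm z) (1 / real (Suc n)) ^ 3" for n z
  have T_cont: "continuous_on UNIV (T n)" for n
  proof -
    have "max (norm z) (1 / real (Suc n)) > 0" for z :: "real ^ 3" by (simp add: less_max_iff_disj)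
    then have "max (norm z) (1 / real (Suc n)) ^ 3 \<noteq> 0" for z :: "real ^ 3" by (metis less_irrefl zero_less_power)
    then show ?thesis unfolding T_def by (intro continuous_intros cont) auto
  qed
  have [measurable]: "T n \<in> borel_measurable borel" for n by (intro borel_measurable_continuous_onI T_cont)
  have T_bound: "\<bar>T n z\<bar> \<le> real (Suc n) ^ p" for n z
    unfolding T_def by (intro truncated_kernel_bounds(1) N p) simp
  have G_int: "integrable lborel G" by (rule decaying_integrable[OF _ bd]) measurable
  define F where "F n a = (\<integral>y. T n (y - a) *\<^sub>R G y \<partial>lborel)" for n a
  have w: "integrable lborel (\<lambda>y. real (Suc n) ^ p * norm (G y))" for n
    by (intro integrable_mult_right integrable_norm G_int)
  have dom: "AE y in lborel. norm (T n (y - a) *\<^sub>R G y) \<le> real (Suc n) ^ p * norm (G y)" for n a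
    by (intro AE_I2) (simp add: mult_right_mono T_bound del: of_nat_Suc)
  have F_cont: "continuous_on UNIV (F n)" for n
    unfolding continuous_on_sequentially
  proof (intro allI ballI impI)
    fix x and a assume *: "(\<forall>m. x m \<in> (UNIV :: (real ^ 3) set)) \<and> x \<longlonglongrightarrow> a"
    have "AE y in lborel. (\<lambda>m. T n (y - x m) *\<^sub>R G y) \<longlonglongrightarrow> T n (y - a) *\<^sub>R G y"
    proof (rule AE_I2)
      fix y
      have "(\<lambda>m. y - x m) \<longlonglongrightarrow> y - a" using * by (intro tendsto_intros) auto
      then have "(\<lambda>m. T n (y - x m)) \<longlonglongrightarrow> T n (y - a)"
        using T_cont[of n] by (auto simp: continuous_on_eq_continuous_at intro: isCont_tendsto_compose)
      then show "(\<lambda>m. T n (y - x m) *\<^sub>R G y) \<longlonglongrightarrow> T n (y - a) *\<^sub>R G y" by (intro tendsto_intros)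
    qed
    then show "(F n \<circ> x) \<longlonglongrightarrow> F n a"
      unfolding F_def comp_def by (intro integral_dominated_convergence[OF _ _ w _ dom]) measurable
  qed
  let ?U = "\<lambda>a. \<integral>y. (N (y - a) / norm (y - a) ^ 3) *\<^sub>R G y \<partial>lborel"
  define D where "D = 2 * C * weak_high_const unit_vol p"
  have close: "norm (?U a - F n a) \<le> D / real (Suc n)" for n a
  proof -
    let ?k = "\<lambda>y. if real (Suc n) < 1 / norm (y - a) then (1 / norm (y - a)) ^ p else 0"
    have h: "weak_high_const unit_vol p \<ge> 0" using p by (intro weak_high_const_nonneg) auto
    have iU: "integrable lborel (\<lambda>y. (N (y - a) / norm (y - a) ^ 3) *\<^sub>R G y)"
      by (rule bounded_potential_integrable[OF _ N p _ bd C]) measurable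
    have iF: "integrable lborel (\<lambda>y. T n (y - a) *\<^sub>R G y)"
      by (rule Bochner_Integration.integrable_bound[OF w[of n]]) (use dom in \<open>auto simp del: of_nat_Suc\<close>)
    have e: "?U a - F n a = (\<integral>y. (N (y - a) / norm (y - a) ^ 3 - T n (y - a)) *\<^sub>R G y \<partial>lborel)"
      unfolding F_def using iU iF by (simp add: scaleR_diff_left)
    have i: "integrable lborel (\<lambda>y. (N (y - a) / norm (y - a) ^ 3 - T n (y - a)) *\<^sub>R G y)"
      using Bochner_Integration.integrable_diff[OF iU iF] by (simp add: scaleR_diff_left)
    have "ennreal (norm (?U a - F n a))
        \<le> (\<integral>\<^sup>+y. norm ((N (y - a) / norm (y - a) ^ 3 - T n (y - a)) *\<^sub>R G y) \<partial>lborel)"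
      unfolding e by (rule integral_norm_bound_ennreal[OF i])
    also have "\<dots> \<le> (\<integral>\<^sup>+y. ennreal (2 * C) * ennreal (?k y) \<partial>lborel)"
    proof (rule nn_integral_mono_AE)
      show "AE y in lborel. ennreal (norm ((N (y - a) / norm (y - a) ^ 3 - T n (y - a)) *\<^sub>R G y)) \<le> ennreal (2 * C) * ennreal (?k y)"
        using bd
      proof eventually_elim
        case (elim y)
        have "(1 + sqdist 0 y) powr - 2 \<le> (1 + sqdist 0 y) powr 0" by (intro powr_mono) auto
        also have "\<dots> \<le> 1" by (simp add: powr_def)
        finally have "C * (1 + sqdist 0 y) powr - 2 \<le> C * 1" by (intro mult_left_mono C)
        then have GC: "norm (G y) \<le> C" using elim by simp
        have "\<bar>N (y - a) / norm (y - a) ^ 3 - T n (y - a)\<bar> \<le> 2 * ?k y"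
          unfolding T_def by (intro truncated_kernel_bounds(2) N p) simp
        then have "norm ((N (y - a) / norm (y - a) ^ 3 - T n (y - a)) *\<^sub>R G y) \<le> (2 * ?k y) * C"
          unfolding norm_scaleR by (intro mult_mono GC) auto
        then have "ennreal (norm ((N (y - a) / norm (y - a) ^ 3 - T n (y - a)) *\<^sub>R G y)) \<le> ennreal ((2 * C) * ?k y)"
          by (intro ennreal_leI) (simp add: mult_ac)
        also have "\<dots> = ennreal (2 * C) * ennreal (?k y)" using C by (intro ennreal_mult) auto
        finally show ?case .
      qed
    qed
    also have "\<dots> = ennreal (2 * C) * (\<integral>\<^sup>+y. ennreal (?k y) \<partial>lborel)"
      by (rule nn_integral_cmult) measurable
    also have "\<dots> \<le> ennreal (2 * C) * ennreal (weak_high_const unit_vol p / real (Suc n))"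
      by (intro mult_left_mono nn_integral_near p) auto
    also have "\<dots> = ennreal (D / real (Suc n))"
      using C h by (subst ennreal_mult[symmetric]) (auto simp: D_def)
    finally show ?thesis using C h by (subst (asm) ennreal_le_iff) (auto simp: D_def)
  qed
  have "(\<lambda>n. D / real (Suc n)) \<longlonglongrightarrow> 0"
    using tendsto_mult_right_zero[OF LIMSEQ_inverse_real_of_nat, of D] by (simp add: divide_inverse)
  have "uniform_limit UNIV F ?U sequentially"
  proof (rule uniform_limitI)
    fix e :: real assume "e > 0"
    with \<open>(\<lambda>n. D / real (Suc n)) \<longlonglongrightarrow> 0\<close> have "\<forall>\<^sub>F n in sequentially. D / real (Suc n) < e"
      by (rule order_tendstoD)
    then show "\<forall>\<^sub>F n in sequentially. \<forall>x\<in>UNIV. dist (F n x) (?U x) < e"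
      by eventually_elim (use close in \<open>auto simp: dist_norm norm_minus_commute intro: le_less_trans simp del: of_nat_Suc\<close>)
  qed
  then show ?thesis
    by (rule uniform_limit_theorem[rotated]) (auto intro: always_eventually F_cont)
qed

text \<open>The set on which the bound fails is open and null, hence empty.\<close>

lemma AE_le_continuous:
  fixes f :: "real ^ 3 \<Rightarrow> real"
  assumes cont: "continuous_on UNIV f" and ae: "AE x in lborel. f x \<le> C"
  shows "f x \<le> C"
proof -
  have op: "open {x. C < f x}"
    by (intro open_Collect_less cont continuous_intros)
  have "{x. C < f x} = {}"
  proof (rule ccontr)
    assume "{x. C < f x} \<noteq> {}"
    then have "\<not> negligible {x. C < f x}" using open_not_negligible[OF op] by simp
    moreover have "{x. C < f x} \<in> null_sets lborel"
      using ae op by (subst AE_iff_null_sets) (auto simp: not_less)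
    ultimately show False
      by (simp add: negligible_iff_null_sets null_sets_completionI)
  qed
  then show ?thesis by (metis (mono_tags, lifting) empty_iff mem_Collect_eq not_less)
qed

text \<open>Split at |x - y| = |x| / 2. In the ball around x the weight is at most 16 / |x|^4 and
  the kernel has an integral of order |x|^2; outside the kernel is at most 2 / |x| and the weight is
  integrable.\<close>

lemma newton_potential_decay:
  "\<exists>B\<ge>0. \<forall>x. norm x \<ge> 1 \<longrightarrow>
    (\<integral>\<^sup>+y. ennreal ((1 + sqdist 0 y) powr - 2 * (1 / norm (y - x))) \<partial>lborel) \<le> ennreal (B / norm x)"
proof -
  define W where "W = enn2real (\<integral>\<^sup>+y. ennreal ((1 + sqdist (0 :: real ^ 3) y) powr - 2) \<partial>lborel)"
  have W: "(\<integral>\<^sup>+y. ennreal ((1 + sqdist (0 :: real ^ 3) y) powr - 2) \<partial>lborel) = ennreal W" "W \<ge> 0"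
    using weight_finite[of 2 0] by (auto simp: W_def)
  define H where "H = weak_high_const unit_vol 1"
  have H: "H \<ge> 0" unfolding H_def by (intro weak_high_const_nonneg) auto
  have "(\<integral>\<^sup>+y. ennreal ((1 + sqdist 0 y) powr - 2 * (1 / norm (y - x))) \<partial>lborel) \<le> ennreal ((4 * H + 2 * W) / norm x)"
    if x: "norm x \<ge> 1" for x :: "real ^ 3"
  proof -
    let ?k = "\<lambda>y. if 2 / norm x < 1 / norm (x - y) then (1 / norm (x - y)) powr 1 else 0"
    let ?w = "\<lambda>y. (1 + sqdist 0 y) powr - 2"
    have x0: "norm x > 0" using x by linarith
    have "(\<integral>\<^sup>+y. ennreal (?w y * (1 / norm (y - x))) \<partial>lborel)
        \<le> (\<integral>\<^sup>+y. ennreal (16 / norm x ^ 4) * ennreal (?k y) + ennreal (2 / norm x) * ennreal (?w y) \<partial>lborel)"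
    proof (intro nn_integral_mono)
      fix y
      have "?w y * (1 / norm (y - x)) \<le> 16 / norm x ^ 4 * ?k y + 2 / norm x * ?w y"
      proof (cases "2 / norm x < 1 / norm (x - y)")
        case True
        have d: "norm (x - y) > 0" using True x0 by (cases "norm (x - y) = 0") auto
        then have "norm (x - y) < norm x / 2" using True x0 by (simp add: field_simps)
        then have y: "norm x / 2 \<le> norm y" using norm_triangle_ineq2[of x y] by linarith
        have "(norm x / 2) ^ 2 \<le> (norm y)\<^sup>2" by (rule power_mono[OF y]) simp
        then have "(norm x / 2) ^ 2 \<le> 1 + sqdist 0 y" unfolding sqdist_def diff_zero by linarith
        then have "?w y \<le> ((norm x / 2) ^ 2) powr - 2" using x0 by (intro powr_mono2') auto
        also have "\<dots> = 16 / norm x ^ 4"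
          using x0 by (simp add: powr_minus_divide power_divide flip: power_mult)
        finally have "?w y * (1 / norm (x - y)) \<le> 16 / norm x ^ 4 * (1 / norm (x - y))"
          by (intro mult_right_mono) auto
        moreover have "0 \<le> 2 / norm x * ?w y" by simp
        moreover have k: "?k y = 1 / norm (x - y)" using True d by simp
        ultimately show ?thesis unfolding k norm_minus_commute[of y x] by linarith
      next
        case False
        then have "?w y * (1 / norm (x - y)) \<le> ?w y * (2 / norm x)" by (intro mult_left_mono) auto
        then show ?thesis using False by (simp add: norm_minus_commute mult.commute)
      qed
      then have "ennreal (?w y * (1 / norm (y - x))) \<le> ennreal (16 / norm x ^ 4 * ?k y + 2 / norm x * ?w y)"
        by (rule ennreal_leI)
      also have "\<dots> = ennreal (16 / norm x ^ 4) * ennreal (?k y) + ennreal (2 / norm x) * ennreal (?w y)"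
        by (subst (1 2) ennreal_mult[symmetric]) (auto intro!: ennreal_plus)
      finally show "ennreal (?w y * (1 / norm (y - x)))
          \<le> ennreal (16 / norm x ^ 4) * ennreal (?k y) + ennreal (2 / norm x) * ennreal (?w y)" .
    qed
    also have "\<dots> = ennreal (16 / norm x ^ 4) * (\<integral>\<^sup>+y. ennreal (?k y) \<partial>lborel) + ennreal (2 / norm x) * ennreal W"
      unfolding W(1)[symmetric] by (subst nn_integral_add) (simp_all add: nn_integral_cmult)
    also have "\<dots> \<le> ennreal (16 / norm x ^ 4) * ennreal (H * (2 / norm x) powr (1 - 3)) + ennreal (2 / norm x) * ennreal W"
      unfolding H_def using x0 by (intro add_right_mono mult_left_mono newton.k_high) auto
    also have "\<dots> = ennreal (16 / norm x ^ 4 * (H * (2 / norm x) powr (1 - 3)) + 2 / norm x * W)"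
      using H W(2) by (subst (1 2) ennreal_mult[symmetric]) (auto intro!: ennreal_plus[symmetric])
    also have "\<dots> \<le> ennreal ((4 * H + 2 * W) / norm x)"
    proof (rule ennreal_leI)
      have "(2 / norm x) powr (1 - 3) = (norm x)\<^sup>2 / 4"
        using x0 by (simp add: powr_minus_divide power_divide)
      then have "16 / norm x ^ 4 * (H * (2 / norm x) powr (1 - 3)) = 4 * H / (norm x)\<^sup>2"
        using x0 by (simp add: field_simps eval_nat_numeral)
      also have "\<dots> \<le> 4 * H / norm x"
      proof (intro divide_left_mono)
        show "norm x \<le> (norm x)\<^sup>2" using power_increasing[of 1 2 "norm x"] x by simp
      qed (use H x0 in auto)
      finally show "16 / norm x ^ 4 * (H * (2 / norm x) powr (1 - 3)) + 2 / norm x * W \<le> (4 * H + 2 * W) / norm x"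
        by (simp add: add_divide_distrib)
    qed
    finally show ?thesis .
  qed
  moreover have "4 * H + 2 * W \<ge> 0" using H W by simp
  ultimately show ?thesis by blast
qed

text \<open>Since |x| and |y - x| differ by at most |y|, replacing |x| / |y - x| by 1 costs at most
  the potential of |y| |g(y)|. By the second decay hypothesis this potential is of order 1 /
  |x|.\<close>

lemma newton_potential_limit:
  fixes g :: "real ^ 3 \<Rightarrow> real"
  assumes [measurable]: "g \<in> borel_measurable lborel"
    and bd: "AE y in lborel. norm (g y) \<le> C * (1 + sqdist 0 y) powr - 2"
    and bd': "AE y in lborel. norm y * norm (g y) \<le> C * (1 + sqdist 0 y) powr - 2" and C: "C \<ge> 0"
  shows "((\<lambda>x. norm x * (\<integral>y. (1 / norm (y - x)) *\<^sub>R g y \<partial>lborel)) \<longlongrightarrow> (\<integral>y. g y \<partial>lborel)) at_infinity"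
proof -
  obtain B where B: "B \<ge> 0" "\<And>x. norm x \<ge> 1 \<Longrightarrow>
    (\<integral>\<^sup>+y. ennreal ((1 + sqdist 0 y) powr - 2 * (1 / norm (y - x))) \<partial>lborel) \<le> ennreal (B / norm x)"
    using newton_potential_decay by blast
  have g_int: "integrable lborel g" by (rule decaying_integrable[OF _ bd]) measurable
  have k: "1 / norm z = (norm z)\<^sup>2 / norm z ^ 3" for z :: "real ^ 3"
    by (simp add: eval_nat_numeral)
  have p_int: "integrable lborel (\<lambda>y. (1 / norm (y - x)) *\<^sub>R g y)" for x
    unfolding k by (rule bounded_potential_integrable[where p = 1, OF _ _ _ _ bd C]) auto
  have close: "\<bar>norm x * (\<integral>y. (1 / norm (y - x)) *\<^sub>R g y \<partial>lborel) - (\<integral>y. g y \<partial>lborel)\<bar> \<le> C * B / norm x"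
    if x: "norm x \<ge> 1" for x
  proof -
    have e: "norm x * (\<integral>y. (1 / norm (y - x)) *\<^sub>R g y \<partial>lborel) - (\<integral>y. g y \<partial>lborel)
        = (\<integral>y. norm x *\<^sub>R ((1 / norm (y - x)) *\<^sub>R g y) - g y \<partial>lborel)"
    proof -
      have "(\<integral>y. norm x *\<^sub>R ((1 / norm (y - x)) *\<^sub>R g y) - g y \<partial>lborel)
          = (\<integral>y. norm x *\<^sub>R ((1 / norm (y - x)) *\<^sub>R g y) \<partial>lborel) - (\<integral>y. g y \<partial>lborel)"
        by (rule Bochner_Integration.integral_diff[OF integrable_scaleR_right[OF p_int] g_int])
      moreover have "(\<integral>y. norm x *\<^sub>R ((1 / norm (y - x)) *\<^sub>R g y) \<partial>lborel)
          = norm x *\<^sub>R (\<integral>y. (1 / norm (y - x)) *\<^sub>R g y \<partial>lborel)"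
        by (rule integral_scaleR_right)
      ultimately show ?thesis by (simp only: real_scaleR_def)
    qed
    have i: "integrable lborel (\<lambda>y. norm x *\<^sub>R ((1 / norm (y - x)) *\<^sub>R g y) - g y)"
      by (intro Bochner_Integration.integrable_diff integrable_scaleR_right p_int g_int)
    have "ennreal \<bar>norm x * (\<integral>y. (1 / norm (y - x)) *\<^sub>R g y \<partial>lborel) - (\<integral>y. g y \<partial>lborel)\<bar>
        \<le> (\<integral>\<^sup>+y. norm (norm x *\<^sub>R ((1 / norm (y - x)) *\<^sub>R g y) - g y) \<partial>lborel)"
      unfolding e real_norm_def[symmetric] by (rule integral_norm_bound_ennreal[OF i])
    also have "\<dots> \<le> (\<integral>\<^sup>+y. ennreal C * ennreal ((1 + sqdist 0 y) powr - 2 * (1 / norm (y - x))) \<partial>lborel)"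
    proof (rule nn_integral_mono_AE)
      show "AE y in lborel. ennreal (norm (norm x *\<^sub>R ((1 / norm (y - x)) *\<^sub>R g y) - g y))
          \<le> ennreal C * ennreal ((1 + sqdist 0 y) powr - 2 * (1 / norm (y - x)))"
        using bd' AE_lborel_singleton[of x]
      proof eventually_elim
        case (elim y)
        then have d: "norm (y - x) > 0" by simp
        have "norm x *\<^sub>R ((1 / norm (y - x)) *\<^sub>R g y) - g y = (norm x - norm (y - x)) / norm (y - x) * g y"
          using d by (simp add: field_simps)
        then have "norm (norm x *\<^sub>R ((1 / norm (y - x)) *\<^sub>R g y) - g y) = \<bar>norm x - norm (y - x)\<bar> * (norm (g y) / norm (y - x))"
          using d by (simp add: abs_mult)
        also have "\<dots> \<le> norm y * (norm (g y) / norm (y - x))"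
        proof (intro mult_right_mono)
          show "\<bar>norm x - norm (y - x)\<bar> \<le> norm y"
            using norm_triangle_ineq3[of x "x - y"] by (simp add: norm_minus_commute)
        qed auto
        also have "\<dots> = (norm y * norm (g y)) * (1 / norm (y - x))" by simp
        also have "\<dots> \<le> (C * (1 + sqdist 0 y) powr - 2) * (1 / norm (y - x))"
          by (intro mult_right_mono elim) auto
        finally have "ennreal (norm (norm x *\<^sub>R ((1 / norm (y - x)) *\<^sub>R g y) - g y))
            \<le> ennreal (C * ((1 + sqdist 0 y) powr - 2 * (1 / norm (y - x))))"
          by (intro ennreal_leI) (simp add: mult.assoc)
        also have "\<dots> = ennreal C * ennreal ((1 + sqdist 0 y) powr - 2 * (1 / norm (y - x)))"
          using C by (intro ennreal_mult) auto
        finally show ?case .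
      qed
    qed
    also have "\<dots> = ennreal C * (\<integral>\<^sup>+y. ennreal ((1 + sqdist 0 y) powr - 2 * (1 / norm (y - x))) \<partial>lborel)"
      by (rule nn_integral_cmult) measurable
    also have "\<dots> \<le> ennreal C * ennreal (B / norm x)" by (intro mult_left_mono B x) auto
    also have "\<dots> = ennreal (C * B / norm x)" using C B by (subst ennreal_mult[symmetric]) auto
    finally show ?thesis using C B by (subst (asm) ennreal_le_iff) auto
  qed
  have "((\<lambda>x :: real ^ 3. C * B * inverse (norm x)) \<longlongrightarrow> C * B * 0) at_infinity"
    by (intro tendsto_mult tendsto_const tendsto_inverse_0_at_top filterlim_norm_at_top)
  then have lim: "((\<lambda>x :: real ^ 3. C * B / norm x) \<longlongrightarrow> 0) at_infinity" by (simp add: divide_inverse)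
  have "((\<lambda>x. norm x * (\<integral>y. (1 / norm (y - x)) *\<^sub>R g y \<partial>lborel) - (\<integral>y. g y \<partial>lborel)) \<longlongrightarrow> 0) at_infinity"
  proof (rule Lim_null_comparison[OF _ lim])
    show "\<forall>\<^sub>F x in at_infinity. norm (norm x * (\<integral>y. (1 / norm (y - x)) *\<^sub>R g y \<partial>lborel) - (\<integral>y. g y \<partial>lborel)) \<le> C * B / norm x"
      unfolding eventually_at_infinity using close by (intro exI[of _ 1]) auto
  qed
  then show ?thesis by (simp add: LIM_zero_iff)
qed

subsection \<open>Borel representatives and the Dirac matrices\<close>

text \<open>The Fubini arguments live on products of lborel, so Lebesgue measurable functions are
  replaced by Borel ones; the scalar statement is applied to each coordinate.\<close>

lemma borel_representative:
  fixes f :: "real ^ 3 \<Rightarrow> 'b::euclidean_space"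
  assumes f: "f \<in> borel_measurable lebesgue"
  shows "\<exists>f'. f' \<in> borel_measurable borel \<and> (AE x in lborel. f x = f' x)"
proof -
  have "\<forall>b. \<exists>g. g \<in> borel_measurable lborel \<and> (AE x in lborel. f x \<bullet> b = g x)"
  proof
    fix b
    have "(\<lambda>x. f x \<bullet> b) \<in> borel_measurable lebesgue" using f by measurable
    then show "\<exists>g. g \<in> borel_measurable lborel \<and> (AE x in lborel. f x \<bullet> b = g x)"
      using completion_ex_borel_measurable_real by blast
  qed
  then obtain G where G [measurable]: "\<And>b. G b \<in> borel_measurable lborel" and ae: "\<And>b. AE x in lborel. f x \<bullet> b = G b x"
    by metis
  have "AE x in lborel. \<forall>b\<in>Basis. f x \<bullet> b = G b x" by (intro AE_finite_allI ae) auto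
  then have "AE x in lborel. f x = (\<Sum>b\<in>Basis. G b x *\<^sub>R b)"
  proof eventually_elim
    case (elim x)
    then have "(\<Sum>b\<in>Basis. G b x *\<^sub>R b) = (\<Sum>b\<in>Basis. (f x \<bullet> b) *\<^sub>R b)" by (intro sum.cong) auto
    then show ?case by (simp add: euclidean_representation)
  qed
  moreover have "(\<lambda>x. \<Sum>b\<in>Basis. G b x *\<^sub>R b) \<in> borel_measurable lborel" by measurable
  ultimately show ?thesis by (intro exI[of _ "\<lambda>x. \<Sum>b\<in>Basis. G b x *\<^sub>R b"]) auto
qed

lemma AE_lebesgueI: "AE x in lborel. P x \<Longrightarrow> AE x in lebesgue. P x"
  by (rule AE_completion)

lemma Lp_function_representative:
  fixes u v :: "real ^ 3 \<Rightarrow> 'b::euclidean_space"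
  assumes "Lp_function p u" "AE x in lborel. u x = v x" "v \<in> borel_measurable borel"
  shows "(\<integral>\<^sup>+x. ennreal (norm (v x) ^ p) \<partial>lborel) < \<infinity>"
proof -
  have "(\<integral>\<^sup>+x. ennreal (norm (v x) ^ p) \<partial>lborel) = (\<integral>\<^sup>+x. ennreal (norm (v x) ^ p) \<partial>lebesgue)"
    by (simp add: nn_integral_completion)
  also have "\<dots> = (\<integral>\<^sup>+x. ennreal (norm (norm (u x) ^ p)) \<partial>lebesgue)"
    using AE_lebesgueI[OF assms(2)] by (intro nn_integral_cong_AE) (auto elim!: eventually_mono)
  also have "\<dots> < \<infinity>" using assms(1) by (simp add: Lp_function_def integrable_iff_bounded)
  finally show ?thesis .
qed

lemma smooth_measurable: "smooth \<phi> \<Longrightarrow> foldr partial js \<phi> \<in> borel_measurable borel"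
  unfolding smooth_def by (intro borel_measurable_continuous_onI differentiable_imp_continuous_on) auto

lemma test_function_measurable:
  assumes "test_function \<phi>"
  shows "\<phi> \<in> borel_measurable borel" "partial j \<phi> \<in> borel_measurable borel"
    "partial i (partial j \<phi>) \<in> borel_measurable borel"
  using assms smooth_measurable[of \<phi> "[]"] smooth_measurable[of \<phi> "[j]"] smooth_measurable[of \<phi> "[i, j]"]
  by (auto simp: test_function_def)

lemma regular_distr_lborel:
  fixes f f' :: "real ^ 3 \<Rightarrow> 'b::euclidean_space"
  assumes [measurable]: "\<phi> \<in> borel_measurable borel" "f' \<in> borel_measurable borel"
    and f: "f \<in> borel_measurable lebesgue" and ae: "AE x in lborel. f x = f' x"
  shows "regular_distr f \<phi> = (\<integral>x. \<phi> x *\<^sub>R f' x \<partial>lborel)"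
proof -
  have \<phi>: "\<phi> \<in> borel_measurable lebesgue" by (simp add: measurable_completion)
  have f': "f' \<in> borel_measurable lebesgue" by (simp add: measurable_completion)
  have "regular_distr f \<phi> = (\<integral>x. \<phi> x *\<^sub>R f' x \<partial>lebesgue)"
    unfolding regular_distr_def
    by (rule integral_cong_AE)
      (use AE_lebesgueI[OF ae] in \<open>auto intro!: borel_measurable_scaleR \<phi> f f' elim!: eventually_mono\<close>)
  also have "\<dots> = (\<integral>x. \<phi> x *\<^sub>R f' x \<partial>lborel)" by (rule integral_completion) measurable
  finally show ?thesis .
qed

lemma vector_4:
  "(vector [a, b, c, d] :: 'a::zero ^ 4) $ 1 = a" "(vector [a, b, c, d] :: 'a ^ 4) $ 2 = b"
  "(vector [a, b, c, d] :: 'a ^ 4) $ 3 = c" "(vector [a, b, c, d] :: 'a ^ 4) $ 4 = d"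
  unfolding vector_def by simp_all

lemma dirac_alpha_mult:
  "(dirac_alpha S *v v) $ 1 = S $ 1 $ 1 * v $ 3 + S $ 1 $ 2 * v $ 4"
  "(dirac_alpha S *v v) $ 2 = S $ 2 $ 1 * v $ 3 + S $ 2 $ 2 * v $ 4"
  "(dirac_alpha S *v v) $ 3 = S $ 1 $ 1 * v $ 1 + S $ 1 $ 2 * v $ 2"
  "(dirac_alpha S *v v) $ 4 = S $ 2 $ 1 * v $ 1 + S $ 2 $ 2 * v $ 2"
  by (simp_all add: dirac_alpha_def matrix_vector_mult_def sum_4 vector_4)

lemma dirac_alpha_bounded_linear: "bounded_linear (\<lambda>v. dirac_alpha S *v v)"
  unfolding linear_conv_bounded_linear[symmetric]
  by (rule linearI)
    (simp_all add: vec_eq_iff matrix_vector_mult_def scaleR_sum_right distrib_left sum.distrib)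

lemma imaginary_unit_bounded_linear: "bounded_linear (\<lambda>v :: complex ^ 4. \<i> *s v)"
  unfolding linear_conv_bounded_linear[symmetric]
  by (rule linearI) (simp_all add: vec_eq_iff vector_scalar_mult_def algebra_simps)

text \<open>A product of two of the off-diagonal block matrices acts on each half of v as the
  product of the corresponding 2 by 2 matrices, so the Pauli relations apply to the halves
  separately.\<close>

lemma dirac_alpha_anticommute:
  assumes "pauli_family \<sigma>"
  shows "dirac_alpha (\<sigma> j) *v (dirac_alpha (\<sigma> k) *v v) + dirac_alpha (\<sigma> k) *v (dirac_alpha (\<sigma> j) *v v)
    = (if j = k then 2 else 0) *\<^sub>R v"
proof -
  let ?S = "\<sigma> j" and ?T = "\<sigma> k"
  let ?c = "if j = k then 2 else 0 :: complex"
  have "?S ** ?T + ?T ** ?S = mat ?c" using assms by (simp add: pauli_family_def)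
  then have "(?S ** ?T + ?T ** ?S) $ a $ b = (mat ?c :: complex ^ 2 ^ 2) $ a $ b" for a b by simp
  note e = this[unfolded mat_def matrix_matrix_mult_def, simplified sum_2 vector_add_component vec_lambda_beta]
  have e11: "?S $ 1 $ 1 * ?T $ 1 $ 1 + ?S $ 1 $ 2 * ?T $ 2 $ 1 + (?T $ 1 $ 1 * ?S $ 1 $ 1 + ?T $ 1 $ 2 * ?S $ 2 $ 1) = ?c"
    using e[of 1 1] by simp
  have e12: "?S $ 1 $ 1 * ?T $ 1 $ 2 + ?S $ 1 $ 2 * ?T $ 2 $ 2 + (?T $ 1 $ 1 * ?S $ 1 $ 2 + ?T $ 1 $ 2 * ?S $ 2 $ 2) = 0"
    using e[of 1 2] by simp
  have e21: "?S $ 2 $ 1 * ?T $ 1 $ 1 + ?S $ 2 $ 2 * ?T $ 2 $ 1 + (?T $ 2 $ 1 * ?S $ 1 $ 1 + ?T $ 2 $ 2 * ?S $ 2 $ 1) = 0"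
    using e[of 2 1] by simp
  have e22: "?S $ 2 $ 1 * ?T $ 1 $ 2 + ?S $ 2 $ 2 * ?T $ 2 $ 2 + (?T $ 2 $ 1 * ?S $ 1 $ 2 + ?T $ 2 $ 2 * ?S $ 2 $ 2) = ?c"
    using e[of 2 2] by simp
  have row: "s * (t1 * x + t2 * y) + s' * (t3 * x + t4 * y) + (r * (p1 * x + p2 * y) + r' * (p3 * x + p4 * y)) = c * x + d * y"
    if "s * t1 + s' * t3 + (r * p1 + r' * p3) = c" "s * t2 + s' * t4 + (r * p2 + r' * p4) = d"
    for s s' t1 t2 t3 t4 r r' p1 p2 p3 p4 x y c d :: complex
    unfolding that[symmetric] by (simp add: algebra_simps)
  have c: "((if j = k then 2 else 0 :: real) *\<^sub>R v) $ i = ?c * v $ i" for i by (simp add: scaleR_conv_of_real)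
  show ?thesis
    unfolding vec_eq_iff forall_4 vector_add_component c dirac_alpha_mult
    using row[OF e11 e12, of "v $ 1" "v $ 2"] row[OF e21 e22, of "v $ 1" "v $ 2"]
      row[OF e11 e12, of "v $ 3" "v $ 4"] row[OF e21 e22, of "v $ 3" "v $ 4"] by simp
qed

text \<open>For a function that is not integrable the left side is 0 by convention, so the estimate
  can be used before integrability is known.\<close>

lemma norm_integral_le_nn_integral:
  fixes f :: "'a \<Rightarrow> 'b::{banach, second_countable_topology}"
  shows "ennreal (norm (\<integral>x. f x \<partial>M)) \<le> (\<integral>\<^sup>+x. ennreal (norm (f x)) \<partial>M)"
  by (cases "integrable M f") (auto simp: integral_norm_bound_ennreal not_integrable_integral_eq)

text \<open>With q = 1 + |x|^2 all three bounds are B^3 / q^2. Two powers of f give 1/q^2 directly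
  and |x| v \<le> B absorbs the additional |x|; for v^2 f the inequality q \<le> (1 + |x|)^2 turns
  the decay of v into v^2 \<le> B^2 / q.\<close>

lemma decay_products:
  fixes x :: "real ^ 3" and v f B :: real
  assumes v: "0 \<le> v" "v * (1 + norm x) \<le> B" and f: "0 \<le> f" "f * (1 + (norm x)\<^sup>2) \<le> B"
  shows "f\<^sup>2 * v \<le> B ^ 3 * (1 + sqdist 0 x) powr - 2"
    and "norm x * (f\<^sup>2 * v) \<le> B ^ 3 * (1 + sqdist 0 x) powr - 2"
    and "v\<^sup>2 * f \<le> B ^ 3 * (1 + sqdist 0 x) powr - 2"
proof -
  define q where "q = 1 + (norm x)\<^sup>2"
  have q: "q > 0" by (simp add: q_def add_pos_nonneg)
  have w: "(1 + sqdist 0 x) powr - 2 = 1 / q\<^sup>2" using q by (simp add: sqdist_def q_def powr_minus_divide)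
  have "v \<le> v * (1 + norm x)" "norm x * v \<le> v * (1 + norm x)" using v(1) by (simp_all add: algebra_simps)
  then have vB: "v \<le> B" "norm x * v \<le> B" using v by linarith+
  then have B: "B \<ge> 0" using v by linarith
  have f2: "(f * q)\<^sup>2 \<le> B\<^sup>2" using f q unfolding q_def by (intro power_mono) auto
  have B3: "B\<^sup>2 * B = B ^ 3" by (simp add: eval_nat_numeral)
  have le: "a \<le> B ^ 3 * (1 + sqdist 0 x) powr - 2" if "b \<le> B\<^sup>2 * B" "a * q\<^sup>2 = b" for a b
    unfolding w using that q by (simp add: pos_le_divide_eq B3)
  have "(f * q)\<^sup>2 * v \<le> B\<^sup>2 * B" "(f * q)\<^sup>2 * (norm x * v) \<le> B\<^sup>2 * B"
    using f2 vB v B by (auto intro!: mult_mono)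
  from this[THEN le] show "f\<^sup>2 * v \<le> B ^ 3 * (1 + sqdist 0 x) powr - 2"
      "norm x * (f\<^sup>2 * v) \<le> B ^ 3 * (1 + sqdist 0 x) powr - 2"
    by (simp_all add: power_mult_distrib mult_ac)
  have "q \<le> (1 + norm x)\<^sup>2" by (simp add: q_def power2_eq_square algebra_simps)
  then have "v\<^sup>2 * q \<le> v\<^sup>2 * (1 + norm x)\<^sup>2" by (intro mult_left_mono) auto
  also have "\<dots> = (v * (1 + norm x))\<^sup>2" by (simp add: power_mult_distrib)
  also have "\<dots> \<le> B\<^sup>2" using v by (intro power_mono) auto
  finally have "(v\<^sup>2 * q) * (f * q) \<le> B\<^sup>2 * B"
    using f q unfolding q_def by (intro mult_mono) auto
  from le[OF this] show "v\<^sup>2 * f \<le> B ^ 3 * (1 + sqdist 0 x) powr - 2"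
    by (simp add: power2_eq_square mult_ac)
qed

text \<open>The representatives are the integrals on the right of the two integral equations, which
  have a value at every point. Estimates are proved almost everywhere for Borel versions of u and
  \<psi> and extend to all points by continuity of these integrals.\<close>

theorem corollary1p3:
  fixes \<sigma> :: "3 \<Rightarrow> complex ^ 2 ^ 2"
    and u :: "real ^ 3 \<Rightarrow> real"
    and \<psi> :: "real ^ 3 \<Rightarrow> complex ^ 4"
  assumes "pauli_family \<sigma>"
    and "Lp_function 6 u"
    and "Lp_function 3 \<psi>"
    and "distr_eq (\<lambda>\<phi>. - 6 * distr_laplacian (regular_distr u) \<phi>)
                  (regular_distr (\<lambda>x. (norm (\<psi> x))\<^sup>2 * u x))"
    and "distr_eq (distr_dirac \<sigma> (regular_distr \<psi>))
                  (regular_distr (\<lambda>x. \<bar>u x\<bar>\<^sup>2 *\<^sub>R \<psi> x))"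
  shows "\<exists>u' \<psi>'.
           continuous_on UNIV u' \<and> continuous_on UNIV \<psi>' \<and>
           (AE x in lebesgue. u' x = u x) \<and> (AE x in lebesgue. \<psi>' x = \<psi> x) \<and>
           (\<exists>C>0. \<forall>x. \<bar>u' x\<bar> \<le> C / (1 + norm x) \<and> norm (\<psi>' x) \<le> C / (1 + (norm x)\<^sup>2)) \<and>
           ((\<forall>x. 0 \<le> u' x) \<longrightarrow>
              (\<exists>\<alpha>\<ge>0. ((\<lambda>x. (1 + norm x) * u' x) \<longlongrightarrow> \<alpha>) at_infinity \<and>
                 (\<alpha> = 0 \<longrightarrow> (\<forall>x. u' x = 0) \<and> (\<forall>x. \<psi>' x = 0))))"
proof -
  have u_meas: "u \<in> borel_measurable lebesgue" and \<psi>_meas: "\<psi> \<in> borel_measurable lebesgue"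
    using assms(2,3) by (auto simp: Lp_function_def)
  obtain u0 where u0 [measurable]: "u0 \<in> borel_measurable borel" and u_ae: "AE x in lborel. u x = u0 x"
    using borel_representative[OF u_meas] by blast
  obtain \<psi>0 where \<psi>0 [measurable]: "\<psi>0 \<in> borel_measurable borel" and \<psi>_ae: "AE x in lborel. \<psi> x = \<psi>0 x"
    using borel_representative[OF \<psi>_meas] by blast
  define v where "v x = \<bar>u0 x\<bar>" for x
  define f where "f x = norm (\<psi>0 x)" for x
  \<comment> \<open>The factor 1/6 comes from c_3 = 6, so that minus the Laplacian of u is
    g.\<close>
  define g where "g x = (1 / 6) * ((norm (\<psi>0 x))\<^sup>2 * u0 x)" for x
  define h where "h x = \<bar>u0 x\<bar>\<^sup>2 *\<^sub>R \<psi>0 x" for x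
  have [measurable]: "v \<in> borel_measurable borel" "f \<in> borel_measurable borel"
      "g \<in> borel_measurable borel" "h \<in> borel_measurable borel"
    unfolding v_def f_def g_def h_def by measurable
  have vf0: "0 \<le> v x" "0 \<le> f x" for x by (simp_all add: v_def f_def)
  have u6: "(\<integral>\<^sup>+x. ennreal (norm (u0 x) ^ 6) \<partial>lborel) < \<infinity>"
    by (rule Lp_function_representative[OF assms(2) u_ae u0])
  then have v6: "(\<integral>\<^sup>+x. ennreal (v x ^ 6) \<partial>lborel) < \<infinity>" by (simp add: v_def)
  have \<psi>3: "(\<integral>\<^sup>+x. ennreal (norm (\<psi>0 x) ^ 3) \<partial>lborel) < \<infinity>"
    by (rule Lp_function_representative[OF assms(3) \<psi>_ae \<psi>0])
  then have f3: "(\<integral>\<^sup>+x. ennreal (f x ^ 3) \<partial>lborel) < \<infinity>" by (simp add: f_def)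
  have g_norm: "norm (g x) = (1 / 6) * ((f x)\<^sup>2 * v x)" for x by (simp add: g_def f_def v_def abs_mult)
  have h_norm: "norm (h x) = (v x)\<^sup>2 * f x" for x by (simp add: h_def f_def v_def)
  have g_le: "norm (g x) \<le> (f x)\<^sup>2 * v x" for x
  proof -
    have "0 \<le> (f x)\<^sup>2 * v x" using vf0 by simp
    then show ?thesis using g_norm[of x] by linarith
  qed
  have int_u: "integrable lborel (\<lambda>x. (1 + sqdist a x) powr (- 3 / 2) *\<^sub>R u0 x)" for a
    by (rule weight_L6[OF _ u6]) simp
  have int_\<psi>: "integrable lborel (\<lambda>x. (1 + sqdist a x) powr (- 3 / 2) *\<^sub>R \<psi>0 x)" for a
    by (rule weight_L3[OF _ \<psi>3]) simp
  have int_g: "integrable lborel (\<lambda>x. (1 + sqdist a x) powr (- 1 / 2) *\<^sub>R g x)" for a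
    using weight_products(1)[of g v f a, OF _ _ _ vf0(1) v6 vf0(2) f3 g_le] by simp
  have int_h: "integrable lborel (\<lambda>x. (1 + sqdist a x) powr (- 1) *\<^sub>R h x)" for a
    using weight_products(2)[of h v f a, OF _ _ _ vf0(1) v6 vf0(2) f3] h_norm by simp

  define L where "L j w = dirac_alpha (\<sigma> j) *v w" for j w
  define J where "J w = \<i> *s w" for w :: "complex ^ 4"
  have L: "bounded_linear (L j)" for j unfolding L_def by (rule dirac_alpha_bounded_linear)
  have J: "bounded_linear J" unfolding J_def by (rule imaginary_unit_bounded_linear)
  have anticomm: "L j (L k w) + L k (L j w) = (if j = k then 2 else 0) *\<^sub>R w" for j k w
    unfolding L_def by (rule dirac_alpha_anticommute[OF assms(1)])
  have eq_u: "- (\<Sum>j\<in>UNIV. \<integral>x. partial j (partial j \<phi>) x *\<^sub>R u0 x \<partial>lborel) = (\<integral>x. \<phi> x *\<^sub>R g x \<partial>lborel)"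
    if \<phi>: "test_function \<phi>" for \<phi>
  proof -
    have 1: "regular_distr u (partial j (partial j \<phi>)) = (\<integral>x. partial j (partial j \<phi>) x *\<^sub>R u0 x \<partial>lborel)" for j
      by (rule regular_distr_lborel[OF _ u0 u_meas u_ae]) (rule test_function_measurable[OF \<phi>])
    have 2: "regular_distr (\<lambda>x. (norm (\<psi> x))\<^sup>2 * u x) \<phi> = (\<integral>x. \<phi> x *\<^sub>R (6 * g x) \<partial>lborel)"
    proof (rule regular_distr_lborel[OF test_function_measurable(1)[OF \<phi>]])
      show "(\<lambda>x. (norm (\<psi> x))\<^sup>2 * u x) \<in> borel_measurable lebesgue"
        using u_meas \<psi>_meas by measurable
      show "AE x in lborel. (norm (\<psi> x))\<^sup>2 * u x = 6 * g x"
        using u_ae \<psi>_ae by eventually_elim (simp add: g_def)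
    qed measurable
    have "- 6 * distr_laplacian (regular_distr u) \<phi> = regular_distr (\<lambda>x. (norm (\<psi> x))\<^sup>2 * u x) \<phi>"
      using assms(4) \<phi> by (simp add: distr_eq_def)
    moreover have "distr_laplacian (regular_distr u) \<phi> = (\<Sum>j\<in>UNIV. \<integral>x. partial j (partial j \<phi>) x *\<^sub>R u0 x \<partial>lborel)"
      by (simp add: distr_laplacian_def distr_partial_def 1)
    moreover have "(\<integral>x. \<phi> x *\<^sub>R (6 * g x) \<partial>lborel) = 6 * (\<integral>x. \<phi> x *\<^sub>R g x \<partial>lborel)"
      by (subst integral_mult_right_zero[symmetric]) (simp add: mult_ac)
    ultimately show ?thesis unfolding 2 by linarith
  qed
  have eq_\<psi>: "(\<Sum>j\<in>UNIV. L j (\<integral>x. partial j \<phi> x *\<^sub>R \<psi>0 x \<partial>lborel)) = - J (\<integral>x. \<phi> x *\<^sub>R h x \<partial>lborel)"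
    if \<phi>: "test_function \<phi>" for \<phi>
  proof -
    interpret L: bounded_linear "L j" for j by (rule L)
    have 1: "regular_distr \<psi> (partial j \<phi>) = (\<integral>x. partial j \<phi> x *\<^sub>R \<psi>0 x \<partial>lborel)" for j
      by (rule regular_distr_lborel[OF _ \<psi>0 \<psi>_meas \<psi>_ae]) (rule test_function_measurable[OF \<phi>])
    have 2: "regular_distr (\<lambda>x. \<bar>u x\<bar>\<^sup>2 *\<^sub>R \<psi> x) \<phi> = (\<integral>x. \<phi> x *\<^sub>R h x \<partial>lborel)"
    proof (rule regular_distr_lborel[OF test_function_measurable(1)[OF \<phi>]])
      show "(\<lambda>x. \<bar>u x\<bar>\<^sup>2 *\<^sub>R \<psi> x) \<in> borel_measurable lebesgue"
        using u_meas \<psi>_meas by measurable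
      show "AE x in lborel. \<bar>u x\<bar>\<^sup>2 *\<^sub>R \<psi> x = h x"
        using u_ae \<psi>_ae by eventually_elim (simp add: h_def)
    qed measurable
    have "distr_dirac \<sigma> (regular_distr \<psi>) \<phi> = regular_distr (\<lambda>x. \<bar>u x\<bar>\<^sup>2 *\<^sub>R \<psi> x) \<phi>"
      using assms(5) \<phi> by (simp add: distr_eq_def)
    moreover have "distr_dirac \<sigma> (regular_distr \<psi>) \<phi> = J (\<Sum>j\<in>UNIV. L j (\<integral>x. partial j \<phi> x *\<^sub>R \<psi>0 x \<partial>lborel))"
      unfolding distr_dirac_def distr_partial_def 1 L_def[symmetric] L.neg sum_negf J_def by (simp add: vec_eq_iff)
    \<comment> \<open>Since J applied twice is -1, one more application isolates the sum in the form
      required by \<open>dirac_representation\<close>.\<close>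
    ultimately have "J (J (\<Sum>j\<in>UNIV. L j (\<integral>x. partial j \<phi> x *\<^sub>R \<psi>0 x \<partial>lborel))) = J (\<integral>x. \<phi> x *\<^sub>R h x \<partial>lborel)"
      unfolding 2 by simp
    moreover have "J (J w) = - w" for w
      unfolding J_def by (simp add: vec_eq_iff flip: mult.assoc)
    ultimately show ?thesis by (simp add: minus_equation_iff)
  qed
  define m where "m = poisson_mass"
  have m: "m > 0" unfolding m_def by (rule poisson_mass_pos)
  define M where "M k w = - L k (J w)" for k w
  have M: "bounded_linear (M k)" for k
    unfolding M_def using bounded_linear_minus[OF bounded_linear_compose[OF L J]] by simp
  define N1 where "N1 z = (norm z)\<^sup>2" for z :: "real ^ 3"
  have N1: "1 / norm z = N1 z / norm z ^ 3" for z by (simp add: N1_def eval_nat_numeral)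
  define U where "U a = (1 / m) * (\<integral>y. (1 / norm (y - a)) *\<^sub>R g y \<partial>lborel)" for a
  define \<Psi> where "\<Psi> a = (1 / m) *\<^sub>R (\<Sum>k\<in>UNIV. M k (\<integral>y. ((y - a) $ k / norm (y - a) ^ 3) *\<^sub>R h y \<partial>lborel))" for a
  have "AE a in lborel. poisson_mass *\<^sub>R u0 a = (\<integral>y. (1 / norm (y - a)) *\<^sub>R g y \<partial>lborel)"
    by (rule newton_representation[OF _ _ int_u int_g eq_u]) simp_all
  then have U_ae: "AE a in lborel. u0 a = U a"
  proof eventually_elim
    case (elim a)
    show ?case unfolding U_def elim[symmetric] m_def[symmetric] using m by simp
  qed
  have "AE a in lborel. poisson_mass *\<^sub>R \<psi>0 a
      = (\<Sum>k\<in>UNIV. - L k (J (\<integral>y. ((y - a) $ k / norm (y - a) ^ 3) *\<^sub>R h y \<partial>lborel)))"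
    by (rule dirac_representation[OF _ _ int_\<psi> int_h L J anticomm eq_\<psi>]) simp_all
  then have \<Psi>_ae: "AE a in lborel. \<psi>0 a = \<Psi> a"
  proof eventually_elim
    case (elim a)
    show ?case unfolding \<Psi>_def M_def elim[symmetric] m_def[symmetric] using m by simp
  qed

  obtain K where K: "\<And>k w. norm (M k w) \<le> norm w * K k"
    using bounded_linear.bounded[OF M] by metis
  define Kc where "Kc = (\<Sum>k\<in>UNIV. \<bar>K k\<bar>)"
  \<comment> \<open>One constant for both inequalities: the first asks for c \<ge> 1 / (6 m), the
    second for c^2 \<ge> Kc / m, and the summand 1 ensures c \<le> c^2.\<close>
  define c where "c = 1 + 1 / (6 * m) + Kc / m"
  have Kc: "Kc \<ge> 0" by (simp add: Kc_def sum_nonneg)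
  have c: "c > 0" "1 / (6 * m) \<le> c" "Kc / m \<le> c\<^sup>2"
  proof -
    have "0 \<le> 1 / (6 * m)" "0 \<le> Kc / m" using m Kc by auto
    then have "1 \<le> c" "1 / (6 * m) \<le> c" "Kc / m \<le> c" by (auto simp: c_def)
    moreover have "c \<le> c\<^sup>2" using \<open>1 \<le> c\<close> power_increasing[of 1 2 c] by simp
    ultimately show "c > 0" "1 / (6 * m) \<le> c" "Kc / m \<le> c\<^sup>2" by linarith+
  qed
  have v_le: "AE x in lborel. ennreal (v x) \<le> (\<integral>\<^sup>+y. ennreal (c * (1 / norm (x - y)) * ((f y)\<^sup>2 * v y)) \<partial>lborel)"
    using U_ae
  proof eventually_elim
    case (elim x)
    have v_eq: "v x = norm (\<integral>y. (1 / m) *\<^sub>R ((1 / norm (y - x)) *\<^sub>R g y) \<partial>lborel)"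
    proof -
      have "(\<integral>y. (1 / m) *\<^sub>R ((1 / norm (y - x)) *\<^sub>R g y) \<partial>lborel)
          = (1 / m) *\<^sub>R (\<integral>y. (1 / norm (y - x)) *\<^sub>R g y \<partial>lborel)"
        by (rule integral_scaleR_right)
      then show ?thesis unfolding v_def elim U_def by (simp only: real_scaleR_def real_norm_def)
    qed
    have "ennreal (v x) \<le> (\<integral>\<^sup>+y. ennreal (norm ((1 / m) *\<^sub>R ((1 / norm (y - x)) *\<^sub>R g y))) \<partial>lborel)"
      unfolding v_eq by (rule norm_integral_le_nn_integral)
    also have "\<dots> \<le> (\<integral>\<^sup>+y. ennreal (c * (1 / norm (x - y)) * ((f y)\<^sup>2 * v y)) \<partial>lborel)"
    proof (intro nn_integral_mono ennreal_leI)
      fix y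
      have "norm ((1 / m) *\<^sub>R ((1 / norm (y - x)) *\<^sub>R g y)) = 1 / (6 * m) * ((1 / norm (x - y)) * ((f y)\<^sup>2 * v y))"
        using m by (simp only: norm_scaleR g_norm) (simp add: norm_minus_commute)
      also have "\<dots> \<le> c * ((1 / norm (x - y)) * ((f y)\<^sup>2 * v y))"
        using vf0 by (intro mult_right_mono c) auto
      finally show "norm ((1 / m) *\<^sub>R ((1 / norm (y - x)) *\<^sub>R g y)) \<le> c * (1 / norm (x - y)) * ((f y)\<^sup>2 * v y)"
        by (simp only: mult.assoc)
    qed
    finally show ?case .
  qed
  have f_le: "AE x in lborel. ennreal (f x) \<le> (\<integral>\<^sup>+y. ennreal ((c * (1 / norm (x - y)))\<^sup>2 * ((v y)\<^sup>2 * f y)) \<partial>lborel)"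
    using \<Psi>_ae
  proof eventually_elim
    case (elim x)
    define I where "I = (\<integral>\<^sup>+y. ennreal ((1 / norm (x - y))\<^sup>2 * ((v y)\<^sup>2 * f y)) \<partial>lborel)"
    let ?V = "\<lambda>k. \<integral>y. ((y - x) $ k / norm (y - x) ^ 3) *\<^sub>R h y \<partial>lborel"
    have V: "ennreal (norm (?V k)) \<le> I" for k
    proof -
      have "ennreal (norm (?V k)) \<le> (\<integral>\<^sup>+y. ennreal (norm (((y - x) $ k / norm (y - x) ^ 3) *\<^sub>R h y)) \<partial>lborel)"
        by (rule norm_integral_le_nn_integral)
      also have "\<dots> \<le> I"
        unfolding I_def
      proof (intro nn_integral_mono ennreal_leI)
        fix y
        have "\<bar>(y - x) $ k / norm (y - x) ^ 3\<bar> \<le> (1 / norm (y - x)) ^ 2"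
          by (rule potential_kernel_bound[where N = "\<lambda>z. z $ k"]) (simp_all add: component_le_norm_cart[of "y - x" k, simplified])
        then show "norm (((y - x) $ k / norm (y - x) ^ 3) *\<^sub>R h y) \<le> (1 / norm (x - y))\<^sup>2 * ((v y)\<^sup>2 * f y)"
          unfolding norm_scaleR h_norm real_norm_def norm_minus_commute[of x y]
          using vf0 by (intro mult_right_mono) auto
      qed
      finally show ?thesis .
    qed
    have "f x \<le> (1 / m) * (\<Sum>k\<in>UNIV. \<bar>K k\<bar> * norm (?V k))"
    proof -
      have "f x = (1 / m) * norm (\<Sum>k\<in>UNIV. M k (?V k))" using elim m by (simp add: f_def \<Psi>_def)
      also have "norm (\<Sum>k\<in>UNIV. M k (?V k)) \<le> (\<Sum>k\<in>UNIV. \<bar>K k\<bar> * norm (?V k))"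
      proof (intro order_trans[OF norm_sum] sum_mono)
        fix k
        have "norm (M k (?V k)) \<le> norm (?V k) * K k" by (rule K)
        also have "\<dots> \<le> norm (?V k) * \<bar>K k\<bar>" by (intro mult_left_mono) auto
        finally show "norm (M k (?V k)) \<le> \<bar>K k\<bar> * norm (?V k)" by (simp add: mult.commute)
      qed
      finally show ?thesis using m by (simp add: divide_right_mono)
    qed
    then have "ennreal (f x) \<le> ennreal ((1 / m) * (\<Sum>k\<in>UNIV. \<bar>K k\<bar> * norm (?V k)))" by (rule ennreal_leI)
    also have "\<dots> = ennreal (1 / m) * (\<Sum>k\<in>UNIV. ennreal \<bar>K k\<bar> * ennreal (norm (?V k)))"
      using m by (subst ennreal_mult) (auto intro!: sum_nonneg simp: sum_ennreal[symmetric] ennreal_mult)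
    also have "\<dots> \<le> ennreal (1 / m) * (\<Sum>k\<in>UNIV. ennreal \<bar>K k\<bar> * I)"
      by (intro mult_left_mono sum_mono V) auto
    also have "\<dots> = ennreal (Kc / m) * I"
      unfolding sum_distrib_right[symmetric] mult.assoc[symmetric] Kc_def
      using m by (subst sum_ennreal) (auto simp: ennreal_mult[symmetric] sum_nonneg)
    also have "\<dots> \<le> ennreal (c\<^sup>2) * I" by (intro mult_right_mono ennreal_leI c) auto
    also have "\<dots> = (\<integral>\<^sup>+y. ennreal (c\<^sup>2) * ennreal ((1 / norm (x - y))\<^sup>2 * ((v y)\<^sup>2 * f y)) \<partial>lborel)"
      unfolding I_def by (rule nn_integral_cmult[symmetric]) measurable
    also have "\<dots> = (\<integral>\<^sup>+y. ennreal ((c * (1 / norm (x - y)))\<^sup>2 * ((v y)\<^sup>2 * f y)) \<partial>lborel)"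
    proof (intro nn_integral_cong)
      fix y
      have "ennreal (c\<^sup>2) * ennreal ((1 / norm (x - y))\<^sup>2 * ((v y)\<^sup>2 * f y)) = ennreal (c\<^sup>2 * ((1 / norm (x - y))\<^sup>2 * ((v y)\<^sup>2 * f y)))"
        using vf0 by (intro ennreal_mult[symmetric]) auto
      then show "ennreal (c\<^sup>2) * ennreal ((1 / norm (x - y))\<^sup>2 * ((v y)\<^sup>2 * f y)) = ennreal ((c * (1 / norm (x - y)))\<^sup>2 * ((v y)\<^sup>2 * f y))"
        by (simp only: power_mult_distrib mult.assoc)
    qed
    finally show ?case .
  qed
  obtain B where B: "B > 0" and decay: "AE x in lborel. v x * (1 + norm x) \<le> B \<and> f x * (1 + (norm x)\<^sup>2) \<le> B"
    using decay_from_integral_inequalities[OF _ _ vf0 v6 f3 c(1) v_le f_le] by auto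
  have g_bd: "AE y in lborel. norm (g y) \<le> B ^ 3 * (1 + sqdist 0 y) powr - 2"
    using decay
  proof eventually_elim
    case (elim y)
    then show ?case using decay_products(1)[OF vf0(1) _ vf0(2)] g_le order_trans by blast
  qed
  have g_bd': "AE y in lborel. norm y * norm (g y) \<le> B ^ 3 * (1 + sqdist 0 y) powr - 2"
    using decay
  proof eventually_elim
    case (elim y)
    have "norm y * norm (g y) \<le> norm y * ((f y)\<^sup>2 * v y)" by (intro mult_left_mono g_le) auto
    then show ?case using decay_products(2)[OF vf0(1) _ vf0(2)] elim order_trans by blast
  qed
  have h_bd: "AE y in lborel. norm (h y) \<le> B ^ 3 * (1 + sqdist 0 y) powr - 2"
    using decay
  proof eventually_elim
    case (elim y)
    then show ?case unfolding h_norm using decay_products(3)[OF vf0(1) _ vf0(2)] by blast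
  qed
  have B3: "B ^ 3 \<ge> 0" using B by simp
  have U_cont: "continuous_on UNIV U"
    unfolding U_def N1
    by (intro continuous_on_mult continuous_on_const potential_continuous[where p = 1, OF _ _ _ _ g_bd B3])
      (auto simp: N1_def intro!: continuous_intros)
  have \<Psi>_cont: "continuous_on UNIV \<Psi>"
  proof -
    have "continuous_on UNIV (\<lambda>a. \<integral>y. ((y - a) $ k / norm (y - a) ^ 3) *\<^sub>R h y \<partial>lborel)" for k
      by (rule potential_continuous[where p = 2 and N = "\<lambda>z. z $ k", OF _ _ _ _ h_bd B3])
        (auto intro!: continuous_intros component_le_norm_cart)
    then show ?thesis
      unfolding \<Psi>_def
      by (intro continuous_on_scaleR continuous_on_const continuous_on_sum bounded_linear.continuous_on[OF M])
  qed
  have U_bd: "\<bar>U x\<bar> \<le> B / (1 + norm x)" for x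
  proof -
    have "\<bar>U x\<bar> * (1 + norm x) \<le> B"
    proof (rule AE_le_continuous[of "\<lambda>x. \<bar>U x\<bar> * (1 + norm x)"])
      show "AE x in lborel. \<bar>U x\<bar> * (1 + norm x) \<le> B"
        using decay U_ae by eventually_elim (simp add: v_def)
    qed (intro continuous_intros U_cont)
    moreover have "1 + norm x > 0" by (simp add: add_pos_nonneg)
    ultimately show ?thesis by (simp add: pos_le_divide_eq)
  qed
  have \<Psi>_bd: "norm (\<Psi> x) \<le> B / (1 + (norm x)\<^sup>2)" for x
  proof -
    have "norm (\<Psi> x) * (1 + (norm x)\<^sup>2) \<le> B"
    proof (rule AE_le_continuous[of "\<lambda>x. norm (\<Psi> x) * (1 + (norm x)\<^sup>2)"])
      show "AE x in lborel. norm (\<Psi> x) * (1 + (norm x)\<^sup>2) \<le> B"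
        using decay \<Psi>_ae by eventually_elim (simp add: f_def)
    qed (intro continuous_intros \<Psi>_cont)
    moreover have "1 + (norm x)\<^sup>2 > 0" by (simp add: add_pos_nonneg)
    ultimately show ?thesis by (simp add: pos_le_divide_eq)
  qed
  define \<alpha> where "\<alpha> = (1 / m) * (\<integral>y. g y \<partial>lborel)"
  have lim: "((\<lambda>x. (1 + norm x) * U x) \<longlongrightarrow> \<alpha>) at_infinity"
  proof -
    have "((\<lambda>x. (1 / m) * (norm x * (\<integral>y. (1 / norm (y - x)) *\<^sub>R g y \<partial>lborel))) \<longlongrightarrow> \<alpha>) at_infinity"
      unfolding \<alpha>_def by (intro tendsto_mult tendsto_const newton_potential_limit[OF _ g_bd g_bd' B3]) simp
    then have 1: "((\<lambda>x. norm x * U x) \<longlongrightarrow> \<alpha>) at_infinity" by (simp add: U_def mult.left_commute)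
    have "((\<lambda>x :: real ^ 3. B * inverse (norm x)) \<longlongrightarrow> B * 0) at_infinity"
      by (intro tendsto_mult tendsto_const tendsto_inverse_0_at_top filterlim_norm_at_top)
    then have 2: "((\<lambda>x :: real ^ 3. B / norm x) \<longlongrightarrow> 0) at_infinity" by (simp add: divide_inverse)
    \<comment> \<open>The factor 1 + |x| differs from the |x| of
      \<open>newton_potential_limit\<close> by a summand U, which tends to 0.\<close>
    have 3: "(U \<longlongrightarrow> 0) at_infinity"
    proof (rule Lim_null_comparison[OF _ 2])
      have "norm (U x) \<le> B / norm x" if "1 \<le> norm x" for x
      proof -
        have "norm (U x) \<le> B / (1 + norm x)" using U_bd by simp
        also have "\<dots> \<le> B / norm x" using that B by (intro divide_left_mono mult_pos_pos add_pos_nonneg) auto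
        finally show ?thesis .
      qed
      then show "\<forall>\<^sub>F x in at_infinity. norm (U x) \<le> B / norm x"
        unfolding eventually_at_infinity by blast
    qed
    show ?thesis using tendsto_add[OF 3 1] by (simp add: distrib_right)
  qed
  have pos: "\<alpha> \<ge> 0 \<and> (\<alpha> = 0 \<longrightarrow> (\<forall>x. U x = 0) \<and> (\<forall>x. \<Psi> x = 0))" if nonneg: "\<forall>x. 0 \<le> U x"
  proof -
    have g_nn: "AE y in lborel. 0 \<le> g y"
      using U_ae by eventually_elim (use nonneg in \<open>simp add: g_def\<close>)
    have g_int: "integrable lborel g" by (rule decaying_integrable[OF _ g_bd]) measurable
    have "\<alpha> \<ge> 0" unfolding \<alpha>_def using m integral_nonneg_AE[OF g_nn] by simp
    moreover have "(\<forall>x. U x = 0) \<and> (\<forall>x. \<Psi> x = 0)" if "\<alpha> = 0"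
    proof -
      have "(\<integral>y. g y \<partial>lborel) = 0" using that m by (simp add: \<alpha>_def)
      then have g0: "AE y in lborel. g y = 0" using integral_nonneg_eq_0_iff_AE[OF g_int g_nn] by simp
      have U0: "U x = 0" for x
      proof -
        have "(\<integral>y. (1 / norm (y - x)) *\<^sub>R g y \<partial>lborel) = 0"
          using g0 by (intro integral_eq_zero_AE) (auto elim!: eventually_mono)
        then show ?thesis by (simp add: U_def)
      qed
      \<comment> \<open>Almost everywhere u0 = U = 0, and h carries the factor u0^2; through the
        second integral equation this forces \<Psi> to vanish as well.\<close>
      then have h0: "AE y in lborel. h y = 0" using U_ae by (auto simp: h_def elim!: eventually_mono)
      have "\<Psi> x = 0" for x
      proof -
        have z: "(\<integral>y. ((y - x) $ k / norm (y - x) ^ 3) *\<^sub>R h y \<partial>lborel) = 0" for k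
          using h0 by (intro integral_eq_zero_AE) (auto elim!: eventually_mono)
        show ?thesis unfolding \<Psi>_def z using linear_simps(3)[OF M] by simp
      qed
      with U0 show ?thesis by blast
    qed
    ultimately show ?thesis by blast
  qed
  have "AE x in lborel. U x = u x" using U_ae u_ae by eventually_elim simp
  moreover have "AE x in lborel. \<Psi> x = \<psi> x" using \<Psi>_ae \<psi>_ae by eventually_elim simp
  ultimately show ?thesis
    using U_cont \<Psi>_cont U_bd \<Psi>_bd B lim pos
    by (intro exI[of _ U] exI[of _ \<Psi>] conjI AE_lebesgueI) blast+
qed

end
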